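(* Let $n\ge 11$ and $p\ge p_c(n)$, where $p_c(n)=\frac{(n-2)^2-4n+8\sqrt{n-1}}{(n-2)(n-10)}$. Let $\psi\in C^2([0,+\infty))$ be positive on $(0,+\infty)$ with $\psi(0)=\psi''(0)=0$, $\psi'(0)=1$, $\psi'(r)\ge 0$ for every $r>0$, and $\liminf_{r\to+\infty}\frac{\psi'(r)}{\psi(r)}>0$. For any $\alpha\ge 0$ denote by $u_\alpha$ the unique solution of $$-\frac{1}{\psi(r)^{n-1}}\left[\psi(r)^{n-1}u'(r)\right]'=|u(r)|^{p-1}u(r)\quad(r>0),\qquad u(0)=\alpha,\quad u'(0)=0.$$ Then there exists $\alpha_0\in(0,+\infty]$ such that either $\alpha_0=+\infty$ and $u_\alpha$ is stable for any $\alpha\ge 0$, or $\alpha_0<+\infty$ and $u_\alpha$ is stable for any $\alpha\in[0,\alpha_0]$ and unstable for any $\alpha>\alpha_0$.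
   Context: $(M,g)$ is the $n$-dimensional Riemannian model with pole $o$ and metric $ds^2=dr^2+\psi(r)^2d\Theta^2$ in polar coordinates $(r,\Theta)\in(0,\infty)\times\mathbb{S}^{n-1}$ around $o$ ($M$ is diffeomorphic to $\mathbb{R}^n$); $V_g$ and $\nabla_g$ are the Riemannian measure and gradient. The function $u_\alpha$ is viewed as a radial function on $M$ ($r$ = distance from $o$); it is globally defined and is a radial solution of $-\Delta_g u=|u|^{p-1}u$ on $M$. A solution $u\in C^2(M)$ of this equation is stable if $\int_M|\nabla_g\varphi|_g^2\,dV_g-p\int_M|u|^{p-1}\varphi^2\,dV_g\ge 0$ for all $\varphi\in C_c^\infty(M)$, and unstable otherwise. *)

theory Defs
  imports "HOL-Analysis.Analysis"
begin

definition p_c :: "nat \<Rightarrow> real" where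
  "p_c n = ((real n - 2)\<^sup>2 - 4 * real n + 8 * sqrt (real n - 1)) / ((real n - 2) * (real n - 10))"

text \<open>
  The model manifold is \<^typ>\<open>real ^ 'n\<close> with pole \<open>0\<close>: polar coordinates \<open>(r, \<Theta>)\<close> correspond to
  the point \<open>r \<Theta>\<close>. In this global chart \<open>dr\<close> is the inner product with the unit vector
  \<open>sgn x\<close>, and \<open>d\<Theta>\<^sup>2\<close> is the Euclidean metric on the tangential part divided by \<open>r\<^sup>2\<close>. At the
  pole the metric is its limit, the Euclidean one, since \<open>\<psi>(r)/r\<close> tends to \<open>\<psi>'(0) = 1\<close>.
\<close>

definition model_metric :: "(real \<Rightarrow> real) \<Rightarrow> real ^ 'n \<Rightarrow> real ^ 'n \<Rightarrow> real ^ 'n \<Rightarrow> real" where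
  "model_metric \<psi> x v w =
     (if x = 0 then v \<bullet> w
      else (v \<bullet> sgn x) * (w \<bullet> sgn x)
           + (\<psi> (norm x))\<^sup>2 * ((v \<bullet> w - (v \<bullet> sgn x) * (w \<bullet> sgn x)) / (norm x)\<^sup>2))"

definition riemannian_volume ::
    "(real ^ 'n \<Rightarrow> real ^ 'n \<Rightarrow> real ^ 'n \<Rightarrow> real) \<Rightarrow> (real ^ 'n) measure" where
  "riemannian_volume g =
     density lborel (\<lambda>x. ennreal (sqrt (det (\<chi> i j. g x (axis i 1) (axis j 1)))))"

definition riemannian_gradient ::
    "(real ^ 'n \<Rightarrow> real ^ 'n \<Rightarrow> real ^ 'n \<Rightarrow> real) \<Rightarrow> (real ^ 'n \<Rightarrow> real) \<Rightarrow> real ^ 'n \<Rightarrow> real ^ 'n" where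
  "riemannian_gradient g \<phi> x = (THE w. \<forall>v. g x w v = frechet_derivative \<phi> (at x) v)"

primrec C_k :: "nat \<Rightarrow> ('a::real_normed_vector \<Rightarrow> 'b::real_normed_vector) \<Rightarrow> bool" where
  "C_k 0 f \<longleftrightarrow> continuous_on UNIV f"
| "C_k (Suc k) f \<longleftrightarrow>
     (\<forall>x. f differentiable (at x)) \<and> (\<forall>v. C_k k (\<lambda>x. frechet_derivative f (at x) v))"

definition test_function :: "('a::real_normed_vector \<Rightarrow> real) \<Rightarrow> bool" where
  "test_function \<phi> \<longleftrightarrow> (\<forall>k. C_k k \<phi>) \<and> compact (closure {x. \<phi> x \<noteq> 0})"

definition stable_solution ::
    "(real ^ 'n \<Rightarrow> real ^ 'n \<Rightarrow> real ^ 'n \<Rightarrow> real) \<Rightarrow> real \<Rightarrow> (real ^ 'n \<Rightarrow> real) \<Rightarrow> bool" where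
  "stable_solution g p U \<longleftrightarrow>
     (\<forall>\<phi>. test_function \<phi> \<longrightarrow>
        (LINT x|riemannian_volume g. g x (riemannian_gradient g \<phi> x) (riemannian_gradient g \<phi> x))
        - p * (LINT x|riemannian_volume g. \<bar>U x\<bar> powr (p - 1) * (\<phi> x)\<^sup>2) \<ge> 0)"

abbreviation unstable_solution ::
    "(real ^ 'n \<Rightarrow> real ^ 'n \<Rightarrow> real ^ 'n \<Rightarrow> real) \<Rightarrow> real \<Rightarrow> (real ^ 'n \<Rightarrow> real) \<Rightarrow> bool" where
  "unstable_solution g p U \<equiv> \<not> stable_solution g p U"

text \<open>
  Solutions live on \<open>[0, \<infinity>)\<close>; values at negative arguments are irrelevant. No continuity of
  \<open>u'\<close> or \<open>u''\<close> is required, as it follows from the equation and the initial conditions.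
\<close>

definition radial_solution ::
    "nat \<Rightarrow> real \<Rightarrow> (real \<Rightarrow> real) \<Rightarrow> real \<Rightarrow> (real \<Rightarrow> real) \<Rightarrow> bool" where
  "radial_solution n p \<psi> \<alpha> u \<longleftrightarrow>
     (\<exists>u'. (\<forall>r\<ge>0. (u has_real_derivative u' r) (at r within {0..})) \<and>
           (\<forall>r>0. \<exists>D. ((\<lambda>s. \<psi> s ^ (n - 1) * u' s) has_real_derivative D) (at r) \<and>
                       - (1 / \<psi> r ^ (n - 1)) * D = \<bar>u r\<bar> powr (p - 1) * u r) \<and>
           u 0 = \<alpha> \<and> u' 0 = 0)"

end

theory Submission
  imports Defs
begin

text \<open>
  Write \<open>f(t) = |t|\<^sup>p\<^sup>-\<^sup>1 t\<close>. Since \<open>p_c(n) > 1\<close>, the function \<open>f\<close> is strictly convex on the positive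
  axis, and this drives the proof: the set of \<open>\<alpha> \<ge> 0\<close> for which \<open>u\<^sub>\<alpha>\<close> is stable contains a
  neighbourhood of \<open>0\<close> in \<open>[0, \<infinity>)\<close>, is downward closed, and is closed. Such a set is \<open>[0, \<infinity>)\<close> or
  \<open>[0, \<alpha>\<^sub>0]\<close> with \<open>\<alpha>\<^sub>0 > 0\<close> (\<open>downward_closed_threshold\<close>).

  \<^item> Small \<open>\<alpha>\<close>. The conditions on \<open>\<psi>'\<close> bound the volume of a geodesic ball by a multiple of the area
  of its boundary sphere. Integrating the radial field whose divergence is \<open>1\<close> gives a Poincare
  inequality on the whole model (\<open>poincare_inequality\<close>). An energy that decreases along the equation
  gives \<open>|u\<^sub>\<alpha>| \<le> \<alpha>\<close>, so the potential \<open>p |u\<^sub>\<alpha>|\<^sup>p\<^sup>-\<^sup>1\<close> lies below the Poincare constant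
  when \<open>\<alpha>\<close> is small (\<open>stable_solution_small\<close>).

  \<^item> Downward closed. Let \<open>u\<^sub>\<alpha>\<close> be stable and \<open>0 < \<beta> < \<alpha>\<close>. If \<open>0 < u\<^sub>\<beta> < u\<^sub>\<alpha>\<close> fails, let \<open>R\<close> be the first
  radius where it does. Then \<open>z = u\<^sub>\<beta>\<close> or \<open>z = u\<^sub>\<alpha> - u\<^sub>\<beta>\<close> vanishes at \<open>R\<close>, and in both cases
  \<open>-(\<Delta> z) z < p u\<^sub>\<alpha>\<^sup>p\<^sup>-\<^sup>1 z\<^sup>2\<close> inside the ball of radius \<open>R\<close>, in the second case by convexity. So \<open>z\<close>,
  extended by zero, makes the quadratic form of \<open>u\<^sub>\<alpha>\<close> negative, a contradiction
  (\<open>unstable_if_subsolution_vanishes\<close>, \<open>stable_solution_dominates_smaller\<close>). Hence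
  \<open>0 < u\<^sub>\<beta> < u\<^sub>\<alpha>\<close> everywhere, the potential of \<open>u\<^sub>\<beta>\<close> is the smaller one, and \<open>u\<^sub>\<beta>\<close> is stable.

  \<^item> Closed. On bounded sets \<open>u\<^sub>\<alpha>\<close> depends continuously on \<open>\<alpha>\<close>
  (\<open>lane_emden_continuous_dependence\<close>), and test functions have compact support.

  The test function \<open>z\<close> above is only Lipschitz, whereas stability quantifies over smooth functions. In
  \<open>stable_solution_tested_on_ball\<close> it is approximated by \<open>P(|x|\<^sup>2) exp(-\<delta>/(R\<^sup>2 - |x|\<^sup>2))\<close> with
  polynomials \<open>P\<close> that vanish at \<open>R\<^sup>2\<close>. All integrations by parts rest on one identity in the global
  chart, \<open>integral_radial_divergence_eq_0\<close>, which replaces integration in polar coordinates.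
\<close>

section \<open>The power nonlinearity and limits at the origin\<close>

lemma power_nonlinearity_deriv:
  fixes p t :: real
  assumes "p > 1"
  shows "((\<lambda>t. \<bar>t\<bar> powr (p - 1) * t) has_real_derivative p * \<bar>t\<bar> powr (p - 1)) (at t)"
proof -
  consider "t > 0" | "t < 0" | "t = 0" by linarith
  then show ?thesis
  proof cases
    case 1
    have "((\<lambda>t. t powr p) has_real_derivative p * t powr (p - 1)) (at t)"
      using 1 by (rule has_real_derivative_powr)
    then show ?thesis
    proof (rule DERIV_cong[OF has_field_derivative_transform_within_open[where S = "{0<..}"]])
      show "x powr p = \<bar>x\<bar> powr (p - 1) * x" if "x \<in> {0<..}" for x
        using that powr_mult_base[of x "p - 1"] by (simp add: mult.commute)
    qed (use 1 in auto)
  next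
    case 2
    have "((\<lambda>t. t powr p) has_real_derivative p * (-t) powr (p - 1)) (at (-t))"
      using 2 by (intro has_real_derivative_powr) simp
    then have "((\<lambda>t. - ((-t) powr p)) has_real_derivative p * (-t) powr (p - 1)) (at t)"
      using 2 by (auto intro!: derivative_eq_intros)
    then show ?thesis
    proof (rule DERIV_cong[OF has_field_derivative_transform_within_open[where S = "{..<0}"]])
      show "- ((-x) powr p) = \<bar>x\<bar> powr (p - 1) * x" if "x \<in> {..<0}" for x
        using that powr_mult_base[of "-x" "p - 1"] by (simp add: mult.commute)
    qed (use 2 in auto)
  next
    case 3
    have "((\<lambda>h::real. \<bar>h\<bar> powr (p - 1)) \<longlongrightarrow> 0 powr (p - 1)) (at 0)"
      by (rule tendsto_powr2) (use assms in \<open>auto intro!: tendsto_eq_intros\<close>)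
    then have "((\<lambda>h::real. \<bar>h\<bar> powr (p - 1) * h / h) \<longlongrightarrow> 0) (at 0)"
      using assms by (subst tendsto_cong) (auto simp: eventually_at_filter powr_0)
    then show ?thesis
      using 3 assms by (simp add: DERIV_def powr_0)
  qed
qed

lemma power_nonlinearity_continuous:
  fixes p :: real
  assumes "p > 1"
  shows "continuous_on A (\<lambda>t. \<bar>t\<bar> powr (p - 1) * t)"
  by (rule DERIV_continuous_on) (rule has_field_derivative_at_within[OF power_nonlinearity_deriv[OF assms]])

lemma power_nonlinearity_lipschitz:
  fixes p A s t :: real
  assumes "p > 1" "\<bar>s\<bar> \<le> A" "\<bar>t\<bar> \<le> A"
  shows "\<bar>\<bar>s\<bar> powr (p - 1) * s - \<bar>t\<bar> powr (p - 1) * t\<bar> \<le> p * A powr (p - 1) * \<bar>s - t\<bar>"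
proof -
  have "norm (\<bar>s\<bar> powr (p - 1) * s - \<bar>t\<bar> powr (p - 1) * t) \<le> p * A powr (p - 1) * norm (s - t)"
  proof (rule field_differentiable_bound[where S = "{-A..A}" and f' = "\<lambda>t. p * \<bar>t\<bar> powr (p - 1)"])
    show "((\<lambda>t. \<bar>t\<bar> powr (p - 1) * t) has_real_derivative p * \<bar>x\<bar> powr (p - 1)) (at x within {-A..A})" for x
      by (rule has_field_derivative_at_within[OF power_nonlinearity_deriv[OF assms(1)]])
    show "norm (p * \<bar>x\<bar> powr (p - 1)) \<le> p * A powr (p - 1)" if "x \<in> {-A..A}" for x
      using that assms by (auto intro!: mult_left_mono powr_mono2)
  qed (use assms in auto)
  then show ?thesis by simp
qed

text \<open>
  Strict convexity: the secant slope between \<open>s\<close> and \<open>t\<close> stays below the slope \<open>p t\<^sup>p\<^sup>-\<^sup>1\<close> at the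
  larger end. For two ordered solutions this compares the equation of their difference with the
  equation linearized at the larger one.
\<close>

lemma power_nonlinearity_convex:
  fixes p s t :: real
  assumes "p > 1" "0 < s" "s < t"
  shows "t powr (p - 1) * t - s powr (p - 1) * s < p * t powr (p - 1) * (t - s)"
proof -
  obtain z where z: "s < z" "z < t" and
    eq: "\<bar>t\<bar> powr (p - 1) * t - \<bar>s\<bar> powr (p - 1) * s = (t - s) * (p * \<bar>z\<bar> powr (p - 1))"
    using MVT2[OF assms(3), of "\<lambda>t. \<bar>t\<bar> powr (p - 1) * t" "\<lambda>t. p * \<bar>t\<bar> powr (p - 1)"]
      power_nonlinearity_deriv[OF assms(1)] by blast
  have "z powr (p - 1) < t powr (p - 1)"
    using z assms by (intro powr_less_mono2) auto
  then have "(t - s) * (p * z powr (p - 1)) < (t - s) * (p * t powr (p - 1))"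
    using assms by simp
  then show ?thesis using eq z assms by (simp add: mult_ac)
qed

lemma le_limit_at_right_if_deriv_nonpos:
  fixes E E' :: "real \<Rightarrow> real"
  assumes lim: "(E \<longlongrightarrow> l) (at_right 0)"
    and deriv: "\<And>r. r > 0 \<Longrightarrow> (E has_real_derivative E' r) (at r)"
    and nonpos: "\<And>r. r > 0 \<Longrightarrow> E' r \<le> 0"
    and "r > 0"
  shows "E r \<le> l"
proof (rule tendsto_lowerbound[OF lim])
  show "\<forall>\<^sub>F s in at_right 0. E r \<le> E s"
    using eventually_at_right_real[OF \<open>r > 0\<close>]
  proof eventually_elim
    case (elim s)
    have "\<exists>y. (E has_real_derivative y) (at x) \<and> y \<le> 0" if "s \<le> x" for x
      using deriv[of x] nonpos[of x] that elim by auto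
    then show ?case
      using elim by (intro DERIV_nonpos_imp_nonincreasing[of s r E]) auto
  qed
qed simp

lemma at_within_nonneg_eq: "at (0::real) within {0..} = at_right 0"
  by (simp add: at_within_Ici_at_right)

lemma limit_at_right_if_continuous:
  fixes g :: "real \<Rightarrow> real"
  assumes "continuous_on {0..} g"
  shows "(g \<longlongrightarrow> g 0) (at_right 0)"
  using assms[unfolded continuous_on_def, rule_format, of 0] by (simp add: at_within_nonneg_eq)

lemma bounded_on_if_limit_at_right:
  fixes h :: "real \<Rightarrow> real"
  assumes "continuous_on {0<..} h" "(h \<longlongrightarrow> l) (at_right 0)"
  obtains M where "M > 0" "\<And>r. 0 < r \<Longrightarrow> r \<le> R \<Longrightarrow> \<bar>h r\<bar> \<le> M"
proof -
  obtain d where d: "d > 0" "\<And>r. 0 < r \<Longrightarrow> r < d \<Longrightarrow> \<bar>h r - l\<bar> < 1"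
    using tendstoD[OF assms(2), of 1] unfolding eventually_at_right_field dist_real_def by auto
  have "compact (h ` {d..R})"
    by (intro compact_continuous_image continuous_on_subset[OF assms(1)]) (use d in auto)
  then have "bounded (h ` {d..R})" by (rule compact_imp_bounded)
  then obtain B where B: "\<And>r. d \<le> r \<Longrightarrow> r \<le> R \<Longrightarrow> \<bar>h r\<bar> \<le> B"
    unfolding bounded_iff by (metis atLeastAtMost_iff image_eqI real_norm_def)
  show thesis
  proof (rule that[of "max (\<bar>l\<bar> + 1) B"])
    show "\<bar>h r\<bar> \<le> max (\<bar>l\<bar> + 1) B" if "0 < r" "r \<le> R" for r
      using d(2)[of r] B[of r] that by (cases "r < d") auto
  qed simp
qed

section \<open>Radial equations on the model\<close>

locale radial_model =
  fixes n :: nat and \<psi> \<psi>' :: "real \<Rightarrow> real"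
  assumes dim_ge_2: "n \<ge> 2"
    and warp_deriv0: "\<And>r. r \<ge> 0 \<Longrightarrow> (\<psi> has_real_derivative \<psi>' r) (at r within {0..})"
    and warp'_continuous: "continuous_on {0..} \<psi>'"
    and warp_pos: "\<And>r. r > 0 \<Longrightarrow> \<psi> r > 0"
    and warp_0: "\<psi> 0 = 0"
    and warp'_0: "\<psi>' 0 = 1"
    and warp'_nonneg: "\<And>r. r > 0 \<Longrightarrow> \<psi>' r \<ge> 0"
begin

lemma warp_deriv: "r > 0 \<Longrightarrow> (\<psi> has_real_derivative \<psi>' r) (at r)"
  using warp_deriv0[of r] at_within_interior[of r "{0..}"] by simp

lemma warp_continuous: "continuous_on {0..} \<psi>"
  by (rule DERIV_continuous_on[where D = \<psi>']) (simp add: warp_deriv0)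

lemma warp_mono: "0 \<le> s \<Longrightarrow> s \<le> r \<Longrightarrow> \<psi> s \<le> \<psi> r"
proof (cases "s = 0")
  case True
  then show "0 \<le> s \<Longrightarrow> s \<le> r \<Longrightarrow> \<psi> s \<le> \<psi> r"
    using warp_pos[of r] warp_0 by (cases "r = 0") auto
next
  case False
  assume "0 \<le> s" "s \<le> r"
  then show "\<psi> s \<le> \<psi> r"
  proof (intro DERIV_nonneg_imp_nondecreasing[of s r \<psi>])
    fix x assume "s \<le> x"
    then show "\<exists>y. (\<psi> has_real_derivative y) (at x) \<and> 0 \<le> y"
      using warp_deriv[of x] warp'_nonneg[of x] False \<open>0 \<le> s\<close> by auto
  qed
qed

lemma warp_power_split: "\<psi> r ^ (n - 1) = \<psi> r * \<psi> r ^ (n - 1 - 1)"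
  using power_minus_mult[of "n - 1" "\<psi> r"] dim_ge_2 by (simp add: mult.commute)

lemma dim_power_split: "(r::real) ^ n = r * r ^ (n - 1)"
  using power_minus_mult[of n r] dim_ge_2 by (simp add: mult.commute)

lemma warp'_limit: "(\<psi>' \<longlongrightarrow> 1) (at_right 0)"
  using limit_at_right_if_continuous[OF warp'_continuous] warp'_0 by simp

lemma warp_limit: "(\<psi> \<longlongrightarrow> 0) (at_right 0)"
  using limit_at_right_if_continuous[OF warp_continuous] warp_0 by simp

lemma warp_quotient_limit: "((\<lambda>r. \<psi> r / r) \<longlongrightarrow> 1) (at_right 0)"
  using warp_deriv0[of 0] warp_0 warp'_0 at_within_nonneg_eq
  by (simp add: has_field_derivative_iff)

text \<open>
  For radial functions \<open>\<Delta>\<^sub>g z = z'' + (n - 1) (\<psi>'/\<psi>) z'\<close>, so this is the equation \<open>-\<Delta>\<^sub>g z = q\<close>. The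
  limit of \<open>z'(r)/r\<close> encodes regularity at the pole: with it, \<open>z\<close> is continuously differentiable
  as a function of \<open>r\<^sup>2\<close> up to \<open>0\<close>.
\<close>

definition radial_poisson :: "(real \<Rightarrow> real) \<Rightarrow> (real \<Rightarrow> real) \<Rightarrow> (real \<Rightarrow> real) \<Rightarrow> bool" where
  "radial_poisson z z' q \<longleftrightarrow>
     continuous_on {0..} z \<and> continuous_on {0..} q \<and>
     (\<forall>r>0. (z has_real_derivative z' r) (at r) \<and>
            (z' has_real_derivative - (real (n - 1) * (\<psi>' r / \<psi> r) * z' r) - q r) (at r)) \<and>
     (\<exists>L. ((\<lambda>r. z' r / r) \<longlongrightarrow> L) (at_right 0))"

lemma radial_poisson_diff:
  assumes "radial_poisson z1 z1' q1" "radial_poisson z2 z2' q2"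
  shows "radial_poisson (\<lambda>r. z1 r - z2 r) (\<lambda>r. z1' r - z2' r) (\<lambda>r. q1 r - q2 r)"
proof -
  obtain L1 L2 where "((\<lambda>r. z1' r / r) \<longlongrightarrow> L1) (at_right 0)" "((\<lambda>r. z2' r / r) \<longlongrightarrow> L2) (at_right 0)"
    using assms unfolding radial_poisson_def by auto
  then have "((\<lambda>r. (z1' r - z2' r) / r) \<longlongrightarrow> L1 - L2) (at_right 0)"
    by (auto simp: diff_divide_distrib intro!: tendsto_diff)
  moreover have "((\<lambda>r. z1' r - z2' r) has_real_derivative
      - (real (n - 1) * (\<psi>' r / \<psi> r) * (z1' r - z2' r)) - (q1 r - q2 r)) (at r)" if r: "r > 0" for r
  proof (rule DERIV_cong[OF DERIV_diff])
    show "(z1' has_real_derivative - (real (n - 1) * (\<psi>' r / \<psi> r) * z1' r) - q1 r) (at r)"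
      "(z2' has_real_derivative - (real (n - 1) * (\<psi>' r / \<psi> r) * z2' r) - q2 r) (at r)"
      using assms r unfolding radial_poisson_def by auto
  qed (simp only: algebra_simps)
  ultimately show ?thesis
    using assms unfolding radial_poisson_def by (blast intro: continuous_on_diff DERIV_diff)
qed

lemma radial_poisson_limits:
  assumes "radial_poisson z z' q"
  shows "(z \<longlongrightarrow> z 0) (at_right 0)" "(z' \<longlongrightarrow> 0) (at_right 0)"
proof -
  show "(z \<longlongrightarrow> z 0) (at_right 0)"
    using assms unfolding radial_poisson_def by (blast intro: limit_at_right_if_continuous)
  obtain L where "((\<lambda>r. z' r / r) \<longlongrightarrow> L) (at_right 0)"
    using assms unfolding radial_poisson_def by auto
  then have "((\<lambda>r. z' r / r * r) \<longlongrightarrow> L * 0) (at_right 0)"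
    by (intro tendsto_mult) auto
  then have "((\<lambda>r. z' r / r * r) \<longlongrightarrow> 0) (at_right 0)" by simp
  then show "(z' \<longlongrightarrow> 0) (at_right 0)"
    by (rule Lim_transform_eventually) (auto simp: eventually_at_filter)
qed

lemma radial_poisson_continuous:
  assumes "radial_poisson z z' q"
  shows "continuous_on {0<..} z" "continuous_on {0<..} z'" "continuous_on {0<..} q"
proof -
  show "continuous_on {0<..} z" "continuous_on {0<..} q"
    using assms unfolding radial_poisson_def by (auto elim: continuous_on_subset)
  show "continuous_on {0<..} z'"
    using assms unfolding radial_poisson_def
    by (auto intro!: continuous_at_imp_continuous_on intro: DERIV_isCont)
qed

text \<open>
  Nothing is known about \<open>u'\<close> near \<open>0\<close> except that it is the derivative of \<open>u\<close>. The flux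
  \<open>\<psi>\<^sup>n\<^sup>-\<^sup>1 u'\<close> has a bounded derivative, and by the mean value theorem \<open>u'\<close> takes, at points tending
  to \<open>0\<close>, the values of the difference quotients of \<open>u\<close> at \<open>0\<close>, which are small. Together these facts
  force the flux to vanish at the pole.
\<close>

lemma flux_limit:
  fixes u u' D :: "real \<Rightarrow> real"
  assumes u: "\<And>r. r \<ge> 0 \<Longrightarrow> (u has_real_derivative u' r) (at r within {0..})"
    and u'0: "u' 0 = 0"
    and flux: "\<And>r. r > 0 \<Longrightarrow> ((\<lambda>s. \<psi> s ^ (n - 1) * u' s) has_real_derivative D r) (at r)"
    and bound: "\<And>r. 0 < r \<Longrightarrow> r \<le> 1 \<Longrightarrow> \<bar>D r\<bar> \<le> C"
  shows "((\<lambda>r. \<psi> r ^ (n - 1) * u' r) \<longlongrightarrow> 0) (at_right 0)"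
proof -
  define N where "N r = \<psi> r ^ (n - 1) * u' r" for r
  define K where "K = \<psi> 1 ^ (n - 1)"
  have K: "K > 0" unfolding K_def using warp_pos by simp
  have C: "C \<ge> 0" using bound[of 1] by auto
  have lip: "\<bar>N s - N r\<bar> \<le> C * s" if rs: "0 < r" "r < s" "s \<le> 1" for r s
  proof -
    have "(N has_real_derivative D x) (at x)" if "r \<le> x" for x
      unfolding N_def using flux[of x] rs(1) that by simp
    then obtain z where z: "r < z" "z < s" "N s - N r = (s - r) * D z"
      using MVT2[OF rs(2), of N D] by blast
    have "\<bar>(s - r) * D z\<bar> \<le> s * C"
      unfolding abs_mult using bound[of z] z rs C by (intro mult_mono) auto
    then show ?thesis using z by (simp add: mult.commute)
  qed
  have u0: "((\<lambda>r. (u r - u 0) / r) \<longlongrightarrow> 0) (at_right 0)"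
    using u[of 0] u'0 at_within_nonneg_eq by (simp add: has_field_derivative_iff)
  have small: "\<bar>N s\<bar> \<le> C * s" if s: "0 < s" "s \<le> 1" for s
  proof (rule field_le_epsilon)
    fix e :: real assume e: "e > 0"
    have "\<forall>\<^sub>F r in at_right 0. dist ((u r - u 0) / r) 0 < e / K"
      using tendstoD[OF u0, of "e / K"] e K by simp
    moreover have "\<forall>\<^sub>F r in at_right 0. r \<in> {0<..<s}"
      using eventually_at_right_real[OF s(1)] .
    ultimately have "\<forall>\<^sub>F r in at_right 0. dist ((u r - u 0) / r) 0 < e / K \<and> r \<in> {0<..<s}"
      by eventually_elim auto
    \<comment> \<open>The factor \<open>K\<close> undoes the weight \<open>\<psi>\<^sup>n\<^sup>-\<^sup>1 \<le> K\<close> in the flux.\<close>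
    from eventually_happens[OF this]
    obtain r where r: "\<bar>(u r - u 0) / r\<bar> < e / K" "0 < r" "r < s"
      by (auto simp: dist_real_def)
    have "\<exists>z\<in>{0<..<r}. u r - u 0 = (r - 0) * u' z"
    proof -
      have "continuous_on {0..r} u"
        by (rule DERIV_continuous_on[where D = u'])
          (use u in \<open>auto intro: has_field_derivative_subset[where s = "{0..}"]\<close>)
      moreover have "(u has_derivative (\<lambda>h. h * u' x)) (at x)" if "0 < x" "x < r" for x
        using u[of x] that at_within_interior[of x "{0..}"]
        by (simp add: has_field_derivative_def mult_commute_abs)
      ultimately show ?thesis
        using mvt[of 0 r u "\<lambda>x h. h * u' x"] r(2) by (metis diff_zero greaterThanLessThan_iff)
    qed
    then obtain z where z: "0 < z" "z < r" "u r - u 0 = r * u' z" by auto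
    have "\<bar>u' z\<bar> < e / K" using r z by simp
    moreover have "\<psi> z ^ (n - 1) \<le> K"
      unfolding K_def using warp_mono[of z 1] warp_pos[of z] z r s by (intro power_mono) auto
    ultimately have "\<bar>N z\<bar> \<le> K * (e / K)"
      unfolding N_def abs_mult using warp_pos[of z] z K by (intro mult_mono) auto
    then have "\<bar>N z\<bar> \<le> e" using K by simp
    then show "\<bar>N s\<bar> \<le> C * s + e"
      using lip[of z s] z r s by linarith
  qed
  show ?thesis
  proof (rule Lim_null_comparison)
    show "\<forall>\<^sub>F s in at_right 0. norm (\<psi> s ^ (n - 1) * u' s) \<le> C * s"
      using eventually_at_right_real[OF zero_less_one]
      by (rule eventually_mono) (use small in \<open>auto simp: N_def\<close>)
    show "((\<lambda>s. C * s) \<longlongrightarrow> 0) (at_right 0)" by (auto intro!: tendsto_eq_intros)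
  qed
qed

text \<open>
  By l'Hopital's rule applied to \<open>\<psi>\<^sup>n\<^sup>-\<^sup>1 u' / (r \<psi>\<^sup>n\<^sup>-\<^sup>1)\<close>, the quotient \<open>u'(r)/r\<close> tends to
  \<open>-f(\<alpha>)/n\<close> at the pole.
\<close>

lemma radial_solution_poisson:
  assumes p: "p > 1" and sol: "radial_solution n p \<psi> \<alpha> u"
  obtains u' where "u 0 = \<alpha>" "radial_poisson u u' (\<lambda>r. \<bar>u r\<bar> powr (p - 1) * u r)"
proof -
  define f where "f t = \<bar>t\<bar> powr (p - 1) * t" for t :: real
  obtain u' where u: "\<And>r. r \<ge> 0 \<Longrightarrow> (u has_real_derivative u' r) (at r within {0..})"
    and eq: "\<And>r. r > 0 \<Longrightarrow> \<exists>D. ((\<lambda>s. \<psi> s ^ (n - 1) * u' s) has_real_derivative D) (at r) \<and>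
                       - (1 / \<psi> r ^ (n - 1)) * D = \<bar>u r\<bar> powr (p - 1) * u r"
    and u0: "u 0 = \<alpha>" "u' 0 = 0"
    using sol unfolding radial_solution_def by blast
  have flux: "((\<lambda>s. \<psi> s ^ (n - 1) * u' s) has_real_derivative - (\<psi> r ^ (n - 1) * f (u r))) (at r)"
    if r: "r > 0" for r
  proof -
    obtain D where D: "((\<lambda>s. \<psi> s ^ (n - 1) * u' s) has_real_derivative D) (at r)"
      "- (1 / \<psi> r ^ (n - 1)) * D = f (u r)"
      using eq[OF r] unfolding f_def by blast
    then have "D = - (\<psi> r ^ (n - 1) * f (u r))" using warp_pos[OF r] by (auto simp: field_simps)
    then show ?thesis using D by simp
  qed
  have u_cont: "continuous_on {0..} u"
    by (rule DERIV_continuous_on[where D = u']) (simp add: u)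
  have f_cont: "continuous_on UNIV f"
    unfolding f_def by (rule power_nonlinearity_continuous[OF p])
  have fu_cont: "continuous_on {0..} (\<lambda>r. f (u r))"
    by (rule continuous_on_compose2[OF f_cont u_cont]) simp
  have fu_lim: "((\<lambda>r. f (u r)) \<longlongrightarrow> f \<alpha>) (at_right 0)"
    using limit_at_right_if_continuous[OF fu_cont] u0 by simp
  have flux_cont: "continuous_on {0..1} (\<lambda>r. - (\<psi> r ^ (n - 1) * f (u r)))"
    by (intro continuous_intros continuous_on_subset[OF fu_cont] continuous_on_subset[OF warp_continuous]) auto
  then have "bounded ((\<lambda>r. - (\<psi> r ^ (n - 1) * f (u r))) ` {0..1})"
    by (intro compact_imp_bounded compact_continuous_image) auto
  then obtain C where "\<forall>x\<in>(\<lambda>r. - (\<psi> r ^ (n - 1) * f (u r))) ` {0..1}. norm x \<le> C"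
    unfolding bounded_iff by blast
  then have C: "\<bar>- (\<psi> r ^ (n - 1) * f (u r))\<bar> \<le> C" if "0 < r" "r \<le> 1" for r
    using that by simp
  have lim: "((\<lambda>r. u' r / r) \<longlongrightarrow> - f \<alpha> / n) (at_right 0)"
  proof -
    have N0: "((\<lambda>r. \<psi> r ^ (n - 1) * u' r) \<longlongrightarrow> 0) (at_right 0)"
      using u u0(2) flux C by (rule flux_limit)
    have "((\<lambda>r. (\<psi> r ^ (n - 1) * u' r) / (r * \<psi> r ^ (n - 1))) \<longlongrightarrow> - f \<alpha> / n) (at_right 0)"
    proof (rule lhopital_right_0[where f' = "\<lambda>r. - (\<psi> r ^ (n - 1) * f (u r))"
          and g' = "\<lambda>r. \<psi> r ^ (n - 1) + r * (real (n - 1) * (\<psi>' r * \<psi> r ^ (n - 1 - 1)))"])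
      show "((\<lambda>r. r * \<psi> r ^ (n - 1)) \<longlongrightarrow> 0) (at_right 0)"
        using warp_limit dim_ge_2 by (auto intro!: tendsto_eq_intros)
      have "((\<lambda>r. - f (u r) / (1 + real (n - 1) * \<psi>' r / (\<psi> r / r))) \<longlongrightarrow>
          - f \<alpha> / (1 + real (n - 1) * 1 / 1)) (at_right 0)"
        by (intro tendsto_intros fu_lim warp'_limit warp_quotient_limit) (use dim_ge_2 in auto)
      moreover have "- f \<alpha> / (1 + real (n - 1) * 1 / 1) = - f \<alpha> / n"
        using dim_ge_2 by (simp add: of_nat_diff)
      ultimately have "((\<lambda>r. - f (u r) / (1 + real (n - 1) * \<psi>' r / (\<psi> r / r))) \<longlongrightarrow> - f \<alpha> / n) (at_right 0)"
        by (simp only:)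
      then show "((\<lambda>r. - (\<psi> r ^ (n - 1) * f (u r)) /
          (\<psi> r ^ (n - 1) + r * (real (n - 1) * (\<psi>' r * \<psi> r ^ (n - 1 - 1))))) \<longlongrightarrow> - f \<alpha> / n) (at_right 0)"
      proof (rule Lim_transform_eventually)
        show "\<forall>\<^sub>F r in at_right 0. - f (u r) / (1 + real (n - 1) * \<psi>' r / (\<psi> r / r)) =
            - (\<psi> r ^ (n - 1) * f (u r)) / (\<psi> r ^ (n - 1) + r * (real (n - 1) * (\<psi>' r * \<psi> r ^ (n - 1 - 1))))"
          using eventually_at_right_less
        proof eventually_elim
          case (elim r)
          have pw: "\<psi> r ^ (n - 1) = \<psi> r * \<psi> r ^ (n - 1 - 1)"
            by (rule warp_power_split)
          have pos: "\<psi> r > 0" "\<psi> r ^ (n - 1 - 1) > 0" using warp_pos elim by auto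
          define P where "P = \<psi> r ^ (n - 1 - 1)"
          define c where "c = real (n - 1) * \<psi>' r"
          have "c \<ge> 0" unfolding c_def using warp'_nonneg elim by simp
          have "1 + c / (\<psi> r / r) = (\<psi> r + r * c) / \<psi> r" using pos elim by (simp add: field_simps)
          then have "- f (u r) / (1 + c / (\<psi> r / r)) = - (\<psi> r * f (u r)) / (\<psi> r + r * c)" by simp
          also have "\<dots> = - (P * (\<psi> r * f (u r))) / (P * (\<psi> r + r * c))"
            using pos unfolding P_def by simp
          finally show ?case unfolding pw c_def P_def by (simp add: algebra_simps)
        qed
      qed
      show "\<forall>\<^sub>F r in at_right 0. r * \<psi> r ^ (n - 1) \<noteq> 0"
        using eventually_at_right_less by eventually_elim (use warp_pos in fastforce)
      show "\<forall>\<^sub>F r in at_right 0. \<psi> r ^ (n - 1) + r * (real (n - 1) * (\<psi>' r * \<psi> r ^ (n - 1 - 1))) \<noteq> 0"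
        using eventually_at_right_less
      proof eventually_elim
        case (elim r)
        then have "\<psi> r ^ (n - 1) > 0" "r * (real (n - 1) * (\<psi>' r * \<psi> r ^ (n - 1 - 1))) \<ge> 0"
          using warp_pos[of r] warp'_nonneg[of r] by auto
        then show ?case by linarith
      qed
      show "\<forall>\<^sub>F r in at_right 0. ((\<lambda>r. \<psi> r ^ (n - 1) * u' r) has_real_derivative - (\<psi> r ^ (n - 1) * f (u r))) (at r)"
        using eventually_at_right_less by eventually_elim (use flux in auto)
      show "\<forall>\<^sub>F r in at_right 0. ((\<lambda>r. r * \<psi> r ^ (n - 1)) has_real_derivative
          \<psi> r ^ (n - 1) + r * (real (n - 1) * (\<psi>' r * \<psi> r ^ (n - 1 - 1)))) (at r)"
        using eventually_at_right_less
        by eventually_elim (auto intro!: derivative_eq_intros warp_deriv simp: algebra_simps)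
    qed (use N0 in simp)
    then show ?thesis
    proof (rule Lim_transform_eventually)
      show "\<forall>\<^sub>F r in at_right 0. (\<psi> r ^ (n - 1) * u' r) / (r * \<psi> r ^ (n - 1)) = u' r / r"
        using eventually_at_right_less
        by eventually_elim (use warp_pos in \<open>fastforce simp: field_simps\<close>)
    qed
  qed
  have u'_deriv: "(u' has_real_derivative - (real (n - 1) * (\<psi>' r / \<psi> r) * u' r) - f (u r)) (at r)"
    if "r > 0" for r
  proof -
    define P where "P = \<psi> r ^ (n - 1 - 1)"
    have pw: "\<psi> r ^ (n - 1) = \<psi> r * P"
      unfolding P_def by (rule warp_power_split)
    have pos: "\<psi> r > 0" "P > 0" unfolding P_def using warp_pos that by auto
    have "((\<lambda>s. (\<psi> s ^ (n - 1) * u' s) / \<psi> s ^ (n - 1)) has_real_derivative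
        (- (\<psi> r ^ (n - 1) * f (u r)) * \<psi> r ^ (n - 1)
          - (\<psi> r ^ (n - 1) * u' r) * (real (n - 1) * (\<psi>' r * \<psi> r ^ (n - 1 - 1)))) /
         (\<psi> r ^ (n - 1) * \<psi> r ^ (n - 1))) (at r)"
      by (intro DERIV_divide flux that)
        (use pos in \<open>auto intro!: derivative_eq_intros warp_deriv that simp: algebra_simps\<close>)
    moreover have "(- (\<psi> r ^ (n - 1) * f (u r)) * \<psi> r ^ (n - 1)
          - (\<psi> r ^ (n - 1) * u' r) * (real (n - 1) * (\<psi>' r * \<psi> r ^ (n - 1 - 1)))) /
         (\<psi> r ^ (n - 1) * \<psi> r ^ (n - 1)) = - (real (n - 1) * (\<psi>' r / \<psi> r) * u' r) - f (u r)"
      unfolding pw P_def[symmetric] using pos by (simp add: divide_simps) (simp add: algebra_simps)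
    ultimately have "((\<lambda>s. (\<psi> s ^ (n - 1) * u' s) / \<psi> s ^ (n - 1)) has_real_derivative
        - (real (n - 1) * (\<psi>' r / \<psi> r) * u' r) - f (u r)) (at r)" by simp
    then show ?thesis
    proof (rule has_field_derivative_transform_within_open[where S = "{0<..}"])
      show "(\<psi> x ^ (n - 1) * u' x) / \<psi> x ^ (n - 1) = u' x" if "x \<in> {0<..}" for x
        using warp_pos[of x] that by simp
    qed (use that in auto)
  qed
  have "radial_poisson u u' (\<lambda>r. f (u r))"
    unfolding radial_poisson_def
  proof (intro conjI allI impI)
    show "(u has_real_derivative u' r) (at r)" if "r > 0" for r
      using u[of r] that at_within_interior[of r "{0..}"] by simp
  qed (use u_cont fu_cont u'_deriv lim in auto)
  with u0(1) show thesis using that unfolding f_def by blast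
qed

text \<open>
  The energy \<open>u'\<^sup>2/2 + |u|\<^sup>p\<^sup>+\<^sup>1/(p + 1)\<close> does not increase, because \<open>\<psi>' \<ge> 0\<close> makes the first order term
  of the equation a friction.
\<close>

lemma lane_emden_bound:
  assumes p: "p > 1" and "u 0 \<ge> 0" and r: "r \<ge> 0"
    and sol: "radial_poisson u u' (\<lambda>r. \<bar>u r\<bar> powr (p - 1) * u r)"
  shows "\<bar>u r\<bar> \<le> u 0"
proof (cases "r = 0")
  case False
  define f where "f t = \<bar>t\<bar> powr (p - 1) * t" for t :: real
  define E where "E r = (u' r)\<^sup>2 / 2 + u r * f (u r) / (p + 1)" for r
  have f_deriv: "(f has_real_derivative p * \<bar>t\<bar> powr (p - 1)) (at t)" for t
    unfolding f_def by (rule power_nonlinearity_deriv[OF p])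
  have "E r \<le> 0\<^sup>2 / 2 + u 0 * f (u 0) / (p + 1)"
  proof (rule le_limit_at_right_if_deriv_nonpos[where E = E
        and E' = "\<lambda>s. - (real (n - 1) * (\<psi>' s / \<psi> s) * (u' s)\<^sup>2)"])
    have "isCont f (u 0)" using f_deriv DERIV_isCont by blast
    then have "((\<lambda>r. f (u r)) \<longlongrightarrow> f (u 0)) (at_right 0)"
      using radial_poisson_limits(1)[OF sol] by (rule isCont_tendsto_compose)
    then show "(E \<longlongrightarrow> 0\<^sup>2 / 2 + u 0 * f (u 0) / (p + 1)) (at_right 0)"
      unfolding E_def using p radial_poisson_limits[OF sol] by (intro tendsto_intros) auto
    show "(E has_real_derivative - (real (n - 1) * (\<psi>' s / \<psi> s) * (u' s)\<^sup>2)) (at s)" if "s > 0" for s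
    proof -
      have d: "(u has_real_derivative u' s) (at s)"
        "(u' has_real_derivative - (real (n - 1) * (\<psi>' s / \<psi> s) * u' s) - f (u s)) (at s)"
        using sol that unfolding radial_poisson_def f_def by auto
      have "((\<lambda>r. f (u r)) has_real_derivative p * \<bar>u s\<bar> powr (p - 1) * u' s) (at s)"
        by (rule DERIV_chain2[OF f_deriv d(1)])
      note D = DERIV_add[OF DERIV_cdivide[OF DERIV_power[OF d(2), of 2], of 2]
          DERIV_cdivide[OF DERIV_mult[OF d(1) this], of "p + 1"]]
      show ?thesis
        unfolding E_def
        by (rule DERIV_cong[OF D]) (use p in \<open>simp add: f_def divide_simps, simp add: algebra_simps power2_eq_square\<close>)
    qed
    show "- (real (n - 1) * (\<psi>' s / \<psi> s) * (u' s)\<^sup>2) \<le> 0" if "s > 0" for s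
      using warp_pos[OF that] warp'_nonneg[OF that] by simp
  qed (use r False in auto)
  moreover have "u r * f (u r) / (p + 1) \<le> E r" unfolding E_def by simp
  ultimately have le: "u r * f (u r) \<le> u 0 * f (u 0)" using p by (simp add: divide_simps split: if_splits)
  show ?thesis
  proof (rule ccontr)
    assume "\<not> \<bar>u r\<bar> \<le> u 0"
    then have gt: "\<bar>u r\<bar> > u 0" by simp
    have "(u 0) powr (p - 1) < \<bar>u r\<bar> powr (p - 1)"
      using gt assms by (intro powr_less_mono2) auto
    moreover have "(u 0)\<^sup>2 < \<bar>u r\<bar>\<^sup>2" using gt assms by (intro power_strict_mono) auto
    ultimately have "(u 0) powr (p - 1) * (u 0)\<^sup>2 < \<bar>u r\<bar> powr (p - 1) * \<bar>u r\<bar>\<^sup>2"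
      by (intro mult_strict_mono) (use assms in auto)
    then show False using le assms unfolding f_def by (simp add: power2_eq_square mult_ac)
  qed
qed (use assms in auto)

text \<open>
  A Gronwall argument for \<open>(u - v)\<^sup>2 + (u' - v')\<^sup>2\<close>. The coefficient \<open>(n - 1) \<psi>'/\<psi>\<close> is singular at the pole but
  enters with the good sign, so the growth rate involves only the Lipschitz constant of the
  nonlinearity on \<open>[-A, A]\<close>.
\<close>

lemma lane_emden_continuous_dependence:
  assumes p: "p > 1" and r: "r \<ge> 0"
    and init: "0 \<le> u 0" "u 0 \<le> A" "0 \<le> v 0" "v 0 \<le> A"
    and u: "radial_poisson u u' (\<lambda>r. \<bar>u r\<bar> powr (p - 1) * u r)"
    and v: "radial_poisson v v' (\<lambda>r. \<bar>v r\<bar> powr (p - 1) * v r)"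
  shows "(u r - v r)\<^sup>2 \<le> (u 0 - v 0)\<^sup>2 * exp ((p * A powr (p - 1) + 1) * r)"
proof (cases "r = 0")
  case False
  define f where "f t = \<bar>t\<bar> powr (p - 1) * t" for t :: real
  define w where "w r = u r - v r" for r
  define w' where "w' r = u' r - v' r" for r
  define q where "q r = f (u r) - f (v r)" for r
  define L where "L = p * A powr (p - 1)"
  define e where "e r = (w' r)\<^sup>2 + (w r)\<^sup>2" for r
  have L: "L \<ge> 0" unfolding L_def using p by simp
  have w: "radial_poisson w w' q"
    unfolding w_def w'_def q_def f_def by (rule radial_poisson_diff[OF u v])
  have lip: "\<bar>q s\<bar> \<le> L * \<bar>w s\<bar>" if "s > 0" for s
    unfolding q_def w_def L_def f_def
    using lane_emden_bound[OF p init(1) _ u, of s] lane_emden_bound[OF p init(3) _ v, of s] init that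
    by (intro power_nonlinearity_lipschitz[OF p]) auto
  define E' where "E' s = (2 * w' s * (- (real (n - 1) * (\<psi>' s / \<psi> s) * w' s) - q s) + 2 * w s * w' s
      - (L + 1) * e s) * exp (- (L + 1) * s)" for s
  have "e r * exp (- (L + 1) * r) \<le> (0\<^sup>2 + (w 0)\<^sup>2) * exp (- (L + 1) * 0)"
  proof (rule le_limit_at_right_if_deriv_nonpos[where E = "\<lambda>r. e r * exp (- (L + 1) * r)"
        and E' = E'])
    show "((\<lambda>r. e r * exp (- (L + 1) * r)) \<longlongrightarrow> (0\<^sup>2 + (w 0)\<^sup>2) * exp (- (L + 1) * 0)) (at_right 0)"
      unfolding e_def by (intro tendsto_intros radial_poisson_limits[OF w])
    show "((\<lambda>r. e r * exp (- (L + 1) * r)) has_real_derivative E' s) (at s)" if "s > 0" for s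
    proof -
      have d: "(w has_real_derivative w' s) (at s)"
        "(w' has_real_derivative - (real (n - 1) * (\<psi>' s / \<psi> s) * w' s) - q s) (at s)"
        using w that unfolding radial_poisson_def by auto
      show ?thesis
        unfolding e_def E'_def
        by (rule derivative_eq_intros d refl)+ (simp add: algebra_simps power2_eq_square)
    qed
    show "E' s \<le> 0" if "s > 0" for s
    proof -
      have "2 * w' s * (- (real (n - 1) * (\<psi>' s / \<psi> s) * w' s)) =
          - (2 * real (n - 1) * (\<psi>' s / \<psi> s) * (w' s)\<^sup>2)"
        by (simp add: power2_eq_square)
      also have "\<dots> \<le> 0" using warp_pos[OF that] warp'_nonneg[OF that] by simp
      finally have 1: "2 * w' s * (- (real (n - 1) * (\<psi>' s / \<psi> s) * w' s)) \<le> 0" .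
      have "- (2 * w' s * q s) + 2 * w s * w' s \<le> 2 * \<bar>w' s\<bar> * \<bar>q s\<bar> + 2 * \<bar>w s\<bar> * \<bar>w' s\<bar>"
        using abs_ge_minus_self[of "w' s * q s"] abs_ge_self[of "w s * w' s"]
        unfolding abs_mult by linarith
      also have "\<dots> \<le> 2 * \<bar>w' s\<bar> * (L * \<bar>w s\<bar>) + 2 * \<bar>w s\<bar> * \<bar>w' s\<bar>"
        using lip[OF that] by (intro add_mono mult_left_mono) auto
      also have "\<dots> = (L + 1) * (2 * \<bar>w' s\<bar> * \<bar>w s\<bar>)" by (simp add: algebra_simps)
      also have "\<dots> \<le> (L + 1) * e s"
        unfolding e_def using L sum_squares_bound[of "\<bar>w' s\<bar>" "\<bar>w s\<bar>"] by (intro mult_left_mono) auto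
      finally have "2 * w' s * (- (real (n - 1) * (\<psi>' s / \<psi> s) * w' s) - q s) + 2 * w s * w' s
        - (L + 1) * e s \<le> 0" using 1 by (simp add: algebra_simps)
      then show ?thesis unfolding E'_def by (simp add: mult_le_0_iff)
    qed
  qed (use r False in auto)
  then have "e r * exp (- ((L + 1) * r)) \<le> (w 0)\<^sup>2"
    by (simp only: mult_minus_left mult_zero_right minus_zero exp_zero mult_1_right zero_power2 add_0)
  then have "e r / exp ((L + 1) * r) \<le> (w 0)\<^sup>2" by (simp add: exp_minus divide_inverse)
  then have "e r \<le> (w 0)\<^sup>2 * exp ((L + 1) * r)" by (simp add: pos_divide_le_eq)
  then show ?thesis unfolding e_def w_def L_def by (smt (verit) zero_le_power2)
qed simp

end

section \<open>Integration of compactly supported functions\<close>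

lemma AE_nonzero:
  assumes "\<And>x::'a::euclidean_space. x \<noteq> 0 \<Longrightarrow> P x"
  shows "AE x in lborel. P x"
  using AE_lborel_singleton[of 0] by (rule eventually_mono) (use assms in auto)

lemma integrable_const_on_cball:
  "integrable lborel (\<lambda>x::'a::euclidean_space. M * indicator (cball 0 R) x :: real)"
  using emeasure_lborel_cball_finite[of "0::'a" R]
  by (intro integrable_mult_right integrable_real_indicator) (auto simp: top.not_eq_extremum)

lemma integrable_if_bounded_support:
  fixes h :: "'a::euclidean_space \<Rightarrow> real"
  assumes "h \<in> borel_measurable borel" and "\<And>x. x \<noteq> 0 \<Longrightarrow> \<bar>h x\<bar> \<le> M * indicator (cball 0 R) x"
  shows "integrable lborel h"
proof (rule Bochner_Integration.integrable_bound[OF integrable_const_on_cball])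
  show "AE x in lborel. norm (h x) \<le> norm (M * indicator (cball 0 R) x)"
    using assms(2) by (intro AE_nonzero) (force intro: order_trans[OF _ abs_ge_self])
qed (use assms in auto)

lemma integral_limit_bounded_support:
  fixes F :: "nat \<Rightarrow> 'a::euclidean_space \<Rightarrow> real"
  assumes "\<And>k. F k \<in> borel_measurable borel" "f \<in> borel_measurable borel"
    and bound: "\<And>k x. x \<noteq> 0 \<Longrightarrow> \<bar>F k x\<bar> \<le> M * indicator (cball 0 R) x"
    and lim: "\<And>x. x \<noteq> 0 \<Longrightarrow> (\<lambda>k. F k x) \<longlonglongrightarrow> f x"
  shows "(\<lambda>k. \<integral>x. F k x \<partial>lborel) \<longlonglongrightarrow> (\<integral>x. f x \<partial>lborel)"
proof (rule integral_dominated_convergence[OF _ _ integrable_const_on_cball])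
  show "AE x in lborel. (\<lambda>k. F k x) \<longlonglongrightarrow> f x" by (rule AE_nonzero) (rule lim)
  show "AE x in lborel. norm (F k x) \<le> M * indicator (cball 0 R) x" for k
    by (rule AE_nonzero) (use bound in auto)
qed (use assms in auto)

lemma borel_measurable_radial:
  fixes h :: "real \<Rightarrow> real"
  assumes "continuous_on {0<..} h"
  shows "(\<lambda>x::'a::euclidean_space. h (norm x)) \<in> borel_measurable borel"
proof -
  have "(\<lambda>r. indicator {0<..} r *\<^sub>R h r) \<in> borel_measurable borel"
    by (rule borel_measurable_continuous_on_indicator[OF _ assms]) simp
  then have "(\<lambda>x::'a. indicator {0<..} (norm x) *\<^sub>R h (norm x)) \<in> borel_measurable borel"
    by (rule measurable_compose[rotated]) simp
  then have "(\<lambda>x::'a. if x \<in> {0} then h 0 else indicator {0<..} (norm x) *\<^sub>R h (norm x)) \<in> borel_measurable borel"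
    by (intro measurable_If_set) auto
  also have "(\<lambda>x::'a. if x \<in> {0} then h 0 else indicator {0<..} (norm x) *\<^sub>R h (norm x)) = (\<lambda>x. h (norm x))"
    by auto
  finally show ?thesis .
qed

lemma integrable_radial_on_ball:
  fixes h :: "real \<Rightarrow> real"
  assumes "continuous_on {0<..} h" "(h \<longlongrightarrow> l) (at_right 0)"
  shows "integrable lborel (\<lambda>x::'a::euclidean_space. indicator (ball 0 R) x * h (norm x))"
proof -
  obtain M where M: "M > 0" "\<And>r. 0 < r \<Longrightarrow> r \<le> R \<Longrightarrow> \<bar>h r\<bar> \<le> M"
    using bounded_on_if_limit_at_right[OF assms] by blast
  have [measurable]: "(\<lambda>x::'a. h (norm x)) \<in> borel_measurable borel" "ball (0::'a) R \<in> sets borel"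
    by (auto intro: borel_measurable_radial[OF assms(1)])
  show ?thesis
  proof (rule integrable_if_bounded_support[where M = M and R = R])
    show "\<bar>indicator (ball 0 R) x * h (norm x)\<bar> \<le> M * indicator (cball 0 R) x" if "x \<noteq> 0" for x :: 'a
      using M(2)[of "norm x"] that by (auto simp: indicator_def)
  qed measurable
qed

section \<open>A divergence theorem for radial vector fields\<close>

text \<open>
  The integral of \<open>G(x + h e) - G(x)\<close> is \<open>0\<close> by translation invariance; dividing by \<open>h\<close> and letting \<open>h\<close>
  tend to \<open>0\<close>, dominated convergence gives the claim. It suffices that the derivative is bounded; it
  may be discontinuous, as happens below at the pole.
\<close>

lemma integral_directional_derivative_eq_0:
  fixes G :: "'a::euclidean_space \<Rightarrow> real"
  assumes deriv: "\<And>x. (G has_derivative G' x) (at x)"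
    and bound: "\<And>x h. \<bar>G' x h\<bar> \<le> M * norm h"
    and supp: "\<And>x. norm x > R \<Longrightarrow> G x = 0"
  shows "integrable lborel (\<lambda>x. G' x e)" "(\<integral>x. G' x e \<partial>lborel) = 0"
proof -
  define D where "D k x = (G (x + (1 / real (Suc k)) *\<^sub>R e) - G x) / (1 / real (Suc k))" for k x
  have cont: "continuous_on UNIV G"
    by (rule has_derivative_continuous_on) (rule has_derivative_at_withinI[OF deriv])
  then have meas[measurable]: "G \<in> borel_measurable borel" by (rule borel_measurable_continuous_onI)
  have lip: "\<bar>G x - G y\<bar> \<le> M * norm (x - y)" for x y
  proof -
    have "norm (G x - G y) \<le> M * norm (x - y)"
    proof (rule differentiable_bound[where S = UNIV and f' = G'])
      show "onorm (G' x) \<le> M" for x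
        by (rule onorm_bound) (use bound[of x] bound[of x "SOME b. b \<in> Basis"] in
            \<open>auto simp: norm_Basis SOME_Basis intro: order_trans[OF abs_ge_zero]\<close>)
    qed (use deriv in auto)
    then show ?thesis by simp
  qed
  have M: "M \<ge> 0" using bound[of 0 "SOME b. b \<in> Basis"] by (simp add: norm_Basis SOME_Basis)
  have lim: "(\<lambda>k. D k x) \<longlonglongrightarrow> G' x e" for x
  proof -
    have "((\<lambda>t. G (x + t *\<^sub>R e)) has_derivative (\<lambda>t. G' x (t *\<^sub>R e))) (at 0)"
      by (rule has_derivative_compose[where g = G and f = "\<lambda>t. x + t *\<^sub>R e", simplified])
        (auto intro!: derivative_eq_intros deriv)
    then have "((\<lambda>t. G (x + t *\<^sub>R e)) has_real_derivative G' x e) (at 0)"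
      by (simp add: has_field_derivative_def linear_scale[OF has_derivative_linear[OF deriv]]
          mult_commute_abs)
    then have "(\<lambda>h. (G (x + h *\<^sub>R e) - G x) / h) \<midarrow>0\<rightarrow> G' x e"
      by (simp add: DERIV_def)
    moreover have "filterlim (\<lambda>k. 1 / real (Suc k)) (at 0) sequentially"
      unfolding filterlim_at using LIMSEQ_inverse_real_of_nat
      by (auto simp: inverse_eq_divide simp del: of_nat_Suc)
    ultimately show ?thesis unfolding D_def by (rule filterlim_compose)
  qed
  have D_bound: "\<bar>D k x\<bar> \<le> (M * norm e) * indicator (cball 0 (R + norm e)) x" for k x
  proof (cases "norm x \<le> R + norm e")
    case True
    have "\<bar>D k x\<bar> = \<bar>G (x + (1 / real (Suc k)) *\<^sub>R e) - G x\<bar> * real (Suc k)"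
      unfolding D_def by (simp add: abs_mult)
    also have "\<dots> \<le> (M * norm ((1 / real (Suc k)) *\<^sub>R e)) * real (Suc k)"
      using lip[of "x + (1 / real (Suc k)) *\<^sub>R e" x] by (intro mult_right_mono) auto
    also have "\<dots> = M * norm e" by simp
    finally show ?thesis using True by simp
  next
    case False
    have "norm x \<le> norm (x + (1 / real (Suc k)) *\<^sub>R e) + norm ((1 / real (Suc k)) *\<^sub>R e)"
      by (metis add_diff_cancel_right' norm_triangle_ineq4)
    moreover have "norm ((1 / real (Suc k)) *\<^sub>R e) \<le> norm e"
      by (simp add: divide_le_eq mult_left_le_one_le field_simps)
    moreover have "norm x > R" using False norm_ge_zero[of e] by linarith
    ultimately have "G (x + (1 / real (Suc k)) *\<^sub>R e) = 0" "G x = 0"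
      using False by (auto intro!: supp)
    then show ?thesis using False by (simp add: D_def)
  qed
  have D_meas[measurable]: "D k \<in> borel_measurable borel" for k unfolding D_def by measurable
  have G'_meas: "(\<lambda>x. G' x e) \<in> borel_measurable borel"
    by (rule borel_measurable_LIMSEQ_real[OF lim]) measurable
  have w: "integrable lborel (\<lambda>x::'a. (M * norm e) * indicator (cball 0 (R + norm e)) x)"
    using M by (intro integrable_if_bounded_support[where M = "M * norm e" and R = "R + norm e"] borel_measurable_times borel_measurable_indicator) auto
  have D0: "(\<integral>x. D k x \<partial>lborel) = 0" for k
  proof -
    define c where "c = (1 / real (Suc k)) *\<^sub>R e"
    have "bounded (G ` cball 0 R)"
      by (intro compact_imp_bounded compact_continuous_image continuous_on_subset[OF cont]) auto
    then obtain b where b: "\<forall>y\<in>G ` cball 0 R. norm y \<le> b" unfolding bounded_iff by blast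
    define B where "B = max b 0"
    have B: "\<bar>G x\<bar> \<le> B" for x
    proof (cases "norm x > R")
      case False
      then have "norm (G x) \<le> b" by (intro b[rule_format] imageI) simp
      then show ?thesis unfolding B_def by simp
    qed (simp add: supp B_def)
    have int: "integrable lborel G"
      by (rule integrable_if_bounded_support[where M = B and R = R])
        (use B supp in \<open>auto simp: indicator_def\<close>)
    have "(\<integral>x. G x \<partial>lborel) = (\<integral>x. G x \<partial>distr lborel borel ((+) c))"
      by (simp add: lborel_distr_plus)
    also have "\<dots> = (\<integral>x. G (c + x) \<partial>lborel)" by (rule integral_distr) auto
    finally have eq: "(\<integral>x. G (x + c) \<partial>lborel) = (\<integral>x. G x \<partial>lborel)" by (simp add: add.commute)
    have "integrable (distr lborel borel ((+) c)) G" using int by (simp add: lborel_distr_plus)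
    then have "integrable lborel (\<lambda>x. G (c + x))" by (subst (asm) integrable_distr_eq) auto
    then have "integrable lborel (\<lambda>x. G (x + c))" by (simp add: add.commute)
    then show ?thesis
      unfolding D_def c_def[symmetric] using eq int by simp
  qed
  have *: "(\<lambda>x. G' x e) \<in> borel_measurable lborel" "\<And>k. D k \<in> borel_measurable lborel"
    "AE x in lborel. (\<lambda>k. D k x) \<longlonglongrightarrow> G' x e"
    "\<And>k. AE x in lborel. norm (D k x) \<le> (M * norm e) * indicator (cball 0 (R + norm e)) x"
    using G'_meas lim D_bound by auto
  show "integrable lborel (\<lambda>x. G' x e)"
    by (rule integrable_dominated_convergence[OF *(1,2) w *(3,4)])
  have "(\<lambda>k. \<integral>x. D k x \<partial>lborel) \<longlonglongrightarrow> (\<integral>x. G' x e \<partial>lborel)"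
    by (rule integral_dominated_convergence[OF *(1,2) w *(3,4)])
  then show "(\<integral>x. G' x e \<partial>lborel) = 0"
    unfolding D0 using LIMSEQ_unique tendsto_const by blast
qed

text \<open>
  Here \<open>D = n K + r K'\<close> is the divergence of the radial field \<open>K(|x|) x\<close>, and the identity integrates
  the divergence of \<open>\<phi>(x) K(|x|) x\<close>. The limit of \<open>K\<close> at \<open>0\<close> makes this field
  differentiable at the pole; the limit of \<open>D\<close> bounds its derivative nearby.
\<close>

lemma integral_radial_divergence_eq_0:
  fixes \<phi> :: "real ^ 'n \<Rightarrow> real" and K D :: "real \<Rightarrow> real"
  assumes deriv: "\<And>x. (\<phi> has_derivative \<phi>' x) (at x)"
    and \<phi>_bound: "\<And>x. \<bar>\<phi> x\<bar> \<le> B"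
    and \<phi>'_bound: "\<And>x h. \<bar>\<phi>' x h\<bar> \<le> B' * norm h"
    and supp: "\<And>x. norm x > R \<Longrightarrow> \<phi> x = 0"
    and K_deriv: "\<And>r. r > 0 \<Longrightarrow> (K has_real_derivative (D r - real CARD('n) * K r) / r) (at r)"
    and K_lim: "(K \<longlongrightarrow> K0) (at_right 0)"
    and D_cont: "continuous_on {0<..} D" and D_lim: "(D \<longlongrightarrow> D0) (at_right 0)"
  shows "(\<integral>x. \<phi> x * D (norm x) + K (norm x) * \<phi>' x x \<partial>lborel) = 0"
proof -
  define K' where "K' r = (D r - real CARD('n) * K r) / r" for r
  have K_cont: "continuous_on {0<..} K"
    using K_deriv by (intro continuous_at_imp_continuous_on ballI) (auto intro: DERIV_isCont)
  obtain M1 where M1: "M1 > 0" "\<And>r. 0 < r \<Longrightarrow> r \<le> R \<Longrightarrow> \<bar>K r\<bar> \<le> M1"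
    using bounded_on_if_limit_at_right[OF K_cont K_lim] by blast
  obtain M2 where M2: "M2 > 0" "\<And>r. 0 < r \<Longrightarrow> r \<le> R \<Longrightarrow> \<bar>D r\<bar> \<le> M2"
    using bounded_on_if_limit_at_right[OF D_cont D_lim] by blast
  define m where "m = M2 + (1 + real CARD('n)) * M1"
  have m: "m \<ge> 0" unfolding m_def using M1(1) M2(1) by simp
  have Km: "\<bar>K r\<bar> \<le> m" "\<bar>r * K' r\<bar> \<le> m" if "0 < r" "r \<le> R" for r
  proof -
    have "\<bar>K r\<bar> \<le> M1" "\<bar>D r\<bar> \<le> M2" using M1 M2 that by auto
    moreover have "real CARD('n) * \<bar>K r\<bar> \<le> real CARD('n) * M1"
      by (intro mult_left_mono M1 that) simp
    moreover have "\<bar>r * K' r\<bar> \<le> \<bar>D r\<bar> + real CARD('n) * \<bar>K r\<bar>"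
      unfolding K'_def using that abs_triangle_ineq4[of "D r" "real CARD('n) * K r"] by (simp add: abs_mult)
    moreover have "real CARD('n) * M1 \<ge> 0" using M1(1) by simp
    ultimately show "\<bar>K r\<bar> \<le> m" "\<bar>r * K' r\<bar> \<le> m"
      unfolding m_def distrib_right using M1(1) M2(1) by linarith+
  qed
  define k where "k x = (if x = 0 then K0 else K (norm x))" for x :: "real ^ 'n"
  define G where "G i x = \<phi> x * k x * (x $ i)" for i x
  define G' where "G' i x h = (if x = 0 then \<phi> 0 * K0 * (h $ i)
    else \<phi>' x h * K (norm x) * (x $ i) + \<phi> x * (K' (norm x) * (sgn x \<bullet> h)) * (x $ i) + \<phi> x * K (norm x) * (h $ i))"
    for i x h
  define C where "C = B' * (m * max R 0) + 2 * (B * m) + B * \<bar>K0\<bar>"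
  have B: "B \<ge> 0" using \<phi>_bound[of 0] by linarith
  have B': "B' \<ge> 0" using \<phi>'_bound[of 0 "axis undefined 1"] by simp
  have k_cont: "isCont k 0"
  proof -
    have n0: "filterlim norm (at_right 0) (at (0::real ^ 'n))"
      unfolding filterlim_at by (auto intro!: tendsto_eq_intros simp: eventually_at_filter)
    have "((\<lambda>x::real ^ 'n. K (norm x)) \<longlongrightarrow> K0) (at 0)"
      by (rule filterlim_compose[OF K_lim n0])
    then have "(k \<longlongrightarrow> K0) (at 0)"
      by (rule Lim_transform_eventually) (auto simp: k_def eventually_at_filter)
    then show ?thesis by (simp add: isCont_def k_def)
  qed
  have G_deriv: "(G i has_derivative G' i x) (at x)" for i x
  proof (cases "x = 0")
    case True
    have c: "isCont (\<lambda>x. \<phi> x * k x) 0"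
      by (intro isCont_mult k_cont has_derivative_continuous[OF deriv])
    have "((\<lambda>y. norm (\<phi> y * k y - \<phi> 0 * k 0)) \<longlongrightarrow> 0) (at 0)"
      using c unfolding isCont_def by (intro tendsto_norm_zero LIM_zero)
    then have "(G i has_derivative (\<lambda>h. \<phi> 0 * k 0 * (h $ i))) (at 0)"
      unfolding has_derivative_at_within[of _ _ 0 UNIV]
    proof (intro conjI bounded_linear_mult_right bounded_linear_compose[OF bounded_linear_mult_right bounded_linear_vec_nth])
      assume lim: "((\<lambda>y. norm (\<phi> y * k y - \<phi> 0 * k 0)) \<longlongrightarrow> 0) (at 0)"
      show "((\<lambda>y. (G i y - G i 0 - \<phi> 0 * k 0 * ((y - 0) $ i)) /\<^sub>R norm (y - 0)) \<longlongrightarrow> 0) (at 0)"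
      proof (rule Lim_null_comparison[OF always_eventually lim], rule allI)
        fix y :: "real ^ 'n"
        have "norm ((G i y - G i 0 - \<phi> 0 * k 0 * ((y - 0) $ i)) /\<^sub>R norm (y - 0)) =
            \<bar>\<phi> y * k y - \<phi> 0 * k 0\<bar> * (\<bar>y $ i\<bar> / norm y)"
        proof -
          have "G i y - G i 0 - \<phi> 0 * k 0 * ((y - 0) $ i) = (\<phi> y * k y - \<phi> 0 * k 0) * (y $ i)"
            unfolding G_def by (simp add: algebra_simps)
          then show ?thesis by (simp add: abs_mult divide_inverse_commute)
        qed
        also have "\<dots> \<le> \<bar>\<phi> y * k y - \<phi> 0 * k 0\<bar> * 1"
          using component_le_norm_cart[of y i] by (intro mult_left_mono) (auto simp: divide_le_eq)
        finally show "norm ((G i y - G i 0 - \<phi> 0 * k 0 * ((y - 0) $ i)) /\<^sub>R norm (y - 0)) \<le>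
            norm (\<phi> y * k y - \<phi> 0 * k 0)" by simp
      qed
    qed
    moreover have "G' i x = (\<lambda>h. \<phi> 0 * k 0 * (h $ i))"
      using True by (simp add: G'_def k_def fun_eq_iff)
    ultimately show ?thesis using True by simp
  next
    case False
    have "((\<lambda>x. K (norm x)) has_derivative (\<lambda>h. K' (norm x) * (sgn x \<bullet> h))) (at x)"
      using has_derivative_compose[OF has_derivative_norm[OF False] K_deriv[THEN has_field_derivative_imp_has_derivative]]
        False by (simp add: inner_commute K'_def)
    then have "((\<lambda>x. \<phi> x * K (norm x) * (x $ i)) has_derivative G' i x) (at x)"
      using False by (auto intro!: derivative_eq_intros deriv bounded_linear_imp_has_derivative[OF bounded_linear_vec_nth]
          simp: G'_def fun_eq_iff algebra_simps)
    then show ?thesis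
      by (rule has_derivative_transform_within_open[where s = "- {0}"]) (use False in \<open>auto simp: G_def k_def\<close>)
  qed
  have out: "\<phi> x = 0" "\<phi>' x h = 0" if x: "norm x > R" for x h
  proof -
    have "((\<lambda>x. 0) has_derivative \<phi>' x) (at x)"
      by (rule has_derivative_transform_within_open[OF deriv, where s = "{x. norm x > R}"])
        (use x supp in \<open>auto intro!: open_Collect_less continuous_intros\<close>)
    then have "\<phi>' x = (\<lambda>h. 0)" by (rule has_derivative_unique) simp
    then show "\<phi>' x h = 0" by simp
  qed (use supp that in auto)
  have C_ge: "C \<ge> B * \<bar>K0\<bar>" "C \<ge> B' * (m * max R 0) + 2 * (B * m)"
    unfolding C_def using B B' m by auto
  have G'_bound: "\<bar>G' i x h\<bar> \<le> C * norm h" for i x h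
  proof -
    have hi: "\<bar>h $ i\<bar> \<le> norm h" and xi: "\<bar>x $ i\<bar> \<le> norm x" by (simp_all add: component_le_norm_cart)
    consider "x = 0" | "x \<noteq> 0" "norm x > R" | "x \<noteq> 0" "norm x \<le> R" by linarith
    then show ?thesis
    proof cases
      case 1
      have "\<bar>\<phi> 0 * K0 * (h $ i)\<bar> \<le> B * \<bar>K0\<bar> * norm h"
        unfolding abs_mult using \<phi>_bound[of 0] hi B by (intro mult_mono) auto
      also have "\<dots> \<le> C * norm h" by (rule mult_right_mono[OF C_ge(1)]) simp
      finally show ?thesis using 1 by (simp add: G'_def)
    next
      case 2
      have "C \<ge> 0" using C_ge(1) B by (meson abs_ge_zero mult_nonneg_nonneg order_trans)
      then show ?thesis using 2 out[of x] by (simp add: G'_def)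
    next
      case 3
      have K: "\<bar>K (norm x)\<bar> \<le> m" "\<bar>norm x * K' (norm x)\<bar> \<le> m"
        using Km[of "norm x"] 3 by auto
      have "\<bar>\<phi>' x h * K (norm x) * (x $ i)\<bar> \<le> (B' * norm h) * m * max R 0"
        unfolding abs_mult using \<phi>'_bound[of x h] K xi 3 m B'
        by (intro mult_mono) (auto intro: order_trans)
      moreover have "\<bar>\<phi> x * K (norm x) * (h $ i)\<bar> \<le> B * m * norm h"
        unfolding abs_mult using \<phi>_bound[of x] K hi m B by (intro mult_mono) auto
      moreover have "\<bar>\<phi> x * (K' (norm x) * (sgn x \<bullet> h)) * (x $ i)\<bar> \<le> B * m * norm h"
      proof -
        have "\<bar>sgn x \<bullet> h\<bar> \<le> norm h"
          using Cauchy_Schwarz_ineq2[of "sgn x" h] 3 by (simp add: norm_sgn)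
        then have "\<bar>\<phi> x\<bar> * (\<bar>K' (norm x)\<bar> * \<bar>x $ i\<bar>) * \<bar>sgn x \<bullet> h\<bar> \<le> B * (\<bar>K' (norm x)\<bar> * norm x) * norm h"
          using \<phi>_bound[of x] xi B by (intro mult_mono) auto
        also have "\<dots> \<le> B * m * norm h"
          using K B by (intro mult_right_mono mult_left_mono) (auto simp: abs_mult mult.commute)
        finally show ?thesis by (simp add: abs_mult mult_ac)
      qed
      ultimately have "\<bar>G' i x h\<bar> \<le> (B' * norm h) * m * max R 0 + B * m * norm h + B * m * norm h"
        using 3 unfolding G'_def by simp
      also have "\<dots> = (B' * (m * max R 0) + 2 * (B * m)) * norm h" by (simp add: algebra_simps)
      also have "\<dots> \<le> C * norm h" by (rule mult_right_mono[OF C_ge(2)]) simp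
      finally show ?thesis .
    qed
  qed
  have "(\<integral>x. (\<Sum>i\<in>UNIV. G' i x (axis i 1)) \<partial>lborel) = 0"
  proof (subst Bochner_Integration.integral_sum)
    show "integrable lborel (\<lambda>x. G' i x (axis i 1))" for i
      by (rule integral_directional_derivative_eq_0(1)[where R = R, OF G_deriv G'_bound]) (use supp in \<open>auto simp: G_def\<close>)
    show "(\<Sum>i\<in>UNIV. \<integral>x. G' i x (axis i 1) \<partial>lborel) = 0"
      by (intro sum.neutral ballI integral_directional_derivative_eq_0(2)[where R = R, OF G_deriv G'_bound]) (use supp in \<open>auto simp: G_def\<close>)
  qed
  moreover have sum_eq: "(\<Sum>i\<in>UNIV. G' i x (axis i 1)) =
      \<phi> x * D (norm x) + K (norm x) * \<phi>' x x" if "x \<noteq> 0" for x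
  proof -
    have lin: "linear (\<phi>' x)" using has_derivative_linear[OF deriv] .
    have "(\<Sum>i\<in>UNIV. \<phi>' x (axis i 1) * (x $ i)) = \<phi>' x (\<Sum>i\<in>UNIV. (x $ i) *\<^sub>R axis i 1)"
      by (simp add: linear_sum[OF lin] linear_scale[OF lin] mult.commute)
    also have "(\<Sum>i\<in>UNIV. (x $ i) *\<^sub>R axis i 1) = x"
      by (simp add: basis_expansion flip: scalar_mult_eq_scaleR)
    finally have 1: "(\<Sum>i\<in>UNIV. \<phi>' x (axis i 1) * (x $ i)) = \<phi>' x x" .
    have "(\<Sum>i\<in>UNIV. (sgn x \<bullet> axis i 1) * (x $ i)) = sgn x \<bullet> x"
      by (subst inner_vec_def) (simp add: inner_axis)
    also have "\<dots> = norm x"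
      using that by (simp add: sgn_div_norm dot_square_norm power2_eq_square)
    finally have 2: "(\<Sum>i\<in>UNIV. (sgn x \<bullet> axis i 1) * (x $ i)) = norm x" .
    have "(\<Sum>i\<in>UNIV. G' i x (axis i 1)) =
        K (norm x) * (\<Sum>i\<in>UNIV. \<phi>' x (axis i 1) * (x $ i)) +
        \<phi> x * K' (norm x) * (\<Sum>i\<in>UNIV. (sgn x \<bullet> axis i 1) * (x $ i)) + (\<Sum>i\<in>(UNIV::'n set). \<phi> x * K (norm x))"
      using that by (simp add: G'_def sum.distrib sum_distrib_left mult_ac axis_def)
    moreover have D: "D (norm x) = real CARD('n) * K (norm x) + K' (norm x) * norm x"
      using that by (simp add: K'_def)
    ultimately show ?thesis unfolding 1 2 D by (simp add: algebra_simps)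
  qed
  then have ae: "AE x in lborel. (\<Sum>i\<in>UNIV. G' i x (axis i 1)) =
      \<phi> x * D (norm x) + K (norm x) * \<phi>' x x"
    using AE_lborel_singleton[of 0] by (auto elim: eventually_mono)
  moreover have "(\<integral>x. (\<Sum>i\<in>UNIV. G' i x (axis i 1)) \<partial>lborel) =
      (\<integral>x. \<phi> x * D (norm x) + K (norm x) * \<phi>' x x \<partial>lborel)"
  proof (rule integral_cong_AE)
    show *: "(\<lambda>x. \<Sum>i\<in>UNIV. G' i x (axis i 1)) \<in> borel_measurable lborel"
      by (intro borel_measurable_sum borel_measurable_integrable
          integral_directional_derivative_eq_0(1)[where R = R, OF G_deriv G'_bound]) (use supp in \<open>auto simp: G_def\<close>)
    have "(\<lambda>x. \<phi> x * D (norm x) + K (norm x) * \<phi>' x x) =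
        (\<lambda>x. if x \<in> {0} then \<phi> 0 * D 0 + K 0 * \<phi>' 0 0 else (\<Sum>i\<in>UNIV. G' i x (axis i 1)))"
      using sum_eq by auto
    also have "\<dots> \<in> borel_measurable lborel"
      using * by (intro measurable_If_set) auto
    finally show "(\<lambda>x. \<phi> x * D (norm x) + K (norm x) * \<phi>' x x)
        \<in> borel_measurable lborel" .
  qed (rule ae)
  ultimately show ?thesis by simp
qed

section \<open>Volume density and gradient of the model metric\<close>

text \<open>
  The matrix is \<open>1\<close> on the line of \<open>e\<close> and \<open>a\<close> on its orthogonal complement, so an orthogonal matrix
  taking a basis vector to \<open>e\<close> diagonalizes it.
\<close>

lemma det_scaled_identity_plus_projection:
  fixes e :: "real ^ 'n"
  assumes "norm e = 1"
  shows "det (\<chi> i j. e $ i * e $ j + a * ((if i = j then 1 else 0) - e $ i * e $ j)) = a ^ (CARD('n) - 1)"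
proof -
  obtain k :: 'n where True by simp
  obtain A where A: "orthogonal_matrix A" "A *v (axis k 1) = e"
    using orthogonal_matrix_exists_basis[OF assms] by blast
  define D :: "real ^ 'n ^ 'n" where "D = (\<chi> i j. if i = j then (if i = k then 1 else a) else 0)"
  have Ak: "A $ i $ k = e $ i" for i
    using A(2) by (auto simp: matrix_vector_mult_def axis_def vec_eq_iff if_distrib cong: if_cong)
  have orth: "(\<Sum>l\<in>UNIV. A $ i $ l * A $ j $ l) = (if i = j then 1 else 0)" for i j
  proof -
    have "A ** transpose A = mat 1" using A(1) unfolding orthogonal_matrix_def by simp
    then have "(A ** transpose A) $ i $ j = (mat 1 :: real ^ 'n ^ 'n) $ i $ j" by simp
    then show ?thesis by (simp add: matrix_matrix_mult_def transpose_def mat_def)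
  qed
  have "(A ** D ** transpose A) $ i $ j = e $ i * e $ j + a * ((if i = j then 1 else 0) - e $ i * e $ j)" for i j
  proof -
    have "(A ** D) $ i $ l = A $ i $ l * (if l = k then 1 else a)" for l
      unfolding matrix_matrix_mult_def D_def by (simp add: if_distrib[of "\<lambda>y. _ * y"] cong: if_cong)
    then have "(A ** D ** transpose A) $ i $ j = (\<Sum>l\<in>UNIV. A $ i $ l * (if l = k then 1 else a) * A $ j $ l)"
      by (simp add: matrix_matrix_mult_def[of "A ** D"] transpose_def)
    also have "\<dots> = (\<Sum>l\<in>UNIV. a * (A $ i $ l * A $ j $ l) + (if l = k then (1 - a) * (A $ i $ k * A $ j $ k) else 0))"
      by (intro sum.cong) (auto simp: algebra_simps)
    also have "\<dots> = a * (if i = j then 1 else 0) + (1 - a) * (e $ i * e $ j)"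
      by (simp add: sum.distrib sum_distrib_left[symmetric] orth Ak)
    finally show ?thesis by (simp add: algebra_simps)
  qed
  then have "det (\<chi> i j. e $ i * e $ j + a * ((if i = j then 1 else 0) - e $ i * e $ j)) = det (A ** D ** transpose A)"
    by (intro arg_cong[where f = det]) (simp add: vec_eq_iff)
  also have "\<dots> = det D" using det_orthogonal_matrix[OF A(1)] by (auto simp: det_mul det_transpose)
  also have "\<dots> = (\<Prod>i\<in>UNIV. if i = k then 1 else a)"
    by (subst det_diagonal) (auto simp: D_def)
  also have "\<dots> = a ^ (CARD('n) - 1)"
    by (subst prod.remove[of _ k]) (simp_all add: card_Diff_singleton)
  finally show ?thesis .
qed

lemma model_volume_density:
  fixes x :: "real ^ 'n"
  assumes "x \<noteq> 0" "\<psi> (norm x) > 0"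
  shows "sqrt (det (\<chi> i j. model_metric \<psi> x (axis i 1) (axis j 1))) = (\<psi> (norm x) / norm x) ^ (CARD('n) - 1)"
proof -
  have n: "norm (sgn x) = 1" using assms by (simp add: norm_sgn)
  have "(\<chi> i j. model_metric \<psi> x (axis i 1) (axis j 1)) =
      (\<chi> i j. sgn x $ i * sgn x $ j + (\<psi> (norm x) / norm x)\<^sup>2 * ((if i = j then 1 else 0) - sgn x $ i * sgn x $ j))"
    using assms by (auto simp: vec_eq_iff model_metric_def inner_axis' power_divide) (auto simp: axis_def)
  then have "det (\<chi> i j. model_metric \<psi> x (axis i 1) (axis j 1)) = ((\<psi> (norm x) / norm x)\<^sup>2) ^ (CARD('n) - 1)"
    by (simp only: det_scaled_identity_plus_projection[OF n])
  also have "\<dots> = ((\<psi> (norm x) / norm x) ^ (CARD('n) - 1))\<^sup>2"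
    by (simp only: power_mult[symmetric] mult.commute)
  finally show ?thesis using assms by simp
qed

lemma model_volume_density_pole:
  "sqrt (det (\<chi> i j. model_metric \<psi> (0::real ^ 'n) (axis i 1) (axis j 1))) = 1"
proof -
  have "(\<chi> i j. model_metric \<psi> (0::real ^ 'n) (axis i 1) (axis j 1)) = mat 1"
    by (auto simp: vec_eq_iff model_metric_def inner_axis_axis mat_def)
  then show ?thesis by simp
qed

text \<open>
  The metric is the Euclidean one in the radial direction and \<open>(\<psi>/r)\<^sup>2\<close> times the Euclidean one
  tangentially, so the tangential part of the Euclidean gradient \<open>d\<close> is divided by that
  factor.
\<close>

lemma model_gradient_norm:
  fixes x d :: "real ^ 'n"
  assumes x: "x \<noteq> 0" and pos: "\<psi> (norm x) > 0" and deriv: "(\<phi> has_derivative (\<lambda>v. d \<bullet> v)) (at x)"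
  defines "w \<equiv> riemannian_gradient (model_metric \<psi>) \<phi> x"
  shows "model_metric \<psi> x w w = (d \<bullet> sgn x)\<^sup>2 + (norm x / \<psi> (norm x))\<^sup>2 * (d \<bullet> d - (d \<bullet> sgn x)\<^sup>2)"
proof -
  define e where "e = sgn x"
  define a where "a = (\<psi> (norm x) / norm x)\<^sup>2"
  have a: "a > 0" unfolding a_def using x pos by simp
  have ee: "e \<bullet> e = 1" unfolding e_def using x by (simp add: dot_square_norm norm_sgn)
  have g: "model_metric \<psi> x v w = (v \<bullet> e) * (w \<bullet> e) + a * (v \<bullet> w - (v \<bullet> e) * (w \<bullet> e))" for v w
    unfolding model_metric_def a_def e_def using x by (simp add: power_divide)
  define w0 where "w0 = (d \<bullet> e) *\<^sub>R e + (1 / a) *\<^sub>R (d - (d \<bullet> e) *\<^sub>R e)"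
  have w0: "model_metric \<psi> x w0 v = d \<bullet> v" for v
    unfolding g w0_def using a by (simp add: inner_simps ee inner_commute[of v] field_simps)
  have "w = w0"
    unfolding w_def riemannian_gradient_def frechet_derivative_at[OF deriv, symmetric]
  proof (rule the_equality)
    fix y assume y: "\<forall>v. model_metric \<psi> x y v = d \<bullet> v"
    define z where "z = y - w0"
    have "model_metric \<psi> x z z = model_metric \<psi> x y z - model_metric \<psi> x w0 z"
      unfolding z_def g by (simp add: inner_simps algebra_simps)
    then have 0: "(z \<bullet> e) * (z \<bullet> e) + a * (z \<bullet> z - (z \<bullet> e) * (z \<bullet> e)) = 0"
      using y w0 unfolding g by simp
    have "(z \<bullet> e)\<^sup>2 \<le> (z \<bullet> z) * (e \<bullet> e)" by (rule Cauchy_Schwarz_ineq)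
    then have cs: "(z \<bullet> e) * (z \<bullet> e) \<le> z \<bullet> z" by (simp add: ee power2_eq_square)
    then have "a * (z \<bullet> z - (z \<bullet> e) * (z \<bullet> e)) \<ge> 0" using a by simp
    with 0 have "(z \<bullet> e) * (z \<bullet> e) = 0" "a * (z \<bullet> z - (z \<bullet> e) * (z \<bullet> e)) = 0"
      using zero_le_square[of "z \<bullet> e"] by linarith+
    then have "z \<bullet> z = 0" using a by simp
    then show "y = w0" by (simp add: z_def)
  qed (use w0 in simp)
  then show ?thesis
    using w0[of w0] unfolding w0_def
    by (simp add: inner_simps e_def a_def power_divide power2_eq_square)
qed

section \<open>Smooth radial test functions\<close>

text \<open>
  A family of functions that contains the directional derivatives of its members consists of smooth
  functions. This reduces smoothness of an explicit function to finding such a family around it.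
\<close>

lemma C_k_if_closed_under_derivatives:
  assumes closed: "\<And>f. f \<in> F \<Longrightarrow> \<exists>f'. \<forall>x. (f has_derivative f' x) (at x) \<and> (\<forall>v. (\<lambda>x. f' x v) \<in> F)"
    and "f \<in> F"
  shows "C_k k f"
  using assms(2)
proof (induction k arbitrary: f)
  case (0 f)
  obtain f' where "\<forall>x. (f has_derivative f' x) (at x) \<and> (\<forall>v. (\<lambda>x. f' x v) \<in> F)"
    using closed[OF 0] ..
  then have "continuous_on UNIV f"
    by (intro continuous_at_imp_continuous_on ballI) (blast intro: has_derivative_continuous)
  then show ?case by simp
next
  case (Suc k f)
  obtain f' where "\<forall>x. (f has_derivative f' x) (at x) \<and> (\<forall>v. (\<lambda>x. f' x v) \<in> F)"
    using closed[OF Suc.prems] ..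
  then have f': "(f has_derivative f' x) (at x)" "(\<lambda>x. f' x v) \<in> F" for x v
    by auto
  have "frechet_derivative f (at x) = f' x" for x
    using frechet_derivative_at[OF f'(1)] by simp
  then show ?case using f' Suc.IH by (auto simp: differentiable_def)
qed

text \<open>
  The classical flat functions \<open>exp(-\<delta>/t)/t\<^sup>j\<close>. The powers of \<open>t\<close> make the family stable under
  differentiation, and \<open>\<delta> \<rightarrow> 0\<close> turns \<open>flat_exp \<delta> 0\<close> into the indicator of the positive axis.
\<close>

definition flat_exp :: "real \<Rightarrow> nat \<Rightarrow> real \<Rightarrow> real" where
  "flat_exp \<delta> j t = (if t > 0 then exp (- \<delta> / t) / t ^ j else 0)"

lemma flat_exp_tendsto_0:
  assumes "\<delta> > 0"
  shows "(flat_exp \<delta> j \<longlongrightarrow> 0) (at_right 0)"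
proof -
  have "filterlim (\<lambda>t. \<delta> / t) at_top (at_right 0)"
    using filterlim_tendsto_pos_mult_at_top[OF tendsto_const assms filterlim_inverse_at_top_right]
    by (simp add: divide_inverse)
  then have "((\<lambda>t. (\<delta> / t) ^ j / exp (\<delta> / t)) \<longlongrightarrow> 0) (at_right 0)"
    by (rule filterlim_compose[OF tendsto_power_div_exp_0])
  then have "((\<lambda>t. (1 / \<delta> ^ j) * ((\<delta> / t) ^ j / exp (\<delta> / t))) \<longlongrightarrow> (1 / \<delta> ^ j) * 0) (at_right 0)"
    by (intro tendsto_mult tendsto_const)
  then have "((\<lambda>t. (1 / \<delta> ^ j) * ((\<delta> / t) ^ j / exp (\<delta> / t))) \<longlongrightarrow> 0) (at_right 0)" by simp
  then show ?thesis
  proof (rule Lim_transform_eventually)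
    show "\<forall>\<^sub>F t in at_right 0. (1 / \<delta> ^ j) * ((\<delta> / t) ^ j / exp (\<delta> / t)) = flat_exp \<delta> j t"
      using eventually_at_right_less
      by eventually_elim (use assms in \<open>simp add: flat_exp_def power_divide exp_minus divide_simps\<close>)
  qed
qed

lemma flat_exp_deriv:
  assumes "\<delta> > 0"
  shows "(flat_exp \<delta> j has_real_derivative
    - real j * flat_exp \<delta> (j + 1) t + \<delta> * flat_exp \<delta> (j + 2) t) (at t)"
proof -
  consider "t > 0" | "t < 0" | "t = 0" by linarith
  then show ?thesis
  proof cases
    case 1
    have "((\<lambda>t. exp (- \<delta> / t) / t ^ j) has_real_derivative
        (exp (- \<delta> / t) * (\<delta> / (t * t)) * t ^ j - exp (- \<delta> / t) * (real j * t ^ (j - 1))) / (t ^ j * t ^ j)) (at t)"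
      using 1 by (auto intro!: derivative_eq_intros)
    moreover have "(exp (- \<delta> / t) * (\<delta> / (t * t)) * t ^ j - exp (- \<delta> / t) * (real j * t ^ (j - 1))) / (t ^ j * t ^ j)
        = - real j * flat_exp \<delta> (j + 1) t + \<delta> * flat_exp \<delta> (j + 2) t"
      using 1 by (cases j) (simp_all add: flat_exp_def divide_simps, simp_all add: algebra_simps)
    ultimately have "((\<lambda>t. exp (- \<delta> / t) / t ^ j) has_real_derivative
        - real j * flat_exp \<delta> (j + 1) t + \<delta> * flat_exp \<delta> (j + 2) t) (at t)" by simp
    then show ?thesis
      by (rule has_field_derivative_transform_within_open[where S = "{0<..}"])
        (use 1 in \<open>auto simp: flat_exp_def\<close>)
  next
    case 2
    have "((\<lambda>t. 0) has_real_derivative 0) (at t)" by simp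
    then have "(flat_exp \<delta> j has_real_derivative 0) (at t)"
      by (rule has_field_derivative_transform_within_open[where S = "{..<0}"])
        (use 2 in \<open>auto simp: flat_exp_def\<close>)
    then show ?thesis using 2 by (simp add: flat_exp_def)
  next
    case 3
    have "((\<lambda>h. flat_exp \<delta> j h / h) \<longlongrightarrow> 0) (at_right 0)"
      by (rule Lim_transform_eventually[OF flat_exp_tendsto_0[OF assms, of "Suc j"]])
        (auto simp: flat_exp_def eventually_at_filter)
    moreover have "((\<lambda>h. flat_exp \<delta> j h / h) \<longlongrightarrow> 0) (at_left 0)"
      by (rule tendsto_eventually) (auto simp: flat_exp_def eventually_at_filter)
    ultimately have "((\<lambda>h. flat_exp \<delta> j h / h) \<longlongrightarrow> 0) (at 0)"
      by (simp add: filterlim_split_at)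
    then show ?thesis using 3 by (simp add: DERIV_def flat_exp_def)
  qed
qed

text \<open>
  The last estimate is the reason for this choice of cutoff: near the boundary its derivative
  \<open>\<delta> flat_exp \<delta> 2\<close> is at most the inverse distance \<open>1/t\<close>, uniformly in \<open>\<delta>\<close>, and is thus harmless when
  multiplied by a function that vanishes linearly.
\<close>

lemma flat_exp_bounds:
  assumes "\<delta> > 0"
  shows "0 \<le> flat_exp \<delta> j t" "flat_exp \<delta> 0 t \<le> 1" "t \<ge> 0 \<Longrightarrow> t * (\<delta> * flat_exp \<delta> 2 t) \<le> 1"
proof -
  show "0 \<le> flat_exp \<delta> j t" "flat_exp \<delta> 0 t \<le> 1"
    using assms by (auto simp: flat_exp_def)
  show "t * (\<delta> * flat_exp \<delta> 2 t) \<le> 1" if "t \<ge> 0"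
  proof (cases "t = 0")
    case False
    have "\<delta> / t \<le> exp (\<delta> / t)" using exp_ge_add_one_self[of "\<delta> / t"] by linarith
    then have "\<delta> / t * exp (- (\<delta> / t)) \<le> exp (\<delta> / t) * exp (- (\<delta> / t))"
      by (intro mult_right_mono) auto
    then have "\<delta> / t * exp (- (\<delta> / t)) \<le> 1" by (simp flip: exp_add)
    then show ?thesis using that False by (simp add: flat_exp_def power2_eq_square)
  qed simp
qed

lemma flat_exp_limits:
  assumes "t > 0"
  shows "(\<lambda>k. flat_exp (1 / real (Suc k)) 0 t) \<longlonglongrightarrow> 1"
    and "(\<lambda>k. 1 / real (Suc k) * flat_exp (1 / real (Suc k)) 2 t) \<longlonglongrightarrow> 0"
proof -
  have "(\<lambda>k. 1 / real (Suc k)) \<longlonglongrightarrow> 0"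
    using LIMSEQ_inverse_real_of_nat by (simp add: inverse_eq_divide)
  note [tendsto_intros] = this
  have "(\<lambda>k. exp (- (1 / real (Suc k)) / t) / t ^ j) \<longlonglongrightarrow> exp (- 0 / t) / t ^ j" for j
    using assms by (intro tendsto_intros) auto
  then have lim: "(\<lambda>k. flat_exp (1 / real (Suc k)) j t) \<longlonglongrightarrow> 1 / t ^ j" for j
    using assms by (simp add: flat_exp_def)
  show "(\<lambda>k. flat_exp (1 / real (Suc k)) 0 t) \<longlonglongrightarrow> 1" using lim[of 0] by simp
  have "(\<lambda>k. 1 / real (Suc k) * flat_exp (1 / real (Suc k)) 2 t) \<longlonglongrightarrow> 0 * (1 / t ^ 2)"
    by (intro tendsto_intros lim)
  then show "(\<lambda>k. 1 / real (Suc k) * flat_exp (1 / real (Suc k)) 2 t) \<longlonglongrightarrow> 0" by simp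
qed

text \<open>
  The algebra generated by polynomials and the flat functions of \<open>S - |x|\<^sup>2\<close>. It is closed
  under directional derivatives and contains the radial bumps used as test functions.
\<close>

inductive_set bump_algebra :: "real \<Rightarrow> real \<Rightarrow> ('a::real_inner \<Rightarrow> real) set" for \<delta> S where
  const: "(\<lambda>x. c) \<in> bump_algebra \<delta> S"
| linear: "(\<lambda>x. x \<bullet> w) \<in> bump_algebra \<delta> S"
| square: "(\<lambda>x. x \<bullet> x) \<in> bump_algebra \<delta> S"
| flat: "(\<lambda>x. flat_exp \<delta> j (S - x \<bullet> x)) \<in> bump_algebra \<delta> S"
| add: "f \<in> bump_algebra \<delta> S \<Longrightarrow> g \<in> bump_algebra \<delta> S \<Longrightarrow> (\<lambda>x. f x + g x) \<in> bump_algebra \<delta> S"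
| mult: "f \<in> bump_algebra \<delta> S \<Longrightarrow> g \<in> bump_algebra \<delta> S \<Longrightarrow> (\<lambda>x. f x * g x) \<in> bump_algebra \<delta> S"

lemma in_ball_iff_inner:
  fixes x :: "'a::real_inner"
  assumes "R > 0"
  shows "R\<^sup>2 - x \<bullet> x > 0 \<longleftrightarrow> norm x < R"
  using assms by (auto simp: dot_square_norm intro!: power_strict_mono dest: power_less_imp_less_base)

lemma has_derivative_inner_self:
  fixes x :: "'a::real_inner"
  shows "((\<lambda>x. x \<bullet> x) has_derivative (\<lambda>v. 2 * (x \<bullet> v))) (at x)"
  by (rule has_derivative_eq_rhs[OF has_derivative_inner[OF has_derivative_ident has_derivative_ident]])
    (auto simp: inner_commute)

lemma bump_algebra_closed:
  assumes "\<delta> > 0" "f \<in> bump_algebra \<delta> S"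
  shows "\<exists>f'. \<forall>x. (f has_derivative f' x) (at x) \<and> (\<forall>v. (\<lambda>x. f' x v) \<in> bump_algebra \<delta> S)"
  using assms(2)
proof induction
  case (const c)
  show ?case by (rule exI[of _ "\<lambda>x v. 0"]) (auto intro: bump_algebra.const)
next
  case (linear w)
  show ?case by (rule exI[of _ "\<lambda>x v. v \<bullet> w"]) (auto intro: bump_algebra.const derivative_eq_intros)
next
  case square
  show ?case
    by (rule exI[of _ "\<lambda>x v. 2 * (x \<bullet> v)"])
      (auto intro: bump_algebra.intros has_derivative_inner_self)
next
  case (flat j)
  define f' where "f' x v = (- real j * flat_exp \<delta> (j + 1) (S - x \<bullet> x) + \<delta> * flat_exp \<delta> (j + 2) (S - x \<bullet> x))
    * (- 2 * (x \<bullet> v))" for x v :: 'a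
  show ?case
  proof (intro exI[of _ f'] allI conjI)
    fix x v :: 'a
    have "((\<lambda>x. S - x \<bullet> x) has_derivative (\<lambda>v. - 2 * (x \<bullet> v))) (at x)"
      by (rule has_derivative_eq_rhs[OF has_derivative_diff[OF has_derivative_const has_derivative_inner_self]]) auto
    from has_derivative_compose[OF this flat_exp_deriv[OF assms(1), THEN has_field_derivative_imp_has_derivative]]
    show "((\<lambda>x. flat_exp \<delta> j (S - x \<bullet> x)) has_derivative f' x) (at x)"
      unfolding f'_def .
    show "(\<lambda>x. f' x v) \<in> bump_algebra \<delta> S"
      unfolding f'_def by (intro bump_algebra.intros)
  qed
next
  case (add f g)
  then obtain f' g' where
    "\<forall>x. (f has_derivative f' x) (at x) \<and> (\<forall>v. (\<lambda>x. f' x v) \<in> bump_algebra \<delta> S)"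
    "\<forall>x. (g has_derivative g' x) (at x) \<and> (\<forall>v. (\<lambda>x. g' x v) \<in> bump_algebra \<delta> S)" by blast
  then show ?case
    by (intro exI[of _ "\<lambda>x v. f' x v + g' x v"]) (auto intro: has_derivative_add bump_algebra.intros)
next
  case (mult f g)
  then obtain f' g' where
    "\<forall>x. (f has_derivative f' x) (at x) \<and> (\<forall>v. (\<lambda>x. f' x v) \<in> bump_algebra \<delta> S)"
    "\<forall>x. (g has_derivative g' x) (at x) \<and> (\<forall>v. (\<lambda>x. g' x v) \<in> bump_algebra \<delta> S)" by blast
  note fg = this
  have "(\<lambda>x. f x * g' x v + f' x v * g x) \<in> bump_algebra \<delta> S" for v
    by (rule bump_algebra.add; rule bump_algebra.mult) (use fg mult.hyps in auto)
  moreover have "((\<lambda>x. f x * g x) has_derivative (\<lambda>v. f x * g' x v + f' x v * g x)) (at x)" for x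
    using fg by (intro has_derivative_mult) auto
  ultimately show ?case by (intro exI[of _ "\<lambda>x v. f x * g' x v + f' x v * g x"]) simp
qed

lemma test_function_radial_bump:
  fixes P :: "real \<Rightarrow> real"
  assumes \<delta>: "\<delta> > 0" and P: "real_polynomial_function P"
  shows "test_function (\<lambda>x::'a::euclidean_space. P (x \<bullet> x) * flat_exp \<delta> 0 (S - x \<bullet> x))"
proof -
  have "(\<lambda>x::'a. P (x \<bullet> x)) \<in> bump_algebra \<delta> S"
    using P
  proof (induction rule: real_polynomial_function.induct)
    case (linear f)
    then have "f = (\<lambda>t. f 1 * t)"
      using real_bounded_linear by (metis mult.commute mult.left_neutral)
    then have "(\<lambda>x::'a. f (x \<bullet> x)) = (\<lambda>x. f 1 * (x \<bullet> x))" by metis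
    moreover have "(\<lambda>x::'a. f 1 * (x \<bullet> x)) \<in> bump_algebra \<delta> S" by (intro bump_algebra.intros)
    ultimately show ?case by (simp only:)
  qed (auto intro: bump_algebra.intros)
  then have mem: "(\<lambda>x::'a. P (x \<bullet> x) * flat_exp \<delta> 0 (S - x \<bullet> x)) \<in> bump_algebra \<delta> S"
    by (intro bump_algebra.intros)
  have "C_k k (\<lambda>x::'a. P (x \<bullet> x) * flat_exp \<delta> 0 (S - x \<bullet> x))" for k
    by (rule C_k_if_closed_under_derivatives[OF bump_algebra_closed[OF \<delta>] mem])
  moreover have "bounded {x::'a. P (x \<bullet> x) * flat_exp \<delta> 0 (S - x \<bullet> x) \<noteq> 0}"
  proof (rule bounded_subset[OF bounded_cball])
    show "{x::'a. P (x \<bullet> x) * flat_exp \<delta> 0 (S - x \<bullet> x) \<noteq> 0} \<subseteq> cball 0 (sqrt S)"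
      by (auto simp: flat_exp_def norm_eq_sqrt_inner split: if_splits)
  qed
  ultimately show ?thesis by (simp add: test_function_def compact_closure)
qed

lemma test_function_gradient:
  fixes \<phi> :: "real ^ 'n \<Rightarrow> real"
  assumes "test_function \<phi>"
  obtains d R B where "\<And>x. (\<phi> has_derivative (\<lambda>v. d x \<bullet> v)) (at x)"
    "continuous_on UNIV d" "continuous_on UNIV \<phi>" "R > 0" "B > 0"
    "\<And>x. norm x > R \<Longrightarrow> \<phi> x = 0" "\<And>x. norm x > R \<Longrightarrow> d x = 0"
    "\<And>x. \<bar>\<phi> x\<bar> \<le> B" "\<And>x. norm (d x) \<le> B"
proof -
  have C: "C_k (Suc 0) \<phi>" "C_k 0 \<phi>" and cpt: "compact (closure {x. \<phi> x \<noteq> 0})"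
    using assms unfolding test_function_def by blast+
  define d where "d x = (\<chi> i. frechet_derivative \<phi> (at x) (axis i 1))" for x
  have fd: "(\<phi> has_derivative frechet_derivative \<phi> (at x)) (at x)" for x
    using C(1) frechet_derivative_works by auto
  have dv: "frechet_derivative \<phi> (at x) v = d x \<bullet> v" for x v
  proof -
    have lin: "linear (frechet_derivative \<phi> (at x))" using has_derivative_linear[OF fd] .
    have "v = (\<Sum>i\<in>UNIV. (v $ i) *\<^sub>R axis i 1)"
      by (simp add: basis_expansion flip: scalar_mult_eq_scaleR)
    then have "frechet_derivative \<phi> (at x) v = frechet_derivative \<phi> (at x) (\<Sum>i\<in>UNIV. (v $ i) *\<^sub>R axis i 1)"
      by simp
    also have "\<dots> = d x \<bullet> v"
      by (simp add: linear_sum[OF lin] linear_scale[OF lin] d_def inner_vec_def mult.commute)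
    finally show ?thesis .
  qed
  have deriv: "(\<phi> has_derivative (\<lambda>v. d x \<bullet> v)) (at x)" for x
    using fd[of x] by (simp add: dv[abs_def] fun_eq_iff[symmetric])
  have d_cont: "continuous_on UNIV d"
    unfolding d_def using C(1) by (intro continuous_on_vec_lambda) simp
  have \<phi>_cont: "continuous_on UNIV \<phi>" using C(2) by simp
  obtain R0 where R0: "\<And>x. x \<in> closure {x. \<phi> x \<noteq> 0} \<Longrightarrow> norm x \<le> R0"
    using compact_imp_bounded[OF cpt] unfolding bounded_iff by blast
  define R where "R = max R0 1"
  have \<phi>0: "\<phi> x = 0" if "norm x > R" for x
    using R0[of x] that closure_subset[of "{x. \<phi> x \<noteq> 0}"] unfolding R_def by force
  have d0: "d x = 0" if x: "norm x > R" for x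
  proof -
    have "((\<lambda>x. 0) has_derivative (\<lambda>v. d x \<bullet> v)) (at x)"
      by (rule has_derivative_transform_within_open[OF deriv, where s = "{x. norm x > R}"])
        (use x \<phi>0 in \<open>auto intro!: open_Collect_less continuous_intros\<close>)
    then have "(\<lambda>v. d x \<bullet> v) = (\<lambda>v. 0)" by (rule has_derivative_unique) simp
    then show ?thesis by (metis inner_eq_zero_iff)
  qed
  have "bounded (\<phi> ` cball 0 R)" "bounded (d ` cball 0 R)"
    by (intro compact_imp_bounded compact_continuous_image continuous_on_subset[OF \<phi>_cont]
        continuous_on_subset[OF d_cont]; simp)+
  then obtain B1 B2 where B1: "\<forall>y\<in>\<phi> ` cball 0 R. norm y \<le> B1" and B2: "\<forall>y\<in>d ` cball 0 R. norm y \<le> B2"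
    unfolding bounded_iff by blast
  define B where "B = max 1 (max B1 B2)"
  have "\<bar>\<phi> x\<bar> \<le> B \<and> norm (d x) \<le> B" for x
  proof (cases "norm x > R")
    case False
    then have "norm (\<phi> x) \<le> B1" "norm (d x) \<le> B2"
      by (intro B1[rule_format] B2[rule_format] imageI; simp)+
    then show ?thesis unfolding B_def by auto
  qed (simp add: \<phi>0 d0 B_def)
  moreover have "R > 0" "B > 0" unfolding R_def B_def by auto
  ultimately show thesis using that deriv d_cont \<phi>_cont \<phi>0 d0 by blast
qed

lemma has_derivative_radial_bump:
  fixes x :: "'a::real_inner"
  assumes "\<delta> > 0" and P: "\<And>s. (P has_real_derivative p s) (at s)"
  shows "((\<lambda>x. P (x \<bullet> x) * flat_exp \<delta> 0 (S - x \<bullet> x)) has_derivative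
    (\<lambda>v. ((2 * (p (x \<bullet> x) * flat_exp \<delta> 0 (S - x \<bullet> x) - P (x \<bullet> x) * (\<delta> * flat_exp \<delta> 2 (S - x \<bullet> x)))) *\<^sub>R x) \<bullet> v)) (at x)"
proof -
  have flat: "(flat_exp \<delta> 0 has_real_derivative \<delta> * flat_exp \<delta> 2 t) (at t)" for t
    using flat_exp_deriv[OF assms(1), of 0 t] by (simp add: numeral_2_eq_2)
  have "((\<lambda>s. P s * flat_exp \<delta> 0 (S - s)) has_real_derivative
      p s * flat_exp \<delta> 0 (S - s) - P s * (\<delta> * flat_exp \<delta> 2 (S - s))) (at s)" for s
  proof -
    have "((\<lambda>s. flat_exp \<delta> 0 (S - s)) has_real_derivative \<delta> * flat_exp \<delta> 2 (S - s) * (0 - 1)) (at s)"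
      by (rule DERIV_chain2[OF flat DERIV_diff[OF DERIV_const DERIV_ident]])
    from DERIV_mult[OF P this] show ?thesis by (simp add: algebra_simps)
  qed
  from has_derivative_compose[OF has_derivative_inner_self this[THEN has_field_derivative_imp_has_derivative]]
  show ?thesis by (rule has_derivative_eq_rhs) (simp add: fun_eq_iff mult_ac)
qed

lemma polynomial_antiderivative:
  fixes p :: "real \<Rightarrow> real"
  assumes "real_polynomial_function p"
  obtains P where "real_polynomial_function P" "P S = 0" "\<And>s. (P has_real_derivative p s) (at s)"
proof -
  obtain a m where p: "p = (\<lambda>x. \<Sum>i\<le>m. a i * x ^ i)"
    using assms unfolding real_polynomial_function_iff_sum by blast
  define Q where "Q x = (\<Sum>i\<le>m. a i / real (Suc i) * x ^ Suc i)" for x :: real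
  have Q: "real_polynomial_function Q"
    unfolding Q_def
    by (intro real_polynomial_function_sum real_polynomial_function.intros(2,4) real_polynomial_function_power
        real_polynomial_function.intros(1) bounded_linear_ident) simp
  have monom: "((\<lambda>x::real. a i / real (Suc i) * x ^ Suc i) has_real_derivative a i * s ^ i) (at s)" for i s
    using DERIV_cmult[OF DERIV_power[OF DERIV_ident, of "Suc i"], of "a i / real (Suc i)" s]
    by (simp del: of_nat_Suc power_Suc)
  have "(Q has_real_derivative p s) (at s)" for s
    unfolding p Q_def by (rule DERIV_sum) (rule monom)
  then have "((\<lambda>s. Q s - Q S) has_real_derivative p s) (at s)" for s
    using DERIV_diff[OF _ DERIV_const] by fastforce
  moreover have "real_polynomial_function (\<lambda>s. Q s - Q S)"
    by (intro real_polynomial_function_diff Q real_polynomial_function.intros(2))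
  ultimately show thesis using that[of "\<lambda>s. Q s - Q S"] by simp
qed

text \<open>
  Weierstrass approximation of the derivative \<open>\<omega>\<close>, integrated from the right endpoint \<open>S\<close>, so that all
  approximants vanish there exactly; the bounds by \<open>C (S - s)\<close> say how fast.
\<close>

lemma polynomial_C1_approximation:
  fixes W \<omega> :: "real \<Rightarrow> real"
  assumes S: "S > 0" and cont: "continuous_on {0..S} \<omega>"
    and W: "\<And>s. s > 0 \<Longrightarrow> (W has_real_derivative \<omega> s) (at s)" and WS: "W S = 0"
  obtains P p :: "nat \<Rightarrow> real \<Rightarrow> real" and C where
    "C > 0" "\<And>k. real_polynomial_function (P k)" "\<And>k. real_polynomial_function (p k)"
    "\<And>k s. (P k has_real_derivative p k s) (at s)"
    "\<And>k s. 0 \<le> s \<Longrightarrow> s \<le> S \<Longrightarrow> \<bar>p k s\<bar> \<le> C"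
    "\<And>k s. 0 \<le> s \<Longrightarrow> s \<le> S \<Longrightarrow> \<bar>P k s\<bar> \<le> C * (S - s)"
    "\<And>s. 0 < s \<Longrightarrow> s \<le> S \<Longrightarrow> (\<lambda>k. p k s) \<longlonglongrightarrow> \<omega> s"
    "\<And>s. 0 < s \<Longrightarrow> s \<le> S \<Longrightarrow> (\<lambda>k. P k s) \<longlonglongrightarrow> W s"
    "\<And>s. 0 \<le> s \<Longrightarrow> s \<le> S \<Longrightarrow> \<bar>\<omega> s\<bar> \<le> C"
    "\<And>s. 0 < s \<Longrightarrow> s \<le> S \<Longrightarrow> \<bar>W s\<bar> \<le> C * (S - s)"
proof -
  have "bounded (\<omega> ` {0..S})" by (intro compact_imp_bounded compact_continuous_image cont) simp
  then obtain C0 where C0: "\<forall>y\<in>\<omega> ` {0..S}. norm y \<le> C0" unfolding bounded_iff by blast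
  define C where "C = max C0 0 + 1"
  have \<omega>_bound: "\<bar>\<omega> s\<bar> \<le> C - 1" if "0 \<le> s" "s \<le> S" for s
  proof -
    have "norm (\<omega> s) \<le> C0" by (intro C0[rule_format] imageI) (use that in simp)
    then show ?thesis unfolding C_def by simp
  qed
  have "\<exists>p P. real_polynomial_function p \<and> real_polynomial_function P \<and> P S = 0 \<and>
      (\<forall>s. (P has_real_derivative p s) (at s)) \<and> (\<forall>s\<in>{0..S}. \<bar>\<omega> s - p s\<bar> < 1 / real (Suc k))" for k
  proof -
    obtain p where p: "real_polynomial_function p" "\<And>s. s \<in> {0..S} \<Longrightarrow> \<bar>\<omega> s - p s\<bar> < 1 / real (Suc k)"
      using Stone_Weierstrass_real_polynomial_function[of "{0..S}" \<omega> "1 / real (Suc k)"] cont by auto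
    obtain P where "real_polynomial_function P" "P S = 0" "\<And>s. (P has_real_derivative p s) (at s)"
      using polynomial_antiderivative[OF p(1)] by blast
    then show ?thesis using p by blast
  qed
  from choice[OF allI, OF this] obtain p where
    "\<forall>k. \<exists>P. real_polynomial_function (p k) \<and> real_polynomial_function P \<and> P S = 0 \<and>
      (\<forall>s. (P has_real_derivative p k s) (at s)) \<and> (\<forall>s\<in>{0..S}. \<bar>\<omega> s - p k s\<bar> < 1 / real (Suc k))" ..
  from choice[OF this] obtain P where
    "\<forall>k. real_polynomial_function (p k) \<and> real_polynomial_function (P k) \<and> P k S = 0 \<and>
      (\<forall>s. (P k has_real_derivative p k s) (at s)) \<and> (\<forall>s\<in>{0..S}. \<bar>\<omega> s - p k s\<bar> < 1 / real (Suc k))" ..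
  then have poly: "real_polynomial_function (p k)" "real_polynomial_function (P k)" and PS: "P k S = 0"
    and P: "(P k has_real_derivative p k s) (at s)"
    and close: "s \<in> {0..S} \<Longrightarrow> \<bar>\<omega> s - p k s\<bar> < 1 / real (Suc k)" for k s by blast+
  have close': "\<bar>\<omega> s - p k s\<bar> \<le> 1 / real (Suc k)" if "0 \<le> s" "s \<le> S" for k s
    using close[of s k] that by simp
  have p_bound: "\<bar>p k s\<bar> \<le> C" if "0 \<le> s" "s \<le> S" for k s
  proof -
    have "1 / real (Suc k) \<le> 1" by simp
    then show ?thesis using close'[OF that, of k] \<omega>_bound[OF that] by linarith
  qed
  have P_bound: "\<bar>P k s\<bar> \<le> C * (S - s)" if "0 \<le> s" "s \<le> S" for k s
  proof -
    have "norm (P k s - P k S) \<le> C * norm (s - S)"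
      by (rule field_differentiable_bound[where S = "{0..S}" and f' = "p k"])
        (use P p_bound that in \<open>auto intro: has_field_derivative_at_within\<close>)
    then show ?thesis using PS that by simp
  qed
  have W_bound: "\<bar>W s\<bar> \<le> C * (S - s)" if "0 < s" "s \<le> S" for s
  proof -
    have "norm (W s - W S) \<le> C * norm (s - S)"
    proof (rule field_differentiable_bound[where S = "{s..S}" and f' = \<omega>])
      show "norm (\<omega> t) \<le> C" if "t \<in> {s..S}" for t
        using \<omega>_bound[of t] that \<open>0 < s\<close> by simp
    qed (use W that in \<open>auto intro: has_field_derivative_at_within\<close>)
    then show ?thesis using WS that by simp
  qed
  have PW: "\<bar>P k s - W s\<bar> \<le> 1 / real (Suc k) * (S - s)" if "0 < s" "s \<le> S" for k s
  proof -
    have "norm ((P k s - W s) - (P k S - W S)) \<le> 1 / real (Suc k) * norm (s - S)"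
    proof (rule field_differentiable_bound[where S = "{s..S}" and f = "\<lambda>s. P k s - W s" and f' = "\<lambda>s. p k s - \<omega> s"])
      show "norm (p k t - \<omega> t) \<le> 1 / real (Suc k)" if "t \<in> {s..S}" for t
        using close'[of t k] that \<open>0 < s\<close> by (simp add: abs_minus_commute)
      show "((\<lambda>s. P k s - W s) has_real_derivative p k t - \<omega> t) (at t within {s..S})" if "t \<in> {s..S}" for t
        using that \<open>0 < s\<close> by (intro has_field_derivative_at_within[OF DERIV_diff[OF P W]]) simp
    qed (use that in auto)
    then show ?thesis using WS PS that by simp
  qed
  have null: "(\<lambda>k. 1 / real (Suc k)) \<longlonglongrightarrow> 0"
    using LIMSEQ_inverse_real_of_nat by (simp add: inverse_eq_divide)
  have p_lim: "(\<lambda>k. p k s) \<longlonglongrightarrow> \<omega> s" if "0 < s" "s \<le> S" for s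
  proof (rule Lim_transform_bound[THEN LIM_zero_cancel, OF _ null])
    show "\<forall>\<^sub>F k in sequentially. norm (p k s - \<omega> s) \<le> norm (1 / real (Suc k))"
      using close' that by (intro always_eventually allI) (simp add: abs_minus_commute)
  qed
  have P_lim: "(\<lambda>k. P k s) \<longlonglongrightarrow> W s" if "0 < s" "s \<le> S" for s
  proof (rule Lim_transform_bound[THEN LIM_zero_cancel, rotated])
    show "(\<lambda>k. 1 / real (Suc k) * (S - s)) \<longlonglongrightarrow> 0"
      by (rule tendsto_eq_rhs[OF tendsto_mult_right[OF null]]) simp
    show "\<forall>\<^sub>F k in sequentially. norm (P k s - W s) \<le> norm (1 / real (Suc k) * (S - s))"
      using PW that by (intro always_eventually allI) simp
  qed
  have C: "C > 0" unfolding C_def by simp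
  have \<omega>_bound': "\<bar>\<omega> s\<bar> \<le> C" if "0 \<le> s" "s \<le> S" for s using \<omega>_bound[OF that] by simp
  show thesis
    by (rule that[where C = C and P = P and p = p, OF C poly(2) poly(1) P p_bound P_bound p_lim P_lim \<omega>_bound' W_bound])
qed

section \<open>Dirichlet energy in the global chart\<close>

context radial_model
begin

abbreviation dirichlet_energy :: "(real ^ 'n \<Rightarrow> real) \<Rightarrow> real" where
  "dirichlet_energy \<phi> \<equiv> (LINT x|riemannian_volume (model_metric \<psi>).
     model_metric \<psi> x (riemannian_gradient (model_metric \<psi>) \<phi> x) (riemannian_gradient (model_metric \<psi>) \<phi> x))"

text \<open>
  The density of the Riemannian volume with respect to Lebesgue measure in the global chart.
\<close>

definition vol_density :: "real \<Rightarrow> real" where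
  "vol_density r = (\<psi> r / r) ^ (n - 1)"

abbreviation potential_energy :: "real \<Rightarrow> (real \<Rightarrow> real) \<Rightarrow> (real ^ 'n \<Rightarrow> real) \<Rightarrow> real" where
  "potential_energy p U \<phi> \<equiv>
     (\<integral>x. vol_density (norm x) * (\<bar>U (norm x)\<bar> powr (p - 1) * (\<phi> x)\<^sup>2) \<partial>lborel)"

lemma vol_density_pos: "r > 0 \<Longrightarrow> vol_density r > 0"
  unfolding vol_density_def using warp_pos by simp

lemma vol_density_continuous: "continuous_on {0<..} vol_density"
  unfolding vol_density_def
  by (intro continuous_intros continuous_on_subset[OF warp_continuous]) auto

lemma vol_density_limit: "(vol_density \<longlongrightarrow> 1) (at_right 0)"
  unfolding vol_density_def using tendsto_power[OF warp_quotient_limit, of "n - 1"] by simp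

lemma vol_density_measurable: "(\<lambda>x::real ^ 'n. vol_density (norm x)) \<in> borel_measurable borel"
  by (rule borel_measurable_radial[OF vol_density_continuous])

lemma integral_model_volume:
  fixes h :: "real ^ 'n \<Rightarrow> real"
  assumes dim: "CARD('n) = n" and h: "h \<in> borel_measurable borel"
  shows "(LINT x|riemannian_volume (model_metric \<psi>). h x) = (\<integral>x. vol_density (norm x) * h x \<partial>lborel)"
proof -
  define s where "s x = sqrt (det (\<chi> i j. model_metric \<psi> x (axis i 1) (axis j 1)))" for x :: "real ^ 'n"
  have s: "s x = vol_density (norm x)" if "x \<noteq> 0" for x
    unfolding s_def vol_density_def using model_volume_density[of x \<psi>] warp_pos[of "norm x"] that dim by simp
  have "s = (\<lambda>x. if x \<in> {0} then 1 else vol_density (norm x))"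
    using s model_volume_density_pole[of \<psi>] by (auto simp: s_def)
  also have "\<dots> \<in> borel_measurable borel"
    using vol_density_measurable by (intro measurable_If_set) auto
  finally have s_meas: "s \<in> borel_measurable borel" .
  have "(LINT x|riemannian_volume (model_metric \<psi>). h x) = (\<integral>x. s x *\<^sub>R h x \<partial>lborel)"
    unfolding riemannian_volume_def s_def[symmetric]
  proof (rule integral_density)
    show "AE x in lborel. 0 \<le> s x"
      by (rule AE_nonzero) (use s vol_density_pos in \<open>auto intro: less_imp_le\<close>)
  qed (use h s_meas in auto)
  also have "\<dots> = (\<integral>x. vol_density (norm x) * h x \<partial>lborel)"
  proof (rule integral_cong_AE)
    show "AE x in lborel. s x *\<^sub>R h x = vol_density (norm x) * h x"
      by (rule AE_nonzero) (simp add: s)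
  qed (use h s_meas vol_density_measurable in \<open>auto intro!: borel_measurable_times\<close>)
  finally show ?thesis .
qed

text \<open>
  The Dirichlet energy as a Lebesgue integral, split into the radial and the tangential part of the
  Euclidean gradient. Integrability holds because \<open>r/\<psi>(r)\<close> and the density are bounded near the
  pole.
\<close>

lemma dirichlet_energy_test_function:
  fixes \<phi> :: "real ^ 'n \<Rightarrow> real"
  assumes dim: "CARD('n) = n" and test: "test_function \<phi>"
    and deriv: "\<And>x. (\<phi> has_derivative (\<lambda>v. d x \<bullet> v)) (at x)"
  defines "E \<equiv> \<lambda>x. vol_density (norm x) * ((d x \<bullet> sgn x)\<^sup>2 +
      (norm x / \<psi> (norm x))\<^sup>2 * (d x \<bullet> d x - (d x \<bullet> sgn x)\<^sup>2))"
  shows "integrable lborel E"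
    and "dirichlet_energy \<phi> = (\<integral>x. E x \<partial>lborel)"
proof -
  obtain d' R B where d': "\<And>x. (\<phi> has_derivative (\<lambda>v. d' x \<bullet> v)) (at x)" "continuous_on UNIV d'"
    "R > 0" "B > 0" "\<And>x. norm x > R \<Longrightarrow> d' x = 0" "\<And>x. norm (d' x) \<le> B"
    using test_function_gradient[OF test] by metis
  have "d x = d' x" for x
  proof -
    have "(\<lambda>v. d x \<bullet> v) = (\<lambda>v. d' x \<bullet> v)" by (rule has_derivative_unique[OF deriv d'(1)])
    then show ?thesis by (metis vector_eq_rdot)
  qed
  then have d: "continuous_on UNIV d" "\<And>x. norm x > R \<Longrightarrow> d x = 0" "\<And>x. norm (d x) \<le> B"
    using d' by auto
  have d_meas[measurable]: "d \<in> borel_measurable borel" using d(1) by (rule borel_measurable_continuous_onI)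
  have sgn_meas[measurable]: "(sgn :: real ^ 'n \<Rightarrow> _) \<in> borel_measurable borel"
    unfolding sgn_div_norm[abs_def] by measurable
  have q_cont: "continuous_on {0<..} (\<lambda>r. r / \<psi> r)"
    by (intro continuous_intros continuous_on_subset[OF warp_continuous]) (use warp_pos in fastforce)+
  have q_lim: "((\<lambda>r. r / \<psi> r) \<longlongrightarrow> 1) (at_right 0)"
    using tendsto_inverse[OF warp_quotient_limit] by simp
  have q_meas[measurable]: "(\<lambda>x::real ^ 'n. norm x / \<psi> (norm x)) \<in> borel_measurable borel"
    by (rule borel_measurable_radial[OF q_cont])
  define Q where "Q x = (d x \<bullet> sgn x)\<^sup>2 + (norm x / \<psi> (norm x))\<^sup>2 * (d x \<bullet> d x - (d x \<bullet> sgn x)\<^sup>2)" for x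
  have Q_meas[measurable]: "Q \<in> borel_measurable borel" unfolding Q_def by measurable
  have E_eq: "E = (\<lambda>x. vol_density (norm x) * Q x)" unfolding E_def Q_def ..
  obtain M1 where M1: "M1 > 0" "\<And>r. 0 < r \<Longrightarrow> r \<le> R \<Longrightarrow> \<bar>vol_density r\<bar> \<le> M1"
    using bounded_on_if_limit_at_right[OF vol_density_continuous vol_density_limit] by blast
  obtain M2 where M2: "M2 > 0" "\<And>r. 0 < r \<Longrightarrow> r \<le> R \<Longrightarrow> \<bar>r / \<psi> r\<bar> \<le> M2"
    using bounded_on_if_limit_at_right[OF q_cont q_lim] by blast
  show int: "integrable lborel E"
    unfolding E_eq
  proof (rule integrable_if_bounded_support[where M = "M1 * (B\<^sup>2 + M2\<^sup>2 * B\<^sup>2)" and R = R])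
    fix x :: "real ^ 'n" assume x: "x \<noteq> 0"
    show "\<bar>vol_density (norm x) * Q x\<bar> \<le> M1 * (B\<^sup>2 + M2\<^sup>2 * B\<^sup>2) * indicator (cball 0 R) x"
    proof (cases "norm x > R")
      case True
      then show ?thesis by (simp add: Q_def d(2))
    next
      case False
      have "(d x \<bullet> sgn x)\<^sup>2 \<le> (d x \<bullet> d x) * (sgn x \<bullet> sgn x)" by (rule Cauchy_Schwarz_ineq)
      then have cs: "(d x \<bullet> sgn x)\<^sup>2 \<le> d x \<bullet> d x" using x by (simp add: dot_square_norm norm_sgn)
      have dd: "d x \<bullet> d x \<le> B\<^sup>2" using d(3)[of x] by (simp add: dot_square_norm power_mono)
      have "\<bar>norm x / \<psi> (norm x)\<bar>\<^sup>2 \<le> M2\<^sup>2"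
        using M2(2)[of "norm x"] x False by (intro power_mono) auto
      then have "(norm x / \<psi> (norm x))\<^sup>2 \<le> M2\<^sup>2" by (simp only: power2_abs)
      then have "(norm x / \<psi> (norm x))\<^sup>2 * (d x \<bullet> d x - (d x \<bullet> sgn x)\<^sup>2) \<le> M2\<^sup>2 * B\<^sup>2"
        using cs dd zero_le_power2[of "d x \<bullet> sgn x"] by (intro mult_mono) (linarith | simp)+
      moreover have "(norm x / \<psi> (norm x))\<^sup>2 * (d x \<bullet> d x - (d x \<bullet> sgn x)\<^sup>2) \<ge> 0" using cs by simp
      ultimately have "\<bar>Q x\<bar> \<le> B\<^sup>2 + M2\<^sup>2 * B\<^sup>2" "Q x \<ge> 0"
        unfolding Q_def using cs dd zero_le_power2[of "d x \<bullet> sgn x"] by linarith+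
      then have "\<bar>vol_density (norm x)\<bar> * \<bar>Q x\<bar> \<le> M1 * (B\<^sup>2 + M2\<^sup>2 * B\<^sup>2)"
        using M1 x False by (intro mult_mono) auto
      then show ?thesis using False by (simp add: abs_mult)
    qed
  qed (use vol_density_measurable in measurable)
  define g where "g x = model_metric \<psi> x (riemannian_gradient (model_metric \<psi>) \<phi> x)
        (riemannian_gradient (model_metric \<psi>) \<phi> x)" for x
  have gQ: "g x = Q x" if "x \<noteq> 0" for x
    unfolding g_def Q_def using model_gradient_norm[OF that warp_pos deriv] that by simp
  then have "g = (\<lambda>x. if x \<in> {0} then g 0 else Q x)" by auto
  also have "\<dots> \<in> borel_measurable borel" by (intro measurable_If_set) auto
  finally have g_meas: "g \<in> borel_measurable borel" .
  have "(LINT x|riemannian_volume (model_metric \<psi>). g x) = (\<integral>x. vol_density (norm x) * g x \<partial>lborel)"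
    by (rule integral_model_volume[OF dim g_meas])
  also have "\<dots> = (\<integral>x. E x \<partial>lborel)"
  proof (rule integral_cong_AE)
    show "AE x in lborel. vol_density (norm x) * g x = E x"
      by (rule AE_nonzero) (simp add: gQ E_eq)
  qed (use g_meas vol_density_measurable int in \<open>auto intro!: borel_measurable_times\<close>)
  finally show "dirichlet_energy \<phi> = (\<integral>x. E x \<partial>lborel)"
    unfolding g_def .
qed

section \<open>The Poincare inequality\<close>

text \<open>
  Up to the common factor, \<open>V r\<close> is the volume of the geodesic ball and \<open>\<psi>\<^sup>n\<^sup>-\<^sup>1\<close> the area of its
  boundary. For bounded radii the comparison follows from the monotonicity of \<open>\<psi>\<close>; beyond that, the
  derivative of \<open>C \<psi>\<^sup>n\<^sup>-\<^sup>1\<close> outgrows the one of \<open>V\<close>, by the exponential growth of \<open>\<psi>\<close>.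
\<close>

lemma volume_le_sphere:
  assumes c: "c > 0" and growth: "\<And>r. r \<ge> R0 \<Longrightarrow> c * \<psi> r \<le> \<psi>' r"
  obtains V C where "C > 0" "(V \<longlongrightarrow> 0) (at_right 0)"
    "\<And>r. r > 0 \<Longrightarrow> (V has_real_derivative \<psi> r ^ (n - 1)) (at r)"
    "\<And>r. r > 0 \<Longrightarrow> 0 \<le> V r" "\<And>r. r > 0 \<Longrightarrow> V r \<le> C * \<psi> r ^ (n - 1)"
proof -
  define V where "V r = integral {0..r} (\<lambda>s. \<psi> s ^ (n - 1))" for r
  have cont: "continuous_on {0..b} (\<lambda>s. \<psi> s ^ (n - 1))" for b
    by (intro continuous_intros continuous_on_subset[OF warp_continuous]) auto
  have Vd: "(V has_real_derivative \<psi> r ^ (n - 1)) (at r)" if "r > 0" for r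
  proof -
    have "(V has_real_derivative \<psi> r ^ (n - 1)) (at r within {0..r + 1})"
      unfolding V_def by (rule integral_has_real_derivative[OF cont]) (use that in auto)
    then show ?thesis using that at_within_interior[of r "{0..r + 1}"] by simp
  qed
  have V_lim: "(V \<longlongrightarrow> 0) (at_right 0)"
  proof -
    have "(V has_real_derivative \<psi> 0 ^ (n - 1)) (at 0 within {0..1})"
      unfolding V_def by (rule integral_has_real_derivative[OF cont]) auto
    then have "continuous (at 0 within {0..1}) V" by (rule DERIV_continuous)
    then show ?thesis by (simp add: continuous_within at_within_Icc_at_right V_def)
  qed
  have V_nonneg: "0 \<le> V r" if "r > 0" for r
    using le_limit_at_right_if_deriv_nonpos[of "\<lambda>r. - V r" 0 "\<lambda>r. - (\<psi> r ^ (n - 1))" r] that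
      tendsto_minus[OF V_lim] DERIV_minus[OF Vd] warp_pos by (simp add: less_imp_le)
  define P where "P r = real (n - 1) * (\<psi>' r * \<psi> r ^ (n - 1 - 1))" for r
  have psi_d: "((\<lambda>r. \<psi> r ^ (n - 1)) has_real_derivative P r) (at r)" if "r > 0" for r
    unfolding P_def using that by (auto intro!: derivative_eq_intros warp_deriv)
  have P_nonneg: "P r \<ge> 0" if "r > 0" for r
    unfolding P_def using that warp'_nonneg[OF that] warp_pos[OF that] by simp
  have small: "V r \<le> r * \<psi> r ^ (n - 1)" if "r > 0" for r
  proof -
    have "V r - r * \<psi> r ^ (n - 1) \<le> 0 - 0 * 0 ^ (n - 1)"
    proof (rule le_limit_at_right_if_deriv_nonpos[where E = "\<lambda>r. V r - r * \<psi> r ^ (n - 1)" and E' = "\<lambda>r. - (r * P r)"])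
      show "((\<lambda>r. V r - r * \<psi> r ^ (n - 1)) \<longlongrightarrow> 0 - 0 * 0 ^ (n - 1)) (at_right 0)"
        by (intro tendsto_intros V_lim warp_limit)
      show "((\<lambda>r. V r - r * \<psi> r ^ (n - 1)) has_real_derivative - (s * P s)) (at s)" if "s > 0" for s
        using DERIV_diff[OF Vd[OF that] DERIV_mult[OF DERIV_ident psi_d[OF that]]]
        by (simp add: mult.commute)
    qed (use that P_nonneg in auto)
    then show ?thesis by simp
  qed
  define R1 where "R1 = max R0 1"
  define C where "C = R1 + 1 / c"
  have R1: "R1 \<ge> 1" "R1 \<ge> R0" unfolding R1_def by auto
  have C: "C > 0" "C \<ge> R1" "C * c \<ge> 1" unfolding C_def using R1 c by (auto simp: add_pos_pos field_simps)
  have "V r \<le> C * \<psi> r ^ (n - 1)" if r: "r > 0" for r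
  proof (cases "r \<le> R1")
    case True
    have "r * \<psi> r ^ (n - 1) \<le> C * \<psi> r ^ (n - 1)"
      using True C warp_pos[OF r] by (intro mult_right_mono) auto
    then show ?thesis using small[OF r] by linarith
  next
    case False
    have "C * \<psi> R1 ^ (n - 1) - V R1 \<le> C * \<psi> r ^ (n - 1) - V r"
    proof (rule DERIV_nonneg_imp_nondecreasing[of R1 r "\<lambda>r. C * \<psi> r ^ (n - 1) - V r"])
      fix x assume x: "R1 \<le> x" "x \<le> r"
      then have x0: "x > 0" using R1 by simp
      have "((\<lambda>r. C * \<psi> r ^ (n - 1) - V r) has_real_derivative C * P x - \<psi> x ^ (n - 1)) (at x)"
        by (intro DERIV_diff DERIV_cmult psi_d Vd x0)
      moreover have "\<psi> x ^ (n - 1) \<le> C * P x"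
      proof -
        have "1 * (1 * \<psi> x) \<le> real (n - 1) * (C * c * \<psi> x)"
          using dim_ge_2 C warp_pos[OF x0] by (intro mult_mono) auto
        also have "\<dots> \<le> real (n - 1) * (C * \<psi>' x)"
          using growth[of x] x R1 C by (intro mult_left_mono) auto
        finally have "\<psi> x \<le> real (n - 1) * (C * \<psi>' x)" by (simp only: mult_1_left)
        then have "\<psi> x * \<psi> x ^ (n - 1 - 1) \<le> (real (n - 1) * (C * \<psi>' x)) * \<psi> x ^ (n - 1 - 1)"
          by (rule mult_right_mono) (use warp_pos[OF x0] in simp)
        then show ?thesis unfolding P_def warp_power_split[of x] by (simp add: mult_ac)
      qed
      ultimately show "\<exists>y. ((\<lambda>r. C * \<psi> r ^ (n - 1) - V r) has_real_derivative y) (at x) \<and> 0 \<le> y" by auto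
    qed (use False in auto)
    moreover have "V R1 \<le> C * \<psi> R1 ^ (n - 1)"
    proof -
      have "R1 * \<psi> R1 ^ (n - 1) \<le> C * \<psi> R1 ^ (n - 1)"
        using C R1 warp_pos[of R1] by (intro mult_right_mono) auto
      then show ?thesis using small[of R1] R1 by linarith
    qed
    ultimately show ?thesis by linarith
  qed
  then show thesis using that C(1) V_lim Vd V_nonneg by blast
qed

text \<open>
  The field \<open>(V/\<psi>\<^sup>n\<^sup>-\<^sup>1) \<partial>\<^sub>r\<close> has Riemannian divergence \<open>1\<close> and length at most \<open>C\<close>. Integrating
  \<open>\<phi>\<^sup>2\<close> against this divergence by parts and absorbing half of \<open>\<phi>\<^sup>2\<close> bounds the \<open>L\<^sup>2\<close> norm of \<open>\<phi>\<close>
  by that of its radial derivative. In the chart, and relative to Lebesgue measure, the field is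
  \<open>K(|x|) x\<close> with \<open>K = V/r\<^sup>n\<close>, and its divergence is the volume density.
\<close>

lemma poincare_inequality:
  assumes dim: "CARD('n::finite) = n"
    and c: "c > 0" and growth: "\<And>r. r \<ge> R0 \<Longrightarrow> c * \<psi> r \<le> \<psi>' r"
  obtains C where "C > 0"
    "\<And>\<phi> :: real ^ 'n \<Rightarrow> real. test_function \<phi> \<Longrightarrow> (\<integral>x. vol_density (norm x) * (\<phi> x)\<^sup>2 \<partial>lborel) \<le> C *
      dirichlet_energy \<phi>"
proof -
  obtain V C where C: "C > 0" and V_lim: "(V \<longlongrightarrow> 0) (at_right 0)"
    and V_deriv: "\<And>r. r > 0 \<Longrightarrow> (V has_real_derivative \<psi> r ^ (n - 1)) (at r)"
    and V_nonneg: "\<And>r. r > 0 \<Longrightarrow> 0 \<le> V r" and V_le: "\<And>r. r > 0 \<Longrightarrow> V r \<le> C * \<psi> r ^ (n - 1)"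
    by (rule volume_le_sphere[of c R0, OF c growth]) (assumption | rule that)+
  define K where "K r = V r / r ^ n" for r
  have n: "n \<ge> 1" using dim_ge_2 by simp
  have K_lim: "(K \<longlongrightarrow> 1 / n) (at_right 0)"
    unfolding K_def
  proof (rule lhopital_right_0[where f' = "\<lambda>r. \<psi> r ^ (n - 1)" and g' = "\<lambda>r. real n * r ^ (n - 1)"])
    show "((\<lambda>r::real. r ^ n) \<longlongrightarrow> 0) (at_right 0)" using n by (auto intro!: tendsto_eq_intros)
    show "\<forall>\<^sub>F r in at_right 0. (r::real) ^ n \<noteq> 0"
      using eventually_at_right_less by eventually_elim simp
    show "\<forall>\<^sub>F r in at_right 0. real n * r ^ (n - 1) \<noteq> 0"
      using eventually_at_right_less by eventually_elim (use n in simp)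
    show "\<forall>\<^sub>F r in at_right 0. (V has_real_derivative \<psi> r ^ (n - 1)) (at r)"
      using eventually_at_right_less by eventually_elim (rule V_deriv)
    show "\<forall>\<^sub>F r::real in at_right 0. ((\<lambda>r. r ^ n) has_real_derivative real n * r ^ (n - 1)) (at r)"
      by (intro always_eventually allI) (auto intro!: derivative_eq_intros)
    have "((\<lambda>r. vol_density r / n) \<longlongrightarrow> 1 / n) (at_right 0)"
      by (intro tendsto_divide vol_density_limit tendsto_const) (use n in simp)
    then show "((\<lambda>r. \<psi> r ^ (n - 1) / (real n * r ^ (n - 1))) \<longlongrightarrow> 1 / n) (at_right 0)"
      by (simp add: vol_density_def power_divide mult.commute)
  qed (rule V_lim)
  have K_deriv: "(K has_real_derivative (vol_density r - real CARD('n) * K r) / r) (at r)" if "r > 0" for r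
  proof -
    have "(K has_real_derivative (\<psi> r ^ (n - 1) * r ^ n - V r * (real n * r ^ (n - 1))) / (r ^ n * r ^ n)) (at r)"
      unfolding K_def using that by (auto intro!: derivative_eq_intros V_deriv)
    moreover have "(\<psi> r ^ (n - 1) * r ^ n - V r * (real n * r ^ (n - 1))) / (r ^ n * r ^ n) =
        (vol_density r - real CARD('n) * K r) / r"
      unfolding K_def vol_density_def dim_power_split power_divide dim using that
      by (simp add: divide_simps) (simp add: algebra_simps)
    ultimately show ?thesis by simp
  qed
  have K_cont: "continuous_on {0<..} K"
    using K_deriv by (intro continuous_at_imp_continuous_on ballI) (auto intro: DERIV_isCont)
  have ineq: "(\<integral>x. vol_density (norm x) * (\<phi> x)\<^sup>2 \<partial>lborel) \<le> (4 * C\<^sup>2) *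
      dirichlet_energy \<phi>" if test: "test_function \<phi>" for \<phi> :: "real ^ 'n \<Rightarrow> real"
  proof -
    obtain d R B where deriv: "\<And>x. (\<phi> has_derivative (\<lambda>v. d x \<bullet> v)) (at x)" and d_cont: "continuous_on UNIV d"
      and \<phi>_cont: "continuous_on UNIV \<phi>" and RB: "R > 0" "B > 0"
      and supp: "\<And>x. norm x > R \<Longrightarrow> \<phi> x = 0" "\<And>x. norm x > R \<Longrightarrow> d x = 0"
      and bd: "\<And>x. \<bar>\<phi> x\<bar> \<le> B" "\<And>x. norm (d x) \<le> B"
      by (rule test_function_gradient[OF test]) (rule that; assumption)
    note [measurable] = borel_measurable_continuous_onI[OF d_cont] borel_measurable_continuous_onI[OF \<phi>_cont]
      vol_density_measurable borel_measurable_radial[OF K_cont]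
    define E where "E = (\<lambda>x. vol_density (norm x) * ((d x \<bullet> sgn x)\<^sup>2 +
      (norm x / \<psi> (norm x))\<^sup>2 * (d x \<bullet> d x - (d x \<bullet> sgn x)\<^sup>2)))"
    note energy = dirichlet_energy_test_function[OF dim test deriv, folded E_def]
    define J where "J x = (\<phi> x)\<^sup>2 * vol_density (norm x) + K (norm x) * (2 * \<phi> x * (d x \<bullet> x))" for x
    have J0: "(\<integral>x. J x \<partial>lborel) = 0"
      unfolding J_def
    proof (rule integral_radial_divergence_eq_0[where \<phi> = "\<lambda>x. (\<phi> x)\<^sup>2"
          and \<phi>' = "\<lambda>x h. 2 * \<phi> x * (d x \<bullet> h)" and K = K and D = vol_density and R = R
          and B = "B\<^sup>2" and B' = "2 * B * B"])
      show "((\<lambda>x. (\<phi> x)\<^sup>2) has_derivative (\<lambda>h. 2 * \<phi> x * (d x \<bullet> h))) (at x)" for x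
        by (auto intro!: derivative_eq_intros deriv)
      show "\<bar>(\<phi> x)\<^sup>2\<bar> \<le> B\<^sup>2" for x using power_mono[OF bd(1)[of x], of 2] by simp
      show "\<bar>2 * \<phi> x * (d x \<bullet> h)\<bar> \<le> 2 * B * B * norm h" for x h
      proof -
        have "\<bar>d x \<bullet> h\<bar> \<le> norm (d x) * norm h" by (rule Cauchy_Schwarz_ineq2)
        also have "\<dots> \<le> B * norm h" using bd(2) by (intro mult_right_mono) auto
        finally have "\<bar>\<phi> x\<bar> * \<bar>d x \<bullet> h\<bar> \<le> B * (B * norm h)" using bd(1) RB by (intro mult_mono) auto
        then show ?thesis by (simp add: abs_mult)
      qed
    qed (use supp K_deriv K_lim vol_density_continuous vol_density_limit in auto)
    obtain M1 where M1: "M1 > 0" "\<And>r. 0 < r \<Longrightarrow> r \<le> R \<Longrightarrow> \<bar>vol_density r\<bar> \<le> M1"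
      using bounded_on_if_limit_at_right[OF vol_density_continuous vol_density_limit] by blast
    obtain M2 where M2: "M2 > 0" "\<And>r. 0 < r \<Longrightarrow> r \<le> R \<Longrightarrow> \<bar>K r\<bar> \<le> M2"
      using bounded_on_if_limit_at_right[OF K_cont K_lim] by blast
    have int1: "integrable lborel (\<lambda>x. vol_density (norm x) * (\<phi> x)\<^sup>2)"
    proof (rule integrable_if_bounded_support[where M = "M1 * B\<^sup>2" and R = R])
      fix x :: "real ^ 'n" assume "x \<noteq> 0"
      then show "\<bar>vol_density (norm x) * (\<phi> x)\<^sup>2\<bar> \<le> M1 * B\<^sup>2 * indicator (cball 0 R) x"
        using M1 power_mono[OF bd(1)[of x], of 2] supp(1)[of x]
        by (cases "norm x > R") (auto simp: abs_mult intro!: mult_mono)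
    qed measurable
    have int2: "integrable lborel (\<lambda>x. K (norm x) * (2 * \<phi> x * (d x \<bullet> x)))"
    proof (rule integrable_if_bounded_support[where M = "M2 * (2 * B * (B * R))" and R = R])
      fix x :: "real ^ 'n" assume x: "x \<noteq> 0"
      show "\<bar>K (norm x) * (2 * \<phi> x * (d x \<bullet> x))\<bar> \<le> M2 * (2 * B * (B * R)) * indicator (cball 0 R) x"
      proof (cases "norm x > R")
        case False
        have "\<bar>d x \<bullet> x\<bar> \<le> norm (d x) * norm x" by (rule Cauchy_Schwarz_ineq2)
        also have "\<dots> \<le> B * R" using bd(2) False RB by (intro mult_mono) auto
        finally have "\<bar>K (norm x)\<bar> * (2 * \<bar>\<phi> x\<bar> * \<bar>d x \<bullet> x\<bar>) \<le> M2 * (2 * B * (B * R))"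
          using M2 bd(1) RB x False by (intro mult_mono) auto
        then show ?thesis using False by (simp add: abs_mult)
      qed (simp add: supp)
    qed measurable
    have intJ: "integrable lborel J"
      unfolding J_def using Bochner_Integration.integrable_add[OF int1 int2] by (simp add: mult.commute)
    have pointwise: "vol_density (norm x) * (\<phi> x)\<^sup>2 / 2 \<le> J x + 2 * C\<^sup>2 * E x" if x: "x \<noteq> 0" for x
    proof -
      define r where "r = norm x"
      have r: "r > 0" unfolding r_def using x by simp
      define G where "G = V r / \<psi> r ^ (n - 1)"
      define y where "y = d x \<bullet> sgn x"
      have \<psi>r: "\<psi> r ^ (n - 1) > 0" using warp_pos[OF r] by simp
      have G: "0 \<le> G" "G \<le> C"
        unfolding G_def using V_nonneg[OF r] V_le[OF r] \<psi>r by (auto simp: divide_le_eq)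
      have "d x \<bullet> x = r * y" unfolding y_def r_def using x by (simp add: sgn_div_norm)
      moreover have "K r * r = vol_density r * G"
        unfolding K_def vol_density_def G_def dim_power_split power_divide using r \<psi>r warp_pos[OF r] by (simp add: field_simps)
      ultimately have K: "K r * (2 * \<phi> x * (d x \<bullet> x)) = vol_density r * (2 * \<phi> x * (G * y))"
        by (simp add: mult_ac)
      \<comment> \<open>Young's inequality for the cross term \<open>2 \<phi> (G y)\<close>.\<close>
      have "0 \<le> (\<phi> x + 2 * (G * y))\<^sup>2" by simp
      then have "(\<phi> x)\<^sup>2 / 2 \<le> (\<phi> x)\<^sup>2 + 2 * \<phi> x * (G * y) + 2 * (G\<^sup>2 * y\<^sup>2)"
        by (simp add: power2_eq_square algebra_simps)
      also have "\<dots> \<le> (\<phi> x)\<^sup>2 + 2 * \<phi> x * (G * y) + 2 * (C\<^sup>2 * y\<^sup>2)"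
        using G by (intro add_left_mono mult_left_mono mult_right_mono power_mono) auto
      finally have "vol_density r * ((\<phi> x)\<^sup>2 / 2) \<le> vol_density r * ((\<phi> x)\<^sup>2 + 2 * \<phi> x * (G * y) + 2 * (C\<^sup>2 * y\<^sup>2))"
        using vol_density_pos[OF r] by (intro mult_left_mono) auto
      also have "\<dots> = J x + 2 * C\<^sup>2 * (vol_density r * y\<^sup>2)"
        unfolding J_def r_def[symmetric] K by (simp add: algebra_simps)
      also have "\<dots> \<le> J x + 2 * C\<^sup>2 * E x"
      proof -
        have "(d x \<bullet> sgn x)\<^sup>2 \<le> (d x \<bullet> d x) * (sgn x \<bullet> sgn x)" by (rule Cauchy_Schwarz_ineq)
        then have "y\<^sup>2 \<le> d x \<bullet> d x" unfolding y_def using x by (simp add: dot_square_norm norm_sgn)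
        then have "vol_density r * y\<^sup>2 \<le> E x"
          unfolding E_def y_def[symmetric] r_def[symmetric] using vol_density_pos[OF r] by (intro mult_left_mono) auto
        then show ?thesis by (intro add_left_mono mult_left_mono) auto
      qed
      finally show ?thesis unfolding r_def by simp
    qed
    have "(\<integral>x. vol_density (norm x) * (\<phi> x)\<^sup>2 / 2 \<partial>lborel) \<le> (\<integral>x. J x + 2 * C\<^sup>2 * E x \<partial>lborel)"
    proof (rule integral_mono_AE)
      show "AE x in lborel. vol_density (norm x) * (\<phi> x)\<^sup>2 / 2 \<le> J x + 2 * C\<^sup>2 * E x"
        by (rule AE_nonzero) (rule pointwise)
    qed (use int1 intJ energy(1) in auto)
    also have "\<dots> = 2 * C\<^sup>2 * (\<integral>x. E x \<partial>lborel)"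
      using J0 intJ energy(1) by simp
    finally show ?thesis unfolding energy(2) by simp
  qed
  show thesis by (rule that[of "4 * C\<^sup>2"]) (use C ineq in auto)
qed

section \<open>Stability of radial functions\<close>

text \<open>
  The bound depends on \<open>U\<close> only through \<open>A\<close>, so it can serve as a common majorant for a sequence of
  potentials.
\<close>

lemma potential_density_bound:
  fixes \<phi> :: "real ^ 'n \<Rightarrow> real"
  assumes p: "p > 1" and test: "test_function \<phi>"
  obtains M R where "\<And>U x. x \<noteq> 0 \<Longrightarrow> \<bar>U (norm x)\<bar> \<le> A \<Longrightarrow>
    \<bar>vol_density (norm x) * (\<bar>U (norm x)\<bar> powr (p - 1) * (\<phi> x)\<^sup>2)\<bar> \<le> M * indicator (cball 0 R) x"
proof -
  obtain d R B where supp: "\<And>x. norm x > R \<Longrightarrow> \<phi> x = 0" and bd: "\<And>x. \<bar>\<phi> x\<bar> \<le> B"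
    by (rule test_function_gradient[OF test]) (rule that; assumption)
  obtain M where M: "M > 0" "\<And>r. 0 < r \<Longrightarrow> r \<le> R \<Longrightarrow> \<bar>vol_density r\<bar> \<le> M"
    using bounded_on_if_limit_at_right[OF vol_density_continuous vol_density_limit] by blast
  show thesis
  proof (rule that[of "M * (A powr (p - 1) * B\<^sup>2)" R])
    fix U and x :: "real ^ 'n" assume x: "x \<noteq> 0" and A: "\<bar>U (norm x)\<bar> \<le> A"
    show "\<bar>vol_density (norm x) * (\<bar>U (norm x)\<bar> powr (p - 1) * (\<phi> x)\<^sup>2)\<bar> \<le>
        M * (A powr (p - 1) * B\<^sup>2) * indicator (cball 0 R) x"
    proof (cases "norm x > R")
      case False
      have "\<bar>U (norm x)\<bar> powr (p - 1) \<le> A powr (p - 1)" using A p by (intro powr_mono2) auto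
      moreover have "(\<phi> x)\<^sup>2 \<le> B\<^sup>2" using power_mono[OF bd(1)[of x], of 2] by simp
      ultimately have "\<bar>vol_density (norm x)\<bar> * (\<bar>U (norm x)\<bar> powr (p - 1) * (\<phi> x)\<^sup>2) \<le> M * (A powr (p - 1) * B\<^sup>2)"
        using M x False by (intro mult_mono) auto
      then show ?thesis using False by (simp add: abs_mult)
    qed (simp add: supp)
  qed
qed

lemma potential_density_measurable:
  fixes \<phi> :: "real ^ 'n \<Rightarrow> real"
  assumes U: "continuous_on {0<..} U" and test: "test_function \<phi>"
  shows "(\<lambda>x. \<bar>U (norm x)\<bar> powr (p - 1) * (\<phi> x)\<^sup>2) \<in> borel_measurable borel"
    and "(\<lambda>x. vol_density (norm x) * (\<bar>U (norm x)\<bar> powr (p - 1) * (\<phi> x)\<^sup>2)) \<in> borel_measurable borel"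
proof -
  have "C_k 0 \<phi>" using test unfolding test_function_def by blast
  then have \<phi>: "continuous_on UNIV \<phi>" by simp
  note [measurable] = borel_measurable_continuous_onI[OF \<phi>] borel_measurable_radial[OF U] vol_density_measurable
  show "(\<lambda>x. \<bar>U (norm x)\<bar> powr (p - 1) * (\<phi> x)\<^sup>2) \<in> borel_measurable borel"
    "(\<lambda>x. vol_density (norm x) * (\<bar>U (norm x)\<bar> powr (p - 1) * (\<phi> x)\<^sup>2)) \<in> borel_measurable borel"
    by measurable
qed

lemma potential_integral:
  fixes \<phi> :: "real ^ 'n \<Rightarrow> real"
  assumes dim: "CARD('n) = n" and p: "p > 1" and U: "continuous_on {0<..} U"
    and A: "\<forall>r>0. \<bar>U r\<bar> \<le> A" and test: "test_function \<phi>"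
  shows "integrable lborel (\<lambda>x. vol_density (norm x) * (\<bar>U (norm x)\<bar> powr (p - 1) * (\<phi> x)\<^sup>2))"
    and "(LINT x|riemannian_volume (model_metric \<psi>). \<bar>U (norm x)\<bar> powr (p - 1) * (\<phi> x)\<^sup>2) =
      potential_energy p U \<phi>"
proof -
  obtain M R where M: "\<And>U x. x \<noteq> 0 \<Longrightarrow> \<bar>U (norm x)\<bar> \<le> A \<Longrightarrow>
    \<bar>vol_density (norm x) * (\<bar>U (norm x)\<bar> powr (p - 1) * (\<phi> x)\<^sup>2)\<bar> \<le> M * indicator (cball 0 R) x"
    using potential_density_bound[OF p test, of A] by blast
  show "integrable lborel (\<lambda>x. vol_density (norm x) * (\<bar>U (norm x)\<bar> powr (p - 1) * (\<phi> x)\<^sup>2))"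
    by (rule integrable_if_bounded_support[OF potential_density_measurable(2)[OF U test]]) (rule M, use A in auto)
  show "(LINT x|riemannian_volume (model_metric \<psi>). \<bar>U (norm x)\<bar> powr (p - 1) * (\<phi> x)\<^sup>2) = potential_energy p U \<phi>"
    by (rule integral_model_volume[OF dim potential_density_measurable(1)[OF U test]])
qed

lemma stable_solution_radial_iff:
  assumes dim: "CARD('n::finite) = n" and p: "p > 1" and U: "continuous_on {0<..} U"
    and A: "\<forall>r>0. \<bar>U r\<bar> \<le> A"
  shows "stable_solution (model_metric \<psi>) p (\<lambda>x::real ^ 'n. U (norm x)) \<longleftrightarrow>
    (\<forall>\<phi>::real ^ 'n \<Rightarrow> real. test_function \<phi> \<longrightarrow>
      p * potential_energy p U \<phi> \<le> dirichlet_energy \<phi>)"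
  unfolding stable_solution_def using potential_integral(2)[OF dim p U A] by auto

text \<open>
  The Dirichlet energy does not depend on the solution, so a smaller potential can only increase the
  quadratic form.
\<close>

lemma stable_solution_mono:
  assumes dim: "CARD('n::finite) = n" and p: "p > 1"
    and U: "continuous_on {0<..} U" and V: "continuous_on {0<..} V"
    and le: "\<And>r. r > 0 \<Longrightarrow> \<bar>U r\<bar> \<le> \<bar>V r\<bar>" and A: "\<forall>r>0. \<bar>V r\<bar> \<le> A"
    and stable: "stable_solution (model_metric \<psi>) p (\<lambda>x::real ^ 'n. V (norm x))"
  shows "stable_solution (model_metric \<psi>) p (\<lambda>x::real ^ 'n. U (norm x))"
proof -
  have AU: "\<forall>r>0. \<bar>U r\<bar> \<le> A" using le A by force
  show ?thesis
    unfolding stable_solution_radial_iff[OF dim p U AU]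
  proof (intro allI impI)
    fix \<phi> :: "real ^ 'n \<Rightarrow> real" assume test: "test_function \<phi>"
    have "potential_energy p U \<phi> \<le>
        potential_energy p V \<phi>"
    proof (rule integral_mono_AE[OF potential_integral(1)[OF dim p U AU test] potential_integral(1)[OF dim p V A test]])
      show "AE x in lborel. vol_density (norm x) * (\<bar>U (norm x)\<bar> powr (p - 1) * (\<phi> x)\<^sup>2)
          \<le> vol_density (norm x) * (\<bar>V (norm x)\<bar> powr (p - 1) * (\<phi> x)\<^sup>2)"
        using le p by (intro AE_nonzero mult_left_mono mult_right_mono powr_mono2 less_imp_le[OF vol_density_pos]) auto
    qed
    then have "p * potential_energy p U \<phi> \<le>
        p * potential_energy p V \<phi>"
      using p by (intro mult_left_mono) auto
    also have "\<dots> \<le> dirichlet_energy \<phi>"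
      using stable test unfolding stable_solution_radial_iff[OF dim p V A] by blast
    finally show "p * potential_energy p U \<phi>
      \<le> dirichlet_energy \<phi>" .
  qed
qed

lemma stable_solution_limit:
  assumes dim: "CARD('n::finite) = n" and p: "p > 1"
    and U: "\<And>k. continuous_on {0<..} (U k)" and V: "continuous_on {0<..} V"
    and A: "\<And>k. \<forall>r>0. \<bar>U k r\<bar> \<le> A"
    and lim: "\<And>r. r > 0 \<Longrightarrow> (\<lambda>k. U k r) \<longlonglongrightarrow> V r"
    and stable: "\<And>k. stable_solution (model_metric \<psi>) p (\<lambda>x::real ^ 'n. U k (norm x))"
  shows "stable_solution (model_metric \<psi>) p (\<lambda>x::real ^ 'n. V (norm x))"
proof -
  have AV: "\<forall>r>0. \<bar>V r\<bar> \<le> A"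
  proof (intro allI impI)
    fix r :: real assume "r > 0"
    then show "\<bar>V r\<bar> \<le> A"
      by (intro tendsto_upperbound[OF tendsto_rabs[OF lim]]) (use A in auto)
  qed
  show ?thesis
    unfolding stable_solution_radial_iff[OF dim p V AV]
  proof (intro allI impI)
    fix \<phi> :: "real ^ 'n \<Rightarrow> real" assume test: "test_function \<phi>"
    obtain M R where M: "\<And>U x. x \<noteq> 0 \<Longrightarrow> \<bar>U (norm x)\<bar> \<le> A \<Longrightarrow>
      \<bar>vol_density (norm x) * (\<bar>U (norm x)\<bar> powr (p - 1) * (\<phi> x)\<^sup>2)\<bar> \<le> M * indicator (cball 0 R) x"
      using potential_density_bound[OF p test, of A] by blast
    have "(\<lambda>k. potential_energy p (U k) \<phi>) \<longlonglongrightarrow> potential_energy p V \<phi>"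
    proof (rule integral_limit_bounded_support[OF potential_density_measurable(2)[OF U test]
          potential_density_measurable(2)[OF V test]])
      show "\<bar>vol_density (norm x) * (\<bar>U k (norm x)\<bar> powr (p - 1) * (\<phi> x)\<^sup>2)\<bar> \<le> M * indicator (cball 0 R) x"
        if "x \<noteq> 0" for k x by (rule M) (use A that in auto)
    next
      fix x :: "real ^ 'n" assume x: "x \<noteq> 0"
      have "(\<lambda>k. \<bar>U k (norm x)\<bar> powr (p - 1)) \<longlonglongrightarrow> \<bar>V (norm x)\<bar> powr (p - 1)"
        using lim[of "norm x"] x p by (intro tendsto_powr2 tendsto_intros) auto
      then show "(\<lambda>k. vol_density (norm x) * (\<bar>U k (norm x)\<bar> powr (p - 1) * (\<phi> x)\<^sup>2)) \<longlonglongrightarrow>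
          vol_density (norm x) * (\<bar>V (norm x)\<bar> powr (p - 1) * (\<phi> x)\<^sup>2)"
        by (intro tendsto_mult_left tendsto_mult_right)
    qed
    then have "(\<lambda>k. p * potential_energy p (U k) \<phi>) \<longlonglongrightarrow>
        p * potential_energy p V \<phi>"
      by (rule tendsto_mult_left)
    moreover have "p * potential_energy p (U k) \<phi> \<le> dirichlet_energy \<phi>" for k
      using stable[of k] test unfolding stable_solution_radial_iff[OF dim p U A] by blast
    ultimately show "p * potential_energy p V \<phi>
      \<le> dirichlet_energy \<phi>"
      by (intro tendsto_upperbound[where F = sequentially]) auto
  qed
qed

lemma stable_solution_small:
  assumes dim: "CARD('n::finite) = n" and p: "p > 1"
    and c: "c > 0" and growth: "\<And>r. r \<ge> R0 \<Longrightarrow> c * \<psi> r \<le> \<psi>' r"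
  obtains A where "A > 0"
    "\<And>U. continuous_on {0<..} U \<Longrightarrow> \<forall>r>0. \<bar>U r\<bar> \<le> A \<Longrightarrow>
      stable_solution (model_metric \<psi>) p (\<lambda>x::real ^ 'n. U (norm x))"
proof -
  obtain C where C: "C > 0" and poincare: "\<And>\<phi> :: real ^ 'n \<Rightarrow> real. test_function \<phi> \<Longrightarrow>
      (\<integral>x. vol_density (norm x) * (\<phi> x)\<^sup>2 \<partial>lborel) \<le> C * dirichlet_energy \<phi>"
    by (rule poincare_inequality[of c R0, OF dim c growth]) (assumption | rule that)+
  \<comment> \<open>The value with \<open>p A\<^sup>p\<^sup>-\<^sup>1 = 1/C\<close>.\<close>
  define A where "A = (1 / (p * C)) powr (1 / (p - 1))"
  have A0: "A > 0" unfolding A_def using p C by simp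
  have Ap: "p * A powr (p - 1) = 1 / C"
    unfolding A_def using p C by (simp add: powr_powr)
  have "stable_solution (model_metric \<psi>) p (\<lambda>x::real ^ 'n. U (norm x))"
    if U: "continuous_on {0<..} U" and A: "\<forall>r>0. \<bar>U r\<bar> \<le> A" for U
    unfolding stable_solution_radial_iff[OF dim p U A]
  proof (intro allI impI)
    fix \<phi> :: "real ^ 'n \<Rightarrow> real" assume test: "test_function \<phi>"
    have le: "potential_energy p U \<phi> \<le>
        potential_energy p (\<lambda>r. A) \<phi>"
    proof (rule integral_mono_AE[OF potential_integral(1)[OF dim p U A test]
          potential_integral(1)[OF dim p, of "\<lambda>r. A" A \<phi>]])
      show "AE x in lborel. vol_density (norm x) * (\<bar>U (norm x)\<bar> powr (p - 1) * (\<phi> x)\<^sup>2)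
          \<le> vol_density (norm x) * (\<bar>(\<lambda>r. A) (norm x)\<bar> powr (p - 1) * (\<phi> x)\<^sup>2)"
        using A p A0 by (intro AE_nonzero mult_left_mono mult_right_mono powr_mono2 less_imp_le[OF vol_density_pos]) auto
    qed (use test A0 in auto)
    also have "\<dots> = A powr (p - 1) * (\<integral>x. vol_density (norm x) * (\<phi> x)\<^sup>2 \<partial>lborel)"
      using A0 by (subst integral_mult_right_zero[symmetric]) (simp add: mult_ac)
    finally have "p * potential_energy p U \<phi> \<le>
        (p * A powr (p - 1)) * (\<integral>x. vol_density (norm x) * (\<phi> x)\<^sup>2 \<partial>lborel)"
      using p by (simp add: mult.assoc)
    also have "\<dots> \<le> (p * A powr (p - 1)) * (C * dirichlet_energy \<phi>)"
      using poincare[OF test] p by (intro mult_left_mono) auto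
    also have "\<dots> = dirichlet_energy \<phi>" unfolding Ap using C by simp
    finally show "p * potential_energy p U \<phi>
      \<le> dirichlet_energy \<phi>" .
  qed
  then show thesis using that A0 by blast
qed

section \<open>Testing with a radial function on a ball\<close>

text \<open>
  The variable \<open>s = r\<^sup>2\<close> is chosen because polynomials in \<open>|x|\<^sup>2\<close>, unlike polynomials in \<open>|x|\<close>,
  are smooth at the pole.
\<close>

lemma radial_poisson_square_variable:
  assumes "radial_poisson z z' q"
  obtains \<omega> where "continuous_on {0..} \<omega>"
    "\<And>s. s > 0 \<Longrightarrow> ((\<lambda>s. z (sqrt s)) has_real_derivative \<omega> s) (at s)"
    "\<And>r. r > 0 \<Longrightarrow> z' r = 2 * r * \<omega> (r\<^sup>2)"
proof -
  obtain L where L: "((\<lambda>r. z' r / r) \<longlongrightarrow> L) (at_right 0)"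
    using assms unfolding radial_poisson_def by blast
  have z: "(z has_real_derivative z' r) (at r)" and z'_cont: "isCont z' r" if "r > 0" for r
    using assms that unfolding radial_poisson_def by (auto intro: DERIV_isCont)
  define \<omega> where "\<omega> s = (if s = 0 then L / 2 else z' (sqrt s) / (2 * sqrt s))" for s
  have "continuous (at s within {0..}) \<omega>" if "s \<ge> 0" for s
  proof (cases "s = 0")
    case True
    have "filterlim sqrt (at_right 0) (at_right 0)"
      unfolding filterlim_at by (auto intro!: tendsto_eq_intros simp: eventually_at_filter)
    then have "((\<lambda>s. z' (sqrt s) / sqrt s / 2) \<longlongrightarrow> L / 2) (at_right 0)"
      by (intro tendsto_divide tendsto_const filterlim_compose[OF L]) auto
    then have "(\<omega> \<longlongrightarrow> L / 2) (at_right 0)"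
      by (rule Lim_transform_eventually) (auto simp: \<omega>_def eventually_at_filter)
    then show ?thesis using True by (simp add: continuous_within at_within_nonneg_eq \<omega>_def)
  next
    case False
    then have "s > 0" using that by simp
    have "continuous_on {0<..} (\<lambda>s. z' (sqrt s) / (2 * sqrt s))"
    proof (intro continuous_intros)
      show "continuous_on {0<..} (\<lambda>s. z' (sqrt s))"
        by (rule continuous_on_compose2[of "{0<..}" z' _ sqrt])
          (auto intro!: continuous_at_imp_continuous_on z'_cont isCont_real_sqrt)
    qed auto
    then have "continuous_on {0<..} \<omega>"
      by (rule continuous_on_eq) (simp add: \<omega>_def)
    then have "isCont \<omega> s"
      using \<open>s > 0\<close> by (simp add: continuous_on_eq_continuous_at)
    then show ?thesis by (rule continuous_at_imp_continuous_at_within)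
  qed
  then have "continuous_on {0..} \<omega>" by (simp add: continuous_on_eq_continuous_within)
  moreover have "((\<lambda>s. z (sqrt s)) has_real_derivative \<omega> s) (at s)" if "s > 0" for s
  proof -
    have "((\<lambda>s. z (sqrt s)) has_real_derivative z' (sqrt s) * (inverse (sqrt s) / 2)) (at s)"
      by (rule DERIV_chain2[OF z DERIV_real_sqrt]) (use that in auto)
    then show ?thesis using that by (simp add: \<omega>_def field_simps)
  qed
  moreover have "z' r = 2 * r * \<omega> (r\<^sup>2)" if "r > 0" for r using that by (simp add: \<omega>_def)
  ultimately show thesis using that by blast
qed

text \<open>
  The divergence theorem for \<open>z \<nabla> z\<close>, whose boundary term vanishes with \<open>z\<close>. To stay with fields
  differentiable on the whole space, the field is multiplied by the cutoff
  \<open>exp(-\<delta>/(R\<^sup>2 - |x|\<^sup>2))\<close>. The error term stays bounded as \<open>\<delta> \<rightarrow> 0\<close>, since \<open>z\<close> vanishes linearly at the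
  boundary, and tends to \<open>0\<close> pointwise.
\<close>

lemma green_identity_on_ball:
  assumes dim: "CARD('n::finite) = n" and z: "radial_poisson z z' q" and R: "R > 0" and zR: "z R = 0"
  shows "(\<integral>x. indicator (ball 0 R) x * (vol_density (norm x) * ((z' (norm x))\<^sup>2 - q (norm x) * z (norm x))) \<partial>(lborel :: (real ^ 'n) measure)) = 0"
proof -
  obtain \<omega> where \<omega>: "continuous_on {0..} \<omega>"
    "\<And>s. s > 0 \<Longrightarrow> ((\<lambda>s. z (sqrt s)) has_real_derivative \<omega> s) (at s)"
    "\<And>r. r > 0 \<Longrightarrow> z' r = 2 * r * \<omega> (r\<^sup>2)"
    using radial_poisson_square_variable[OF z] by blast
  obtain P p :: "nat \<Rightarrow> real \<Rightarrow> real" and C where C: "C > 0"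
    and \<omega>_bd: "\<And>s. 0 \<le> s \<Longrightarrow> s \<le> R\<^sup>2 \<Longrightarrow> \<bar>\<omega> s\<bar> \<le> C"
    and z_bd: "\<And>s. 0 < s \<Longrightarrow> s \<le> R\<^sup>2 \<Longrightarrow> \<bar>z (sqrt s)\<bar> \<le> C * (R\<^sup>2 - s)"
  proof (rule polynomial_C1_approximation[of "R\<^sup>2" \<omega> "\<lambda>s. z (sqrt s)"])
    show "continuous_on {0..R\<^sup>2} \<omega>" by (rule continuous_on_subset[OF \<omega>(1)]) auto
  qed (use R zR \<omega>(2) that in auto)
  have zd: "(z has_real_derivative z' r) (at r)"
    "(z' has_real_derivative - (real (n - 1) * (\<psi>' r / \<psi> r) * z' r) - q r) (at r)" if "r > 0" for r
    using z that unfolding radial_poisson_def by auto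
  note cont = radial_poisson_continuous[OF z]
  have q_lim: "(q \<longlongrightarrow> q 0) (at_right 0)"
    using z unfolding radial_poisson_def by (blast intro: limit_at_right_if_continuous)
  obtain L where L: "((\<lambda>r. z' r / r) \<longlongrightarrow> L) (at_right 0)"
    using z unfolding radial_poisson_def by blast
  define D where "D r = vol_density r * ((z' r)\<^sup>2 - q r * z r)" for r
  define K where "K r = vol_density r * (z r * (z' r / r))" for r
  have D_cont: "continuous_on {0<..} D"
    unfolding D_def by (intro continuous_intros vol_density_continuous cont)
  have D_lim: "(D \<longlongrightarrow> 1 * (0\<^sup>2 - q 0 * z 0)) (at_right 0)"
    unfolding D_def by (intro tendsto_intros vol_density_limit radial_poisson_limits[OF z] q_lim)
  have K_lim: "(K \<longlongrightarrow> 1 * (z 0 * L)) (at_right 0)"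
    unfolding K_def by (intro tendsto_mult vol_density_limit radial_poisson_limits[OF z] L)
  have K_deriv: "(K has_real_derivative (D r - real CARD('n) * K r) / r) (at r)" if r: "r > 0" for r
  proof -
    define N where "N r = \<psi> r ^ (n - 1) * (z r * z' r)" for r
    have N: "(N has_real_derivative \<psi> r ^ (n - 1) * ((z' r)\<^sup>2 - q r * z r)) (at r)"
    proof -
      define T where "T = \<psi> r ^ (n - 1 - 1)"
      have pw: "\<psi> r ^ (n - 1) = \<psi> r * T"
        unfolding T_def by (rule warp_power_split)
      have "((\<lambda>r. \<psi> r ^ (n - 1)) has_real_derivative real (n - 1) * (\<psi>' r * T)) (at r)"
        unfolding T_def using r by (auto intro!: derivative_eq_intros warp_deriv)
      from DERIV_mult[OF this DERIV_mult[OF zd(1)[OF r] zd(2)[OF r]]]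
      have "(N has_real_derivative real (n - 1) * (\<psi>' r * T) * (z r * z' r) +
          (z' r * z' r + (- (real (n - 1) * (\<psi>' r / \<psi> r) * z' r) - q r) * z r) * \<psi> r ^ (n - 1)) (at r)"
        unfolding N_def .
      moreover have "real (n - 1) * (\<psi>' r * T) * (z r * z' r) +
          (z' r * z' r + (- (real (n - 1) * (\<psi>' r / \<psi> r) * z' r) - q r) * z r) * \<psi> r ^ (n - 1) =
          \<psi> r ^ (n - 1) * ((z' r)\<^sup>2 - q r * z r)"
        unfolding pw using warp_pos[OF r] by (simp add: field_simps power2_eq_square)
      ultimately show ?thesis by simp
    qed
    have K_eq: "K s = N s / s ^ n" if "s > 0" for s
      unfolding K_def N_def vol_density_def dim_power_split power_divide using that by (simp add: field_simps)
    have "((\<lambda>s. N s / s ^ n) has_real_derivative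
        (\<psi> r ^ (n - 1) * ((z' r)\<^sup>2 - q r * z r) * r ^ n - N r * (real n * r ^ (n - 1))) / (r ^ n * r ^ n)) (at r)"
      using r by (auto intro!: derivative_eq_intros N)
    moreover have "(\<psi> r ^ (n - 1) * ((z' r)\<^sup>2 - q r * z r) * r ^ n - N r * (real n * r ^ (n - 1))) / (r ^ n * r ^ n)
        = (D r - real CARD('n) * K r) / r"
      unfolding K_eq[OF r] D_def vol_density_def dim_power_split power_divide dim using r
      by (simp add: divide_simps) (simp add: algebra_simps)
    ultimately have "((\<lambda>s. N s / s ^ n) has_real_derivative (D r - real CARD('n) * K r) / r) (at r)" by simp
    then show ?thesis
      by (rule has_field_derivative_transform_within_open[where S = "{0<..}"]) (use r K_eq in auto)
  qed
  have K_cont: "continuous_on {0<..} K"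
    using K_deriv by (intro continuous_at_imp_continuous_on ballI) (auto intro: DERIV_isCont)
  define e where "e k x = flat_exp (1 / real (Suc k)) 0 (R\<^sup>2 - x \<bullet> x)" for k and x :: "real ^ 'n"
  \<comment> \<open>The cutoff \<open>e k\<close> has gradient \<open>- 2 f k x\<close> times \<open>x\<close>.\<close>
  define f where "f k x = 1 / real (Suc k) * flat_exp (1 / real (Suc k)) 2 (R\<^sup>2 - x \<bullet> x)" for k and x :: "real ^ 'n"
  have \<delta>: "1 / real (Suc k) > 0" for k by simp
  have in_ball: "R\<^sup>2 - x \<bullet> x > 0 \<longleftrightarrow> norm x < R" for x :: "real ^ 'n"
    by (rule in_ball_iff_inner[OF R])
  have e_deriv: "(e k has_derivative (\<lambda>v. (- 2 * f k x) * (x \<bullet> v))) (at x)" for k x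
    using has_derivative_radial_bump[OF \<delta>[of k], of "\<lambda>s. 1" "\<lambda>s. 0" "R\<^sup>2" x]
    unfolding e_def[abs_def] f_def by simp
  have e_test: "test_function (e k)" for k
    using test_function_radial_bump[OF \<delta>[of k] real_polynomial_function.intros(2)[of 1], of "R\<^sup>2"]
    unfolding e_def[abs_def] by simp
  have e_out: "e k x = 0" "f k x = 0" if "norm x \<ge> R" for k x
    using in_ball[of x] that by (auto simp: e_def f_def flat_exp_def)
  have zero: "(\<integral>x. e k x * D (norm x) + K (norm x) * (- 2 * f k x * (x \<bullet> x)) \<partial>lborel) = 0" for k
  proof -
    obtain d R' B where d: "\<And>x. (e k has_derivative (\<lambda>v. d x \<bullet> v)) (at x)" "\<And>x. norm (d x) \<le> B"
      by (rule test_function_gradient[OF e_test[of k]]) (rule that; assumption)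
    show ?thesis
    proof (rule integral_radial_divergence_eq_0[where \<phi> = "e k" and \<phi>' = "\<lambda>x v. - 2 * f k x * (x \<bullet> v)" and R = R
          and K = K and D = D and B = 1 and B' = B])
      show "\<bar>e k x\<bar> \<le> 1" for x
        using flat_exp_bounds(2)[OF \<delta>[of k], of "R\<^sup>2 - x \<bullet> x"] flat_exp_bounds(1)[OF \<delta>[of k], of 0 "R\<^sup>2 - x \<bullet> x"]
        by (simp add: e_def)
      show "\<bar>- 2 * f k x * (x \<bullet> h)\<bar> \<le> B * norm h" for x h
      proof -
        have "- 2 * f k x * (x \<bullet> h) = d x \<bullet> h"
          using has_derivative_unique[OF e_deriv d(1)] by metis
        then show ?thesis
          using Cauchy_Schwarz_ineq2[of "d x" h] mult_right_mono[OF d(2)[of x], of "norm h"] by simp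
      qed
    qed (use e_deriv e_out K_deriv K_lim D_cont D_lim in auto)
  qed
  obtain M1 where M1: "M1 > 0" "\<And>r. 0 < r \<Longrightarrow> r \<le> R \<Longrightarrow> \<bar>vol_density r\<bar> \<le> M1"
    using bounded_on_if_limit_at_right[OF vol_density_continuous vol_density_limit] by blast
  obtain M2 where M2: "M2 > 0" "\<And>r. 0 < r \<Longrightarrow> r \<le> R \<Longrightarrow> \<bar>D r\<bar> \<le> M2"
    using bounded_on_if_limit_at_right[OF D_cont D_lim] by blast
  have [measurable]: "(\<lambda>x::real ^ 'n. D (norm x)) \<in> borel_measurable borel"
    "(\<lambda>x::real ^ 'n. K (norm x)) \<in> borel_measurable borel" "ball (0::real ^ 'n) R \<in> sets borel"
    by (auto intro: borel_measurable_radial D_cont K_cont)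
  have flat_meas[measurable]: "flat_exp \<delta> j \<in> borel_measurable borel" for \<delta> j
    unfolding flat_exp_def[abs_def] by measurable
  have "(\<lambda>k. \<integral>x. e k x * D (norm x) + K (norm x) * (- 2 * f k x * (x \<bullet> x)) \<partial>lborel) \<longlonglongrightarrow>
      (\<integral>x. indicator (ball 0 R) x * D (norm x) \<partial>(lborel :: (real ^ 'n) measure))"
  proof (rule integral_limit_bounded_support[where R = R and M = "M2 + M1 * (C * (2 * C)) * (2 * R\<^sup>2)"])
    show "(\<lambda>x. e k x * D (norm x) + K (norm x) * (- 2 * f k x * (x \<bullet> x))) \<in> borel_measurable borel" for k
      unfolding e_def f_def by measurable
    show "(\<lambda>x::real ^ 'n. indicator (ball 0 R) x * D (norm x)) \<in> borel_measurable borel"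
      by measurable
  next
    fix k and x :: "real ^ 'n" assume x: "x \<noteq> 0"
    show "\<bar>e k x * D (norm x) + K (norm x) * (- 2 * f k x * (x \<bullet> x))\<bar> \<le>
        (M2 + M1 * (C * (2 * C)) * (2 * R\<^sup>2)) * indicator (cball 0 R) x"
    proof (cases "norm x < R")
      case False
      then show ?thesis using e_out[of x] M1 M2 C by (simp add: indicator_def)
    next
      case True
      define r where "r = norm x"
      define \<tau> where "\<tau> = R\<^sup>2 - r\<^sup>2"
      have xx: "x \<bullet> x = r\<^sup>2" unfolding r_def by (rule dot_square_norm)
      have r: "0 < r" "r < R" unfolding r_def using x True by auto
      have \<tau>: "\<tau> > 0" unfolding \<tau>_def using in_ball[of x] True xx by simp
      have "\<bar>e k x\<bar> \<le> 1"
        using flat_exp_bounds(1)[OF \<delta>[of k], of 0 \<tau>] flat_exp_bounds(2)[OF \<delta>[of k], of \<tau>]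
        by (simp add: e_def \<tau>_def xx)
      then have 1: "\<bar>e k x * D r\<bar> \<le> 1 * M2"
        unfolding abs_mult using M2(2)[of r] r by (intro mult_mono) auto
      have f0: "f k x \<ge> 0" using flat_exp_bounds(1)[OF \<delta>[of k]] by (simp add: f_def)
      have tf: "\<tau> * f k x \<le> 1"
        using flat_exp_bounds(3)[OF \<delta>[of k], of \<tau>] \<tau> by (simp add: f_def \<tau>_def xx)
      have zr: "\<bar>z r\<bar> \<le> C * \<tau>"
        using z_bd[of "r\<^sup>2"] r \<tau> by (simp add: \<tau>_def)
      have z'r: "\<bar>z' r / r\<bar> \<le> 2 * C"
        using \<omega>_bd[of "r\<^sup>2"] \<omega>(3)[of r] r \<tau> by (simp add: \<tau>_def abs_mult)
      have "\<bar>z r\<bar> * \<bar>z' r / r\<bar> * f k x \<le> (C * \<tau>) * (2 * C) * f k x"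
        using zr z'r f0 C \<tau> by (intro mult_right_mono mult_mono) auto
      also have "\<dots> = C * (2 * C) * (\<tau> * f k x)" by simp
      also have "\<dots> \<le> C * (2 * C) * 1" using tf C by (intro mult_left_mono) auto
      finally have zz: "\<bar>z r\<bar> * \<bar>z' r / r\<bar> * f k x \<le> C * (2 * C)" by simp
      have "\<bar>K r * (- 2 * f k x * (x \<bullet> x))\<bar> = \<bar>vol_density r\<bar> * (\<bar>z r\<bar> * \<bar>z' r / r\<bar> * f k x) * (2 * r\<^sup>2)"
        unfolding K_def xx using f0 by (simp add: abs_mult)
      also have "\<dots> \<le> M1 * (C * (2 * C)) * (2 * R\<^sup>2)"
        by (rule mult_mono[OF mult_mono[OF M1(2) zz]]) (use M1(1) r f0 C in \<open>auto intro: power_mono\<close>)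
      finally show ?thesis using 1 True abs_triangle_ineq[of "e k x * D r" "K r * (- 2 * f k x * (x \<bullet> x))"]
        unfolding r_def by simp
    qed
  next
    fix x :: "real ^ 'n" assume x: "x \<noteq> 0"
    show "(\<lambda>k. e k x * D (norm x) + K (norm x) * (- 2 * f k x * (x \<bullet> x))) \<longlonglongrightarrow> indicator (ball 0 R) x * D (norm x)"
    proof (cases "norm x < R")
      case True
      then have \<tau>: "R\<^sup>2 - x \<bullet> x > 0" using in_ball by simp
      have "(\<lambda>k. e k x * D (norm x) + K (norm x) * (- 2 * f k x * (x \<bullet> x))) \<longlonglongrightarrow>
          1 * D (norm x) + K (norm x) * (- 2 * 0 * (x \<bullet> x))"
        unfolding e_def f_def by (intro tendsto_intros flat_exp_limits[OF \<tau>])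
      then show ?thesis using True by simp
    qed (simp add: e_out)
  qed
  then have "(\<lambda>k::nat. 0) \<longlonglongrightarrow> (\<integral>x. indicator (ball 0 R) x * D (norm x) \<partial>(lborel :: (real ^ 'n) measure))"
    unfolding zero .
  from LIMSEQ_unique[OF this tendsto_const] show ?thesis by (simp add: D_def)
qed

text \<open>
  The stability inequality for \<open>z\<close> extended by zero outside the ball. The polynomials approximating \<open>z\<close>
  vanish on the boundary sphere, so one limit \<open>k \<rightarrow> \<infinity>\<close> can be taken simultaneously in the polynomial
  and in the cutoff, by dominated convergence.
\<close>

lemma stable_solution_tested_on_ball:
  assumes dim: "CARD('n::finite) = n" and z: "radial_poisson z z' q" and R: "R > 0" and zR: "z R = 0"
    and p: "p > 1" and U: "continuous_on {0<..} U" and A: "\<forall>r>0. \<bar>U r\<bar> \<le> A"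
    and stable: "stable_solution (model_metric \<psi>) p (\<lambda>x::real ^ 'n. U (norm x))"
  shows "p * (\<integral>x. indicator (ball 0 R) x * (vol_density (norm x) * (\<bar>U (norm x)\<bar> powr (p - 1) * (z (norm x))\<^sup>2)) \<partial>(lborel :: (real ^ 'n) measure))
    \<le> (\<integral>x. indicator (ball 0 R) x * (vol_density (norm x) * (z' (norm x))\<^sup>2) \<partial>(lborel :: (real ^ 'n) measure))"
proof -
  obtain \<omega> where \<omega>: "continuous_on {0..} \<omega>"
    "\<And>s. s > 0 \<Longrightarrow> ((\<lambda>s. z (sqrt s)) has_real_derivative \<omega> s) (at s)"
    "\<And>r. r > 0 \<Longrightarrow> z' r = 2 * r * \<omega> (r\<^sup>2)"
    using radial_poisson_square_variable[OF z] by blast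
  obtain P p' :: "nat \<Rightarrow> real \<Rightarrow> real" and C where C: "C > 0"
    and poly: "\<And>k. real_polynomial_function (P k)" "\<And>k. real_polynomial_function (p' k)"
    and P_deriv: "\<And>k s. (P k has_real_derivative p' k s) (at s)"
    and p'_bd: "\<And>k s. 0 \<le> s \<Longrightarrow> s \<le> R\<^sup>2 \<Longrightarrow> \<bar>p' k s\<bar> \<le> C"
    and P_bd: "\<And>k s. 0 \<le> s \<Longrightarrow> s \<le> R\<^sup>2 \<Longrightarrow> \<bar>P k s\<bar> \<le> C * (R\<^sup>2 - s)"
    and p'_lim: "\<And>s. 0 < s \<Longrightarrow> s \<le> R\<^sup>2 \<Longrightarrow> (\<lambda>k. p' k s) \<longlonglongrightarrow> \<omega> s"
    and P_lim: "\<And>s. 0 < s \<Longrightarrow> s \<le> R\<^sup>2 \<Longrightarrow> (\<lambda>k. P k s) \<longlonglongrightarrow> z (sqrt s)"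
  proof (rule polynomial_C1_approximation[of "R\<^sup>2" \<omega> "\<lambda>s. z (sqrt s)"])
    show "continuous_on {0..R\<^sup>2} \<omega>" by (rule continuous_on_subset[OF \<omega>(1)]) auto
  qed (use R zR \<omega>(2) that in auto)
  note cont = radial_poisson_continuous[OF z]
  define e where "e k x = flat_exp (1 / real (Suc k)) 0 (R\<^sup>2 - x \<bullet> x)" for k and x :: "real ^ 'n"
  define f where "f k x = 1 / real (Suc k) * flat_exp (1 / real (Suc k)) 2 (R\<^sup>2 - x \<bullet> x)" for k and x :: "real ^ 'n"
  \<comment> \<open>Half the factor of \<open>x\<close> in the Euclidean gradient of \<open>\<phi> k\<close>.\<close>
  define \<eta> where "\<eta> k x = p' k (x \<bullet> x) * e k x - P k (x \<bullet> x) * f k x" for k and x :: "real ^ 'n"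
  define \<phi> where "\<phi> k x = P k (x \<bullet> x) * e k x" for k and x :: "real ^ 'n"
  have \<delta>: "1 / real (Suc k) > 0" for k by simp
  have in_ball: "R\<^sup>2 - x \<bullet> x > 0 \<longleftrightarrow> norm x < R" for x :: "real ^ 'n"
    by (rule in_ball_iff_inner[OF R])
  have test: "test_function (\<phi> k)" for k
    unfolding \<phi>_def[abs_def] e_def[abs_def] by (rule test_function_radial_bump[OF \<delta> poly(1)])
  have deriv: "(\<phi> k has_derivative (\<lambda>v. ((2 * \<eta> k x) *\<^sub>R x) \<bullet> v)) (at x)" for k x
    unfolding \<phi>_def[abs_def] \<eta>_def e_def[abs_def] f_def by (rule has_derivative_radial_bump[OF \<delta> P_deriv])
  have out: "e k x = 0" "f k x = 0" if "norm x \<ge> R" for k x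
    using in_ball[of x] that by (auto simp: e_def f_def flat_exp_def)
  have energy: "dirichlet_energy (\<phi> k) = (\<integral>x. vol_density (norm x) * (2 * \<eta> k x * norm x)\<^sup>2 \<partial>lborel)" for k
  proof -
    have "vol_density (norm x) * ((((2 * \<eta> k x) *\<^sub>R x) \<bullet> sgn x)\<^sup>2 + (norm x / \<psi> (norm x))\<^sup>2 *
        (((2 * \<eta> k x) *\<^sub>R x) \<bullet> ((2 * \<eta> k x) *\<^sub>R x) - (((2 * \<eta> k x) *\<^sub>R x) \<bullet> sgn x)\<^sup>2)) =
        vol_density (norm x) * (2 * \<eta> k x * norm x)\<^sup>2" for x
    proof -
      have "x \<bullet> sgn x = norm x"
        by (cases "x = 0") (simp_all add: sgn_div_norm dot_square_norm power2_eq_square)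
      then have s: "((2 * \<eta> k x) *\<^sub>R x) \<bullet> sgn x = 2 * \<eta> k x * norm x" by simp
      have "((2 * \<eta> k x) *\<^sub>R x) \<bullet> ((2 * \<eta> k x) *\<^sub>R x) = (2 * \<eta> k x * norm x)\<^sup>2"
        by (simp add: dot_square_norm power2_eq_square)
      then show ?thesis unfolding s by simp
    qed
    then show ?thesis using dirichlet_energy_test_function(2)[OF dim test deriv, of k] by (simp only:)
  qed
  obtain M where M: "M > 0" "\<And>r. 0 < r \<Longrightarrow> r \<le> R \<Longrightarrow> \<bar>vol_density r\<bar> \<le> M"
    using bounded_on_if_limit_at_right[OF vol_density_continuous vol_density_limit] by blast
  have [measurable]: "(\<lambda>x::real ^ 'n. z (norm x)) \<in> borel_measurable borel"
    "(\<lambda>x::real ^ 'n. z' (norm x)) \<in> borel_measurable borel"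
    "(\<lambda>x::real ^ 'n. U (norm x)) \<in> borel_measurable borel"
    "(\<lambda>x::real ^ 'n. vol_density (norm x)) \<in> borel_measurable borel" "ball (0::real ^ 'n) R \<in> sets borel"
    by (auto intro: borel_measurable_radial cont U vol_density_continuous)
  have flat_meas[measurable]: "flat_exp \<delta> j \<in> borel_measurable borel" for \<delta> j
    unfolding flat_exp_def[abs_def] by measurable
  have [measurable]: "P k \<in> borel_measurable borel" "p' k \<in> borel_measurable borel" for k
    using poly[of k] by (auto intro!: borel_measurable_continuous_onI continuous_on_polymonial_function
        simp: real_polynomial_function_eq)
  have [measurable]: "e k \<in> borel_measurable borel" "f k \<in> borel_measurable borel" for k
    unfolding e_def[abs_def] f_def[abs_def] by measurable
  have e01: "0 \<le> e k x" "e k x \<le> 1" "f k x \<ge> 0" for k x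
    using flat_exp_bounds(1,2)[OF \<delta>[of k]] flat_exp_bounds(1)[OF \<delta>[of k]] by (auto simp: e_def f_def)
  have lim1: "(\<lambda>k. \<integral>x. vol_density (norm x) * (2 * \<eta> k x * norm x)\<^sup>2 \<partial>lborel) \<longlonglongrightarrow>
    (\<integral>x. indicator (ball 0 R) x * (vol_density (norm x) * (z' (norm x))\<^sup>2) \<partial>(lborel :: (real ^ 'n) measure))"
  proof (rule integral_limit_bounded_support[where R = R and M = "M * (2 * (2 * C) * R)\<^sup>2"])
    show "(\<lambda>x. vol_density (norm x) * (2 * \<eta> k x * norm x)\<^sup>2) \<in> borel_measurable borel" for k
      unfolding \<eta>_def by measurable
  next
    fix k and x :: "real ^ 'n" assume x: "x \<noteq> 0"
    show "\<bar>vol_density (norm x) * (2 * \<eta> k x * norm x)\<^sup>2\<bar> \<le> M * (2 * (2 * C) * R)\<^sup>2 * indicator (cball 0 R) x"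
    proof (cases "norm x < R")
      case False
      then show ?thesis using out[of x k] M by (simp add: \<eta>_def indicator_def)
    next
      case True
      define \<tau> where "\<tau> = R\<^sup>2 - x \<bullet> x"
      have \<tau>: "\<tau> > 0" unfolding \<tau>_def using in_ball[of x] True by simp
      then have s: "0 \<le> x \<bullet> x" "x \<bullet> x \<le> R\<^sup>2" unfolding \<tau>_def by auto
      have "\<bar>p' k (x \<bullet> x) * e k x\<bar> \<le> C * 1"
        unfolding abs_mult using p'_bd[OF s] e01[of k x] C by (intro mult_mono) auto
      moreover have "\<bar>P k (x \<bullet> x) * f k x\<bar> \<le> C"
      proof -
        have "\<bar>P k (x \<bullet> x) * f k x\<bar> \<le> (C * \<tau>) * f k x"
          unfolding abs_mult \<tau>_def using P_bd[OF s] e01[of k x] by (simp add: mult_right_mono)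
        also have "\<dots> = C * (\<tau> * f k x)" by simp
        also have "\<dots> \<le> C * 1"
          using flat_exp_bounds(3)[OF \<delta>[of k], of \<tau>] \<tau> C by (intro mult_left_mono) (auto simp: f_def \<tau>_def)
        finally show ?thesis by simp
      qed
      ultimately have "\<bar>\<eta> k x\<bar> \<le> 2 * C" unfolding \<eta>_def by linarith
      then have "\<bar>2 * \<eta> k x * norm x\<bar> \<le> 2 * (2 * C) * R"
        unfolding abs_mult using True C by (intro mult_mono) auto
      then have "\<bar>2 * \<eta> k x * norm x\<bar>\<^sup>2 \<le> (2 * (2 * C) * R)\<^sup>2" by (rule power_mono) simp
      then have "(2 * \<eta> k x * norm x)\<^sup>2 \<le> (2 * (2 * C) * R)\<^sup>2" by (simp only: power2_abs)
      then have "\<bar>vol_density (norm x)\<bar> * (2 * \<eta> k x * norm x)\<^sup>2 \<le> M * (2 * (2 * C) * R)\<^sup>2"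
        using M x True by (intro mult_mono) auto
      then show ?thesis using True by (simp add: abs_mult)
    qed
  next
    fix x :: "real ^ 'n" assume x: "x \<noteq> 0"
    show "(\<lambda>k. vol_density (norm x) * (2 * \<eta> k x * norm x)\<^sup>2) \<longlonglongrightarrow>
        indicator (ball 0 R) x * (vol_density (norm x) * (z' (norm x))\<^sup>2)"
    proof (cases "norm x < R")
      case True
      then have \<tau>: "R\<^sup>2 - x \<bullet> x > 0" using in_ball by simp
      have s: "0 < x \<bullet> x" "x \<bullet> x \<le> R\<^sup>2" using x \<tau> by auto
      have "(\<lambda>k. \<eta> k x) \<longlonglongrightarrow> \<omega> (x \<bullet> x) * 1 - z (sqrt (x \<bullet> x)) * 0"
        unfolding \<eta>_def e_def f_def
        by (intro tendsto_diff tendsto_mult p'_lim P_lim s flat_exp_limits[OF \<tau>])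
      then have "(\<lambda>k. vol_density (norm x) * (2 * \<eta> k x * norm x)\<^sup>2) \<longlonglongrightarrow>
          vol_density (norm x) * (2 * (\<omega> (x \<bullet> x) * 1 - z (sqrt (x \<bullet> x)) * 0) * norm x)\<^sup>2"
        by (intro tendsto_mult tendsto_power tendsto_const)
      then show ?thesis
        using True x \<omega>(3)[of "norm x"] by (simp add: dot_square_norm mult_ac)
    qed (simp add: out \<eta>_def)
  qed measurable
  have lim2: "(\<lambda>k. \<integral>x. vol_density (norm x) * (\<bar>U (norm x)\<bar> powr (p - 1) * (\<phi> k x)\<^sup>2) \<partial>lborel) \<longlonglongrightarrow>
    (\<integral>x. indicator (ball 0 R) x * (vol_density (norm x) * (\<bar>U (norm x)\<bar> powr (p - 1) * (z (norm x))\<^sup>2)) \<partial>(lborel :: (real ^ 'n) measure))"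
  proof (rule integral_limit_bounded_support[where R = R and M = "M * (A powr (p - 1) * (C * R\<^sup>2)\<^sup>2)"])
    show "(\<lambda>x. vol_density (norm x) * (\<bar>U (norm x)\<bar> powr (p - 1) * (\<phi> k x)\<^sup>2)) \<in> borel_measurable borel" for k
      unfolding \<phi>_def by measurable
  next
    fix k and x :: "real ^ 'n" assume x: "x \<noteq> 0"
    show "\<bar>vol_density (norm x) * (\<bar>U (norm x)\<bar> powr (p - 1) * (\<phi> k x)\<^sup>2)\<bar> \<le>
        M * (A powr (p - 1) * (C * R\<^sup>2)\<^sup>2) * indicator (cball 0 R) x"
    proof (cases "norm x < R")
      case False
      then show ?thesis using out[of x k] M by (simp add: \<phi>_def indicator_def)
    next
      case True
      have s: "0 \<le> x \<bullet> x" "x \<bullet> x \<le> R\<^sup>2" using in_ball[of x] True by auto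
      have "C * (R\<^sup>2 - x \<bullet> x) \<le> C * R\<^sup>2" using s C by (intro mult_left_mono) auto
      then have "\<bar>P k (x \<bullet> x)\<bar> \<le> C * R\<^sup>2" using P_bd[OF s, of k] by linarith
      then have "\<bar>\<phi> k x\<bar> \<le> (C * R\<^sup>2) * 1"
        unfolding \<phi>_def abs_mult using e01[of k x] C by (intro mult_mono) auto
      then have "\<bar>\<phi> k x\<bar>\<^sup>2 \<le> (C * R\<^sup>2)\<^sup>2" by (intro power_mono) auto
      moreover have "\<bar>U (norm x)\<bar> powr (p - 1) \<le> A powr (p - 1)"
        using A[rule_format, of "norm x"] x p by (intro powr_mono2) auto
      ultimately have "\<bar>vol_density (norm x)\<bar> * (\<bar>U (norm x)\<bar> powr (p - 1) * (\<phi> k x)\<^sup>2) \<le> M * (A powr (p - 1) * (C * R\<^sup>2)\<^sup>2)"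
        using M x True by (intro mult_mono) auto
      then show ?thesis using True by (simp add: abs_mult)
    qed
  next
    fix x :: "real ^ 'n" assume x: "x \<noteq> 0"
    show "(\<lambda>k. vol_density (norm x) * (\<bar>U (norm x)\<bar> powr (p - 1) * (\<phi> k x)\<^sup>2)) \<longlonglongrightarrow>
        indicator (ball 0 R) x * (vol_density (norm x) * (\<bar>U (norm x)\<bar> powr (p - 1) * (z (norm x))\<^sup>2))"
    proof (cases "norm x < R")
      case True
      then have \<tau>: "R\<^sup>2 - x \<bullet> x > 0" using in_ball by simp
      have s: "0 < x \<bullet> x" "x \<bullet> x \<le> R\<^sup>2" using x \<tau> by auto
      have "(\<lambda>k. \<phi> k x) \<longlonglongrightarrow> z (sqrt (x \<bullet> x)) * 1"
        unfolding \<phi>_def e_def by (intro tendsto_mult P_lim s flat_exp_limits[OF \<tau>])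
      then have "(\<lambda>k. vol_density (norm x) * (\<bar>U (norm x)\<bar> powr (p - 1) * (\<phi> k x)\<^sup>2)) \<longlonglongrightarrow>
          vol_density (norm x) * (\<bar>U (norm x)\<bar> powr (p - 1) * (z (sqrt (x \<bullet> x)) * 1)\<^sup>2)"
        by (intro tendsto_mult tendsto_power tendsto_const)
      then show ?thesis using True by (simp add: dot_square_norm)
    qed (simp add: out \<phi>_def)
  qed measurable
  show ?thesis
  proof (rule LIMSEQ_le[OF tendsto_mult_left[OF lim2] lim1], intro exI[of _ 0] allI impI)
    fix k
    show "p * potential_energy p U (\<phi> k) \<le>
        (\<integral>x. vol_density (norm x) * (2 * \<eta> k x * norm x)\<^sup>2 \<partial>lborel)"
      using stable test[of k] unfolding stable_solution_radial_iff[OF dim p U A] energy[symmetric] by blast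
  qed
qed

section \<open>Comparison with a stable solution\<close>

text \<open>
  By Green's identity the energy of \<open>z\<close> on the ball is the integral of \<open>q z\<close>, which the hypothesis puts
  strictly below the potential term.
\<close>

lemma unstable_if_subsolution_vanishes:
  assumes dim: "CARD('n::finite) = n" and z: "radial_poisson z z' q" and R: "R > 0" and zR: "z R = 0"
    and p: "p > 1" and U: "continuous_on {0..} U" and A: "\<forall>r>0. \<bar>U r\<bar> \<le> A"
    and sub: "\<And>r. 0 < r \<Longrightarrow> r < R \<Longrightarrow> q r * z r < p * \<bar>U r\<bar> powr (p - 1) * (z r)\<^sup>2"
  shows "unstable_solution (model_metric \<psi>) p (\<lambda>x::real ^ 'n. U (norm x))"
proof
  assume stable: "stable_solution (model_metric \<psi>) p (\<lambda>x::real ^ 'n. U (norm x))"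
  have pos_part: "continuous_on {0<..} g" "(g \<longlongrightarrow> g 0) (at_right 0)" if "continuous_on {0..} g" for g :: "real \<Rightarrow> real"
  proof -
    show "continuous_on {0<..} g" using that by (rule continuous_on_subset) auto
    show "(g \<longlongrightarrow> g 0) (at_right 0)" by (rule limit_at_right_if_continuous[OF that])
  qed
  have zc: "continuous_on {0..} z" and qc: "continuous_on {0..} q"
    using z unfolding radial_poisson_def by auto
  define h1 where "h1 r = vol_density r * (z' r)\<^sup>2" for r
  define h2 where "h2 r = vol_density r * (q r * z r)" for r
  define h3 where "h3 r = vol_density r * (\<bar>U r\<bar> powr (p - 1) * (z r)\<^sup>2)" for r
  define I where "I h = (\<integral>x. indicator (ball 0 R) x * h (norm x) \<partial>(lborel :: (real ^ 'n) measure))" for h :: "real \<Rightarrow> real"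
  have int1: "integrable lborel (\<lambda>x::real ^ 'n. indicator (ball 0 R) x * h1 (norm x))"
    unfolding h1_def
    by (rule integrable_radial_on_ball[where l = "1 * 0\<^sup>2"])
      (intro continuous_intros tendsto_intros vol_density_continuous radial_poisson_continuous[OF z] vol_density_limit radial_poisson_limits[OF z])+
  have int2: "integrable lborel (\<lambda>x::real ^ 'n. indicator (ball 0 R) x * h2 (norm x))"
    unfolding h2_def
    by (rule integrable_radial_on_ball[where l = "1 * (q 0 * z 0)"])
      (intro continuous_intros tendsto_intros vol_density_continuous pos_part zc qc vol_density_limit)+
  have powr_c: "continuous_on {0..} (\<lambda>r. \<bar>U r\<bar> powr (p - 1) * (z r)\<^sup>2)"
    using p by (intro continuous_intros continuous_on_powr' U zc) auto
  have int3: "integrable lborel (\<lambda>x::real ^ 'n. indicator (ball 0 R) x * h3 (norm x))"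
    unfolding h3_def
    by (rule integrable_radial_on_ball[where l = "1 * (\<bar>U 0\<bar> powr (p - 1) * (z 0)\<^sup>2)"])
      (intro continuous_on_mult vol_density_continuous tendsto_mult[OF vol_density_limit] pos_part[OF powr_c])+
  \<comment> \<open>Positive inside the ball off the pole, but with integral at most \<open>0\<close>.\<close>
  define F where "F x = p * (indicator (ball 0 R) x * h3 (norm x)) - indicator (ball 0 R) x * h2 (norm x)" for x :: "real ^ 'n"
  have F_int: "integrable lborel F"
    unfolding F_def using int2 int3 by simp
  have F_pos: "F x > 0" if "x \<noteq> 0" "norm x < R" for x
  proof -
    have "vol_density (norm x) * (q (norm x) * z (norm x)) <
        vol_density (norm x) * (p * \<bar>U (norm x)\<bar> powr (p - 1) * (z (norm x))\<^sup>2)"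
      using sub[of "norm x"] vol_density_pos[of "norm x"] that by simp
    then show ?thesis using that unfolding F_def h2_def h3_def by (simp add: mult_ac)
  qed
  have F_nonneg: "AE x in lborel. 0 \<le> F x"
  proof (rule AE_nonzero)
    show "0 \<le> F x" if "x \<noteq> 0" for x
      using F_pos[OF that] by (cases "norm x < R") (auto simp: F_def)
  qed
  have "I (\<lambda>r. vol_density r * ((z' r)\<^sup>2 - q r * z r)) = 0"
    unfolding I_def by (rule green_identity_on_ball[OF dim z R zR])
  moreover have "I (\<lambda>r. vol_density r * ((z' r)\<^sup>2 - q r * z r)) = I h1 - I h2"
    unfolding I_def using int1 int2
    by (subst Bochner_Integration.integral_diff[symmetric]) (auto simp: h1_def h2_def algebra_simps)
  ultimately have "I h1 = I h2" by simp
  moreover have "p * I h3 \<le> I h1"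
    using stable_solution_tested_on_ball[OF dim z R zR p pos_part(1)[OF U] A stable]
    unfolding I_def h1_def h3_def .
  moreover have "integral\<^sup>L lborel F = p * I h3 - I h2"
    unfolding F_def I_def using int2 int3 by simp
  moreover have "integral\<^sup>L lborel F \<ge> 0" by (rule integral_nonneg_AE[OF F_nonneg])
  ultimately have "integral\<^sup>L lborel F = 0" by linarith
  then have "AE x in lborel. F x = 0"
    using integral_nonneg_eq_0_iff_AE[OF F_int F_nonneg] by blast
  moreover have "AE x in lborel. x \<noteq> (0::real ^ 'n)" by (rule AE_nonzero)
  ultimately have "AE x in lborel. x \<notin> ball (0::real ^ 'n) R"
    by eventually_elim (use F_pos in fastforce)
  then have "emeasure lborel (ball (0::real ^ 'n) R) = 0"
    by (subst (asm) AE_iff_measurable[where N = "ball 0 R"]) auto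
  moreover have "emeasure lborel (ball (0::real ^ 'n) R) \<noteq> 0"
    using content_ball_pos[OF R, of "0::real ^ 'n"] by (auto simp: measure_def)
  ultimately show False by simp
qed

text \<open>
  At the first radius where the ordering \<open>0 < v < u\<close> fails, either \<open>v\<close> or \<open>u - v\<close> has its first zero, and
  that function contradicts the stability of \<open>u\<close>. For \<open>v\<close> the strict inequality needed is
  \<open>v\<^sup>p\<^sup>-\<^sup>1 < p u\<^sup>p\<^sup>-\<^sup>1\<close>, for \<open>u - v\<close> it is strict convexity.
\<close>

lemma stable_solution_dominates_smaller:
  assumes dim: "CARD('n::finite) = n" and p: "p > 1" and init: "0 < v 0" "v 0 < u 0"
    and u: "radial_poisson u u' (\<lambda>r. \<bar>u r\<bar> powr (p - 1) * u r)"
    and v: "radial_poisson v v' (\<lambda>r. \<bar>v r\<bar> powr (p - 1) * v r)"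
    and stable: "stable_solution (model_metric \<psi>) p (\<lambda>x::real ^ 'n. u (norm x))"
    and r: "r \<ge> 0"
  shows "0 < v r \<and> v r < u r"
proof (rule ccontr)
  assume bad: "\<not> (0 < v r \<and> v r < u r)"
  \<comment> \<open>The ordering holds exactly where \<open>m\<close> is positive.\<close>
  define m where "m s = min (v s) (u s - v s)" for s
  have u_cont: "continuous_on {0..} u" and v_cont: "continuous_on {0..} v"
    using u v unfolding radial_poisson_def by auto
  have m_cont: "continuous_on {0..} m"
    unfolding m_def by (intro continuous_intros u_cont v_cont)
  have m0: "m 0 > 0" unfolding m_def using init by simp
  have zero: "\<exists>s. 0 \<le> s \<and> s \<le> t \<and> m s = 0" if "t \<ge> 0" "m t \<le> 0" for t
    using IVT2'[of m t 0 0] that m0 continuous_on_subset[OF m_cont, of "{0..t}"] by auto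
  define Z where "Z = {s \<in> {0..r}. m s = 0}"
  have "compact Z"
  proof -
    have "closed Z" unfolding Z_def
      by (rule continuous_closed_preimage_constant) (auto intro: continuous_on_subset[OF m_cont])
    moreover have "bounded Z" by (rule bounded_subset[of "{0..r}"]) (auto simp: Z_def)
    ultimately show ?thesis by (simp add: compact_eq_bounded_closed)
  qed
  moreover have "Z \<noteq> {}"
  proof -
    have "m r \<le> 0" using bad unfolding m_def by auto
    then show ?thesis using zero[OF r] unfolding Z_def by auto
  qed
  ultimately obtain R where R: "R \<in> Z" "\<And>s. s \<in> Z \<Longrightarrow> R \<le> s"
    using compact_attains_inf[of Z] by auto
  have mR: "m R = 0" and R0: "R > 0" and Rr: "R \<le> r"
    using R(1) m0 unfolding Z_def by (auto simp: less_le)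
  have before: "0 < v s \<and> v s < u s" if s: "0 \<le> s" "s < R" for s
  proof -
    have "m s > 0"
    proof (rule ccontr)
      assume "\<not> m s > 0"
      then obtain t where "0 \<le> t" "t \<le> s" "m t = 0" using zero[of s] s by auto
      then have "t \<in> Z" using s Rr unfolding Z_def by auto
      then show False using R(2) \<open>t \<le> s\<close> s by force
    qed
    then show ?thesis unfolding m_def by auto
  qed
  have A: "\<forall>r>0. \<bar>u r\<bar> \<le> u 0"
    using lane_emden_bound[OF p _ _ u] init by auto
  consider "v R = 0" | "u R - v R = 0" using mR unfolding m_def min_def by (auto split: if_splits)
  then have "unstable_solution (model_metric \<psi>) p (\<lambda>x::real ^ 'n. u (norm x))"
  proof cases
    case 1
    show ?thesis
    proof (rule unstable_if_subsolution_vanishes[OF dim v R0 1 p u_cont A])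
      fix s assume "0 < s" "s < R"
      then have s: "0 < v s" "v s < u s" using before[of s] by auto
      have "v s powr (p - 1) < u s powr (p - 1)" using s p by (intro powr_less_mono2) auto
      also have "\<dots> \<le> p * u s powr (p - 1)"
        using p mult_right_mono[of 1 p "u s powr (p - 1)"] by simp
      finally show "\<bar>v s\<bar> powr (p - 1) * v s * v s < p * \<bar>u s\<bar> powr (p - 1) * (v s)\<^sup>2"
        using s by (simp add: power2_eq_square mult.assoc)
    qed
  next
    case 2
    show ?thesis
    proof (rule unstable_if_subsolution_vanishes[OF dim radial_poisson_diff[OF u v] R0 2 p u_cont A])
      fix s assume "0 < s" "s < R"
      then have s: "0 < v s" "v s < u s" using before[of s] by auto
      have "(u s powr (p - 1) * u s - v s powr (p - 1) * v s) * (u s - v s) <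
          (p * u s powr (p - 1) * (u s - v s)) * (u s - v s)"
        using s power_nonlinearity_convex[OF p s] by (intro mult_strict_right_mono) auto
      then show "(\<bar>u s\<bar> powr (p - 1) * u s - \<bar>v s\<bar> powr (p - 1) * v s) * (u s - v s) <
          p * \<bar>u s\<bar> powr (p - 1) * (u s - v s)\<^sup>2"
        using s by (simp add: power2_eq_square mult.assoc)
    qed
  qed
  with stable show False by simp
qed

end

section \<open>The stability threshold\<close>

lemma one_less_p_c:
  assumes "n \<ge> 11"
  shows "1 < p_c n"
proof -
  define m where "m = real n"
  have m: "m \<ge> 11" unfolding m_def using assms by simp
  have "(m - 2) * (m - 10) < (m - 2)\<^sup>2 - 4 * m + 8 * sqrt (m - 1)"
  proof -
    have "(m - 2)\<^sup>2 - 4 * m - (m - 2) * (m - 10) = 4 * m - 16"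
      by (simp add: power2_eq_square algebra_simps)
    moreover have "sqrt (m - 1) \<ge> 0" using m by simp
    ultimately show ?thesis using m by linarith
  qed
  then show ?thesis
    unfolding p_c_def m_def[symmetric] using m by simp
qed

lemma downward_closed_threshold:
  fixes S :: "real set"
  assumes "A > 0" and small: "\<And>\<alpha>. 0 \<le> \<alpha> \<Longrightarrow> \<alpha> \<le> A \<Longrightarrow> \<alpha> \<in> S"
    and down: "\<And>\<alpha> \<beta>. \<alpha> \<in> S \<Longrightarrow> 0 \<le> \<beta> \<Longrightarrow> \<beta> < \<alpha> \<Longrightarrow> \<beta> \<in> S"
    and closed: "\<And>\<beta> \<alpha>. (\<And>k. \<beta> k \<in> S) \<Longrightarrow> (\<And>k. 0 \<le> \<beta> k \<and> \<beta> k \<le> \<alpha>) \<Longrightarrow> \<beta> \<longlonglongrightarrow> \<alpha> \<Longrightarrow> \<alpha> \<in> S"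
  shows "\<exists>\<alpha>\<^sub>0::ereal. 0 < \<alpha>\<^sub>0 \<and> ((\<alpha>\<^sub>0 = \<infinity> \<and> (\<forall>\<alpha>\<ge>0. \<alpha> \<in> S)) \<or>
    (\<alpha>\<^sub>0 < \<infinity> \<and> (\<forall>\<alpha>\<ge>0. ereal \<alpha> \<le> \<alpha>\<^sub>0 \<longrightarrow> \<alpha> \<in> S) \<and> (\<forall>\<alpha>. ereal \<alpha> > \<alpha>\<^sub>0 \<longrightarrow> \<alpha> \<notin> S)))"
proof (cases "\<forall>\<alpha>\<ge>0. \<alpha> \<in> S")
  case True
  then show ?thesis by (intro exI[of _ \<infinity>]) auto
next
  case False
  then obtain a where a: "a \<ge> 0" "a \<notin> S" by auto
  define s where "s = Sup S"
  have upper: "\<alpha> \<le> a" if "\<alpha> \<in> S" for \<alpha>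
    using down[OF that a(1)] a(2) by force
  have bdd: "bdd_above S" using upper by (auto simp: bdd_above_def)
  have "A \<in> S" using small \<open>A > 0\<close> by simp
  then have s: "s > 0" unfolding s_def using cSup_upper[OF _ bdd] \<open>A > 0\<close> by fastforce
  have below: "\<alpha> \<in> S" if "0 \<le> \<alpha>" "\<alpha> < s" for \<alpha>
    using less_cSupD[of S \<alpha>] that \<open>A \<in> S\<close> down unfolding s_def by blast
  have "s \<in> S"
  proof (rule closed[of "\<lambda>k. s * (1 - 1 / real (Suc k))"])
    fix k
    have "1 / real (Suc k) \<le> 1" "1 / real (Suc k) > 0" by simp_all
    then have "0 \<le> s * (1 - 1 / real (Suc k))" "s * (1 - 1 / real (Suc k)) < s"
      using s by (auto simp: mult_less_cancel_left2)
    then show "s * (1 - 1 / real (Suc k)) \<in> S" "0 \<le> s * (1 - 1 / real (Suc k)) \<and> s * (1 - 1 / real (Suc k)) \<le> s"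
      using below by auto
  next
    have "(\<lambda>k. 1 / real (Suc k)) \<longlonglongrightarrow> 0"
      using LIMSEQ_inverse_real_of_nat by (simp add: inverse_eq_divide)
    then have "(\<lambda>k. s * (1 - 1 / real (Suc k))) \<longlonglongrightarrow> s * (1 - 0)" by (intro tendsto_intros)
    then show "(\<lambda>k. s * (1 - 1 / real (Suc k))) \<longlonglongrightarrow> s" by simp
  qed
  moreover have "\<alpha> \<notin> S" if "\<alpha> > s" for \<alpha>
    using cSup_upper[OF _ bdd, of \<alpha>] that unfolding s_def by force
  ultimately show ?thesis
    using s below by (intro exI[of _ "ereal s"]) (auto simp: le_less)
qed

theorem theorem2p12:
  fixes p :: real and \<psi> \<psi>' \<psi>'' :: "real \<Rightarrow> real" and u :: "real \<Rightarrow> real \<Rightarrow> real"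
  assumes "CARD('n::finite) \<ge> 11"
    and "p \<ge> p_c CARD('n)"
    and "\<And>r. r \<ge> 0 \<Longrightarrow> (\<psi> has_real_derivative \<psi>' r) (at r within {0..})"
    and "\<And>r. r \<ge> 0 \<Longrightarrow> (\<psi>' has_real_derivative \<psi>'' r) (at r within {0..})"
    and "continuous_on {0..} \<psi>''"
    and "\<And>r. r > 0 \<Longrightarrow> \<psi> r > 0"
    and "\<psi> 0 = 0" and "\<psi>'' 0 = 0" and "\<psi>' 0 = 1"
    and "\<And>r. r > 0 \<Longrightarrow> \<psi>' r \<ge> 0"
    and "Liminf at_top (\<lambda>r. ereal (\<psi>' r / \<psi> r)) > 0"
    and "\<And>\<alpha>. \<alpha> \<ge> 0 \<Longrightarrow> radial_solution CARD('n) p \<psi> \<alpha> (u \<alpha>)"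
  shows "\<exists>\<alpha>\<^sub>0::ereal. 0 < \<alpha>\<^sub>0 \<and>
    ((\<alpha>\<^sub>0 = \<infinity> \<and> (\<forall>\<alpha>\<ge>0. stable_solution (model_metric \<psi>) p (\<lambda>x::real^'n. u \<alpha> (norm x)))) \<or>
     (\<alpha>\<^sub>0 < \<infinity> \<and>
      (\<forall>\<alpha>\<ge>0. ereal \<alpha> \<le> \<alpha>\<^sub>0 \<longrightarrow> stable_solution (model_metric \<psi>) p (\<lambda>x::real^'n. u \<alpha> (norm x))) \<and>
      (\<forall>\<alpha>. ereal \<alpha> > \<alpha>\<^sub>0 \<longrightarrow> unstable_solution (model_metric \<psi>) p (\<lambda>x::real^'n. u \<alpha> (norm x)))))"
proof -
  have p: "p > 1" using one_less_p_c[OF assms(1)] assms(2) by linarith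
  interpret radial_model "CARD('n)" \<psi> \<psi>'
  proof
    show "continuous_on {0..} \<psi>'"
      by (rule DERIV_continuous_on[where D = \<psi>'']) (use assms(4) in simp)
  qed (use assms in auto)
  define stable where "stable \<alpha> \<longleftrightarrow> stable_solution (model_metric \<psi>) p (\<lambda>x::real^'n. u \<alpha> (norm x))" for \<alpha>
  obtain c where c: "0 < ereal c" "ereal c < Liminf at_top (\<lambda>r. ereal (\<psi>' r / \<psi> r))"
    using ereal_dense2[OF assms(11)] by blast
  have "eventually (\<lambda>r. r > 0 \<and> c < \<psi>' r / \<psi> r) at_top"
    using less_LiminfD[OF c(2)] eventually_gt_at_top[of 0] by eventually_elim simp
  then obtain R0 where R0: "\<And>r. r \<ge> R0 \<Longrightarrow> r > 0 \<and> c < \<psi>' r / \<psi> r"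
    unfolding eventually_at_top_linorder by blast
  have growth: "c * \<psi> r \<le> \<psi>' r" if "r \<ge> R0" for r
    using R0[OF that] warp_pos[of r] by (simp add: less_divide_eq)
  have c0: "c > 0" using c(1) by simp
  obtain A where A: "A > 0" and small: "\<And>U. continuous_on {0<..} U \<Longrightarrow> \<forall>r>0. \<bar>U r\<bar> \<le> A \<Longrightarrow>
      stable_solution (model_metric \<psi>) p (\<lambda>x::real ^ 'n. U (norm x))"
    by (rule stable_solution_small[of p c R0, OF refl p c0 growth]) (assumption | rule that)+
  have sol: "\<exists>v. u \<alpha> 0 = \<alpha> \<and> radial_poisson (u \<alpha>) v (\<lambda>r. \<bar>u \<alpha> r\<bar> powr (p - 1) * u \<alpha> r)" if "\<alpha> \<ge> 0" for \<alpha>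
    using radial_solution_poisson[OF p assms(12)[OF that]] by blast
  have init: "u \<alpha> 0 = \<alpha>" if "\<alpha> \<ge> 0" for \<alpha> using sol[OF that] by blast
  have cont: "continuous_on {0<..} (u \<alpha>)" if "\<alpha> \<ge> 0" for \<alpha>
  proof -
    have "continuous_on {0..} (u \<alpha>)" using sol[OF that] unfolding radial_poisson_def by blast
    then show ?thesis by (rule continuous_on_subset) auto
  qed
  have bound: "\<bar>u \<alpha> r\<bar> \<le> \<alpha>" if "\<alpha> \<ge> 0" "r \<ge> 0" for \<alpha> r
  proof -
    obtain v where "radial_poisson (u \<alpha>) v (\<lambda>r. \<bar>u \<alpha> r\<bar> powr (p - 1) * u \<alpha> r)" using sol[OF \<open>\<alpha> \<ge> 0\<close>] by blast
    from lane_emden_bound[OF p _ \<open>r \<ge> 0\<close> this] show ?thesis using init[OF \<open>\<alpha> \<ge> 0\<close>] \<open>\<alpha> \<ge> 0\<close> by simp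
  qed
  have stable_small: "stable \<alpha>" if "0 \<le> \<alpha>" "\<alpha> \<le> A" for \<alpha>
    unfolding stable_def
  proof (intro small[OF cont[OF that(1)]] allI impI)
    show "\<bar>u \<alpha> r\<bar> \<le> A" if "r > 0" for r
      using bound[OF \<open>0 \<le> \<alpha>\<close>, of r] \<open>\<alpha> \<le> A\<close> that by simp
  qed
  have stable_down: "stable \<beta>" if st: "stable \<alpha>" and \<alpha>: "\<alpha> \<ge> 0" and \<beta>: "0 \<le> \<beta>" "\<beta> < \<alpha>" for \<alpha> \<beta>
  proof (cases "\<beta> = 0")
    case True
    then show ?thesis using stable_small A by simp
  next
    case False
    obtain v where v: "radial_poisson (u \<alpha>) v (\<lambda>r. \<bar>u \<alpha> r\<bar> powr (p - 1) * u \<alpha> r)" using sol[OF \<alpha>] by blast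
    obtain w where w: "radial_poisson (u \<beta>) w (\<lambda>r. \<bar>u \<beta> r\<bar> powr (p - 1) * u \<beta> r)" using sol[OF \<beta>(1)] by blast
    have ord: "0 < u \<beta> r \<and> u \<beta> r < u \<alpha> r" if "r \<ge> 0" for r
      by (rule stable_solution_dominates_smaller[OF refl p _ _ v w st[unfolded stable_def] that])
        (use False \<alpha> \<beta> init in auto)
    show ?thesis
      unfolding stable_def
    proof (rule stable_solution_mono[OF refl p cont[OF \<beta>(1)] cont[OF \<alpha>] _ _ st[unfolded stable_def]])
      show "\<bar>u \<beta> r\<bar> \<le> \<bar>u \<alpha> r\<bar>" if "r > 0" for r using ord[of r] that by simp
      show "\<forall>r>0. \<bar>u \<alpha> r\<bar> \<le> \<alpha>" using bound[OF \<alpha>] by simp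
    qed
  qed
  have stable_closed: "stable \<alpha>"
    if st: "\<And>k. stable (\<beta> k)" and \<beta>: "\<And>k. 0 \<le> \<beta> k \<and> \<beta> k \<le> \<alpha>" and lim: "\<beta> \<longlonglongrightarrow> \<alpha>" for \<beta> \<alpha>
  proof -
    have \<alpha>: "\<alpha> \<ge> 0" using \<beta>[of 0] by linarith
    have "(\<lambda>k. u (\<beta> k) r) \<longlonglongrightarrow> u \<alpha> r" if r: "r > 0" for r
    proof -
      define E where "E = exp ((p * \<alpha> powr (p - 1) + 1) * r)"
      have le: "(u (\<beta> k) r - u \<alpha> r)\<^sup>2 \<le> (\<beta> k - \<alpha>)\<^sup>2 * E" for k
      proof -
        obtain v where v: "radial_poisson (u \<alpha>) v (\<lambda>r. \<bar>u \<alpha> r\<bar> powr (p - 1) * u \<alpha> r)" using sol[OF \<alpha>] by blast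
        obtain w where w: "radial_poisson (u (\<beta> k)) w (\<lambda>r. \<bar>u (\<beta> k) r\<bar> powr (p - 1) * u (\<beta> k) r)"
          using sol \<beta> by blast
        show ?thesis
          using lane_emden_continuous_dependence[OF p _ _ _ _ _ w v, of r \<alpha>] r \<alpha> \<beta>[of k] init[of "\<beta> k"] init[OF \<alpha>]
          unfolding E_def by simp
      qed
      have "(\<lambda>k. (\<beta> k - \<alpha>)\<^sup>2 * E) \<longlonglongrightarrow> (\<alpha> - \<alpha>)\<^sup>2 * E" by (intro tendsto_intros lim)
      then have "(\<lambda>k. (u (\<beta> k) r - u \<alpha> r)\<^sup>2) \<longlonglongrightarrow> 0"
        by (intro Lim_null_comparison[of "\<lambda>k. (u (\<beta> k) r - u \<alpha> r)\<^sup>2"]) (use le in auto)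
      from tendsto_real_sqrt[OF this]
      have "(\<lambda>k. u (\<beta> k) r - u \<alpha> r) \<longlonglongrightarrow> 0" by (simp add: tendsto_rabs_zero_iff)
      then show ?thesis by (rule LIM_zero_cancel)
    qed
    moreover have "\<forall>r>0. \<bar>u (\<beta> k) r\<bar> \<le> \<alpha>" for k
    proof (intro allI impI)
      show "\<bar>u (\<beta> k) r\<bar> \<le> \<alpha>" if "r > 0" for r
        using bound[of "\<beta> k" r] \<beta>[of k] that by simp
    qed
    ultimately show ?thesis
      unfolding stable_def using \<beta>
      by (intro stable_solution_limit[OF refl p cont cont[OF \<alpha>] _ _ st[unfolded stable_def]]) auto
  qed
  have "\<exists>\<alpha>\<^sub>0::ereal. 0 < \<alpha>\<^sub>0 \<and> ((\<alpha>\<^sub>0 = \<infinity> \<and> (\<forall>\<alpha>\<ge>0. \<alpha> \<in> {\<alpha>. \<alpha> \<ge> 0 \<and> stable \<alpha>})) \<or>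
    (\<alpha>\<^sub>0 < \<infinity> \<and> (\<forall>\<alpha>\<ge>0. ereal \<alpha> \<le> \<alpha>\<^sub>0 \<longrightarrow> \<alpha> \<in> {\<alpha>. \<alpha> \<ge> 0 \<and> stable \<alpha>}) \<and>
      (\<forall>\<alpha>. ereal \<alpha> > \<alpha>\<^sub>0 \<longrightarrow> \<alpha> \<notin> {\<alpha>. \<alpha> \<ge> 0 \<and> stable \<alpha>})))"
  proof (rule downward_closed_threshold[OF A])
    show "\<alpha> \<in> {\<alpha>. \<alpha> \<ge> 0 \<and> stable \<alpha>}"
      if "\<And>k. \<beta> k \<in> {\<alpha>. \<alpha> \<ge> 0 \<and> stable \<alpha>}" "\<And>k. 0 \<le> \<beta> k \<and> \<beta> k \<le> \<alpha>" "\<beta> \<longlonglongrightarrow> \<alpha>" for \<beta> \<alpha>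
      using stable_closed[of \<beta> \<alpha>] that(1,3) that(2) order_trans[of 0 "\<beta> 0" \<alpha>] by auto
  qed (use stable_small stable_down in auto)
  then obtain \<alpha>\<^sub>0 :: ereal where \<alpha>\<^sub>0: "0 < \<alpha>\<^sub>0"
    and alt: "(\<alpha>\<^sub>0 = \<infinity> \<and> (\<forall>\<alpha>\<ge>0. stable \<alpha>)) \<or> (\<alpha>\<^sub>0 < \<infinity> \<and>
      (\<forall>\<alpha>\<ge>0. ereal \<alpha> \<le> \<alpha>\<^sub>0 \<longrightarrow> stable \<alpha>) \<and> (\<forall>\<alpha>. ereal \<alpha> > \<alpha>\<^sub>0 \<longrightarrow> \<not> (\<alpha> \<ge> 0 \<and> stable \<alpha>)))"
    by auto
  have "\<alpha> \<ge> 0" if "ereal \<alpha> > \<alpha>\<^sub>0" for \<alpha>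
    using less_trans[OF \<alpha>\<^sub>0 that] by simp
  with \<alpha>\<^sub>0 alt show ?thesis
    unfolding stable_def[symmetric] by blast
qed

end
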